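(* The relations $\simeq_{rbr}$ and $\approx_{rb}$ (extended to $\mathbb{CCSP}_t$ expressions via closed substitutions) are full congruences for $\mathbb{CCSP}_t$.
   Context: $Act=A\uplus\{\tau,t\}$ ($A$ visible actions, $\tau$ hidden, $t$ time-out); $A_\tau:=A\cup\{\tau\}$. $\mathbb{CCSP}_t$: for a countable set $V$ of variables, expressions are $E::=0\mid x\mid\alpha.E\mid E+F\mid E\parallel_S F\mid\tau_I(E)\mid\mathcal R(E)\mid\theta_L^U(E)\mid\psi_X(E)\mid\langle y\mid\mathcal S\rangle$ with $x\in V$, $\alpha\in Act$, $S,I,L,U,X\subseteq A$, $L\subseteq U$, $\mathcal R\subseteq A\times A$ with each $\{b\mid(a,b)\in\mathcal R\}$ finite, $\mathcal S$ a recursive specification (a set $\{x=\mathcal S_x\mid x\in V_{\mathcal S}\}$, $V_{\mathcal S}\subseteq V$, each $\mathcal S_x$ an expression) and $y\in V_{\mathcal S}$. The $\mathcal S_x$ are subexpressions of $\langle y|\mathcal S\rangle$; a variable occurrence in $E$ is bound if it lies in a subexpression $\langle y|\mathcal S\rangle$ with $x\in V_{\mathcal S}$, else free. $E$ is invalid if it has a subexpression $\theta_L^U(F)$ or $\psi_X(F)$ with a variable occurrence free in $F$ but bound in $E$; $\mathbb E$ is the set of valid expressions and processes are valid expressions without free variables. $E[\rho]$ is capture-avoiding simultaneous substitution of $\rho(x)$ for free occurrences of $x\in\mathrm{dom}(\rho)$. $\theta_X:=\theta_X^X$. $\langle E|\mathcal S\rangle$ is $E$ with each free $y\in V_{\mathcal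 S}$ replaced by $\langle y|\mathcal S\rangle$. For processes, $\mathcal I(P):=\{\alpha\in A_\tau\mid\exists Q.\,P\xrightarrow{\alpha}Q\}$, and transitions are the least relation satisfying ($\alpha\in Act$, $a,b\in A$): $\alpha.x\xrightarrow{\alpha}x$; $x\xrightarrow{\alpha}x'$ implies $x+y\xrightarrow{\alpha}x'$ and $y+x\xrightarrow{\alpha}x'$; $x\xrightarrow{a}x'$, $(a,b)\in\mathcal R$ imply $\mathcal R(x)\xrightarrow{b}\mathcal R(x')$; $x\xrightarrow{\tau}x'$ implies $\mathcal R(x)\xrightarrow{\tau}\mathcal R(x')$; $x\xrightarrow{t}x'$ implies $\mathcal R(x)\xrightarrow{t}\mathcal R(x')$; $x\xrightarrow{\alpha}x'$, $\alpha\notin S$ imply $x\parallel_S y\xrightarrow{\alpha}x'\parallel_S y$ and $y\parallel_S x\xrightarrow{\alpha}y\parallel_S x'$; $x\xrightarrow{a}x'$, $y\xrightarrow{a}y'$, $a\in S$ imply $x\parallel_S y\xrightarrow{a}x'\parallel_S y'$; $x\xrightarrow{\alpha}x'$, $\alpha\notin I$ imply $\tau_I(x)\xrightarrow{\alpha}\tau_I(x')$; $x\xrightarrow{a}x'$, $a\in I$ imply $\tau_I(x)\xrightarrow{\tau}\tau_I(x')$; $\langle\mathcal S_x|\mathcal S\rangle\xrightarrow{\alpha}x'$ implies $\langle x|\mathcal S\rangle\xrightarrow{\alpha}x'$; $x\xrightarrow{\tau}x'$ implies $\theta_L^U(x)\xrightarrow{\tau}\theta_L^U(x')$; $x\xrightarrow{a}x'$,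 $a\in U$ imply $\theta_L^U(x)\xrightarrow{a}x'$; $x\xrightarrow{\alpha}x'$ and $\mathcal I(x)\cap(L\cup\{\tau\})=\emptyset$ imply $\theta_L^U(x)\xrightarrow{\alpha}x'$; $x\xrightarrow{\alpha}x'$, $\alpha\neq t$ imply $\psi_X(x)\xrightarrow{\alpha}x'$; $x\xrightarrow{t}x'$ and $\mathcal I(x)\cap(X\cup\{\tau\})=\emptyset$ imply $\psi_X(x)\xrightarrow{t}\theta_X(x')$. Notation: $P\xrightarrow{(\alpha)}P'$ means ($\alpha=\tau$ and $P=P'$) or $P\xrightarrow{\alpha}P'$; $\Longrightarrow$ is the reflexive-transitive closure of $\xrightarrow{\tau}$; $P\not\xrightarrow{\tau}$ means no $\tau$-transition. $\simeq_{br}$, $\simeq^X_{br}$: a concrete branching reactive bisimulation is a symmetric ($\mathcal R(P,Q)\Leftrightarrow\mathcal R(Q,P)$, $\mathcal R(P,X,Q)\Leftrightarrow\mathcal R(Q,X,P)$) relation on pairs and triples $(P,X,Q)$ of processes, $X\subseteq A$, such that: 1. if $\mathcal R(P,Q)$: (a) if $P\xrightarrow{\alpha}P'$, $\alpha\in A_\tau$, there is $Q\Longrightarrow Q_1\xrightarrow{(\alpha)}Q_2$ with $\mathcal R(P,Q_1)$, $\mathcal R(P',Q_2)$; (b) $\mathcal R(P,Y,Q)$ for all $Y\subseteq A$; 2. if $\mathcal R(P,X,Q)$: (a) if $P\xrightarrow{\tau}P'$ there is $Q\Longrightarrow Q_1\xrightarrow{(\tau)}Q_2$ with $\mathcal R(P,X,Q_1)$,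 $\mathcal R(P',X,Q_2)$; (b) if $P\xrightarrow{a}P'$, $a\in X$, there is $Q\Longrightarrow Q_1\xrightarrow{a}Q_2$ with $\mathcal R(P,X,Q_1)$, $\mathcal R(P',Q_2)$; (c) if $\mathcal I(P)\cap(X\cup\{\tau\})=\emptyset$ there is $Q\Longrightarrow Q_0$ with $\mathcal R(P,Q_0)$; (d) if $\mathcal I(P)\cap(X\cup\{\tau\})=\emptyset$ and $P\xrightarrow{t}P'$ there is $Q\Longrightarrow Q_1\xrightarrow{t}Q_2$ with $\mathcal R(P',X,Q_2)$; (e) if $P\not\xrightarrow{\tau}$ there is $Q\Longrightarrow Q_0\not\xrightarrow{\tau}$. $P\simeq_{br}Q$ / $P\simeq^X_{br}Q$ iff $\mathcal R(P,Q)$ / $\mathcal R(P,X,Q)$ for some such $\mathcal R$. $\simeq_{rbr}$: union of all symmetric relations of the same type such that: 1. if $\mathcal R(P,Q)$: (a) if $P\xrightarrow{\alpha}P'$, $\alpha\in A_\tau$, then $Q\xrightarrow{\alpha}Q'$ with $P'\simeq_{br}Q'$; (b) $\mathcal R(P,Y,Q)$ for all $Y$; 2. if $\mathcal R(P,X,Q)$: (a) if $P\xrightarrow{\tau}P'$ then $Q\xrightarrow{\tau}Q'$ with $P'\simeq^X_{br}Q'$; (b) if $P\xrightarrow{a}P'$, $a\in X$, then $Q\xrightarrow{a}Q'$ with $P'\simeq_{br}Q'$; (c) if $\mathcal I(P)\cap(X\cup\{\tau\})=\emptyset$ then $\mathcal R(P,Q)$; (d) if moreover $P\xrightarrow{t}P'$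 then $Q\xrightarrow{t}Q'$ with $P'\simeq^X_{br}Q'$ ($P\simeq_{rbr}Q$ iff $\mathcal R(P,Q)$ in some such $\mathcal R$). $\approx_b$: union of all symmetric binary relations $\mathcal R$ on processes such that if $\mathcal R(P,Q)$: (1) if $P\xrightarrow{\alpha}P'$, $\alpha\in Act$, there is $Q\Longrightarrow Q_1\xrightarrow{(\alpha)}Q_2$ with $\mathcal R(P,Q_1)$, $\mathcal R(P',Q_2)$; (2) if $P\not\xrightarrow{\tau}$ there is $Q\Longrightarrow Q_0\not\xrightarrow{\tau}$. $\approx_{rb}$: union of all symmetric $\mathcal R$ such that if $\mathcal R(P,Q)$ and $P\xrightarrow{\alpha}P'$, $\alpha\in Act$, then $Q\xrightarrow{\alpha}Q'$ with $P'\approx_bQ'$. A relation $\sim$ on processes is extended to $\mathbb E$ by $E\sim F$ iff $E[\rho]\sim F[\rho]$ for all $\rho:V\to$ processes. An equivalence $\sim$ on $\mathbb E$ is a full congruence if (1) for every $n$-ary operator $f$ of the language, $P_i\sim Q_i$ for all $i<n$ implies $f(P_0,\dots,P_{n-1})\sim f(Q_0,\dots,Q_{n-1})$, and (2) for all recursive specifications $\mathcal S,\mathcal S'$ with $V_{\mathcal S}=V_{\mathcal S'}$ and $x\in V_{\mathcal S}$ such that $\langle x|\mathcal S\rangle,\langle x|\mathcal S'\rangle$ are processes, if $\mathcal S_y\sim\mathcal S'_y$ for all $y\in V_{\mathcal S}$ then $\langle x|\mathcal S\rangle\sim\langle x|\mathcal S'\rangle$. *)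

theory Defs
  imports Main "HOL-Library.Countable"
begin

datatype 'a act = Vis 'a | Tau | Timeout

text \<open>
  A recursive specification \<open>\<S>\<close> is a partial map: \<open>dom \<S>\<close> is the set of variables that it
  defines, and \<open>\<S> x = Some E\<close> says that it contains the equation \<open>x = E\<close>. It may contain
  infinitely many equations.
\<close>

datatype ('a, 'v) expr =
    Inaction
  | Var 'v
  | Prefix "'a act" "('a, 'v) expr"
  | Plus "('a, 'v) expr" "('a, 'v) expr"
  | Par "'a set" "('a, 'v) expr" "('a, 'v) expr"
  | Hide "'a set" "('a, 'v) expr"
  | Rename "('a \<times> 'a) set" "('a, 'v) expr"
  | Theta "'a set" "'a set" "('a, 'v) expr"  \<comment> \<open>\<open>Theta L U E\<close> is \<open>\<theta>\<^sub>L\<^sup>U(E)\<close>\<close>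
  | Psi "'a set" "('a, 'v) expr"
  | Rec 'v "'v \<Rightarrow> ('a, 'v) expr option"

type_synonym ('a, 'v) rspec = "'v \<Rightarrow> ('a, 'v) expr option"

text \<open>The side conditions of the grammar.\<close>

inductive wf_expr :: "('a, 'v) expr \<Rightarrow> bool" where
  "wf_expr Inaction"
| "wf_expr (Var x)"
| "wf_expr E \<Longrightarrow> wf_expr (Prefix \<alpha> E)"
| "wf_expr E \<Longrightarrow> wf_expr F \<Longrightarrow> wf_expr (Plus E F)"
| "wf_expr E \<Longrightarrow> wf_expr F \<Longrightarrow> wf_expr (Par S E F)"
| "wf_expr E \<Longrightarrow> wf_expr (Hide I E)"
| "wf_expr E \<Longrightarrow> (\<And>a. finite {b. (a, b) \<in> R}) \<Longrightarrow> wf_expr (Rename R E)"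
| "wf_expr E \<Longrightarrow> L \<subseteq> U \<Longrightarrow> wf_expr (Theta L U E)"
| "wf_expr E \<Longrightarrow> wf_expr (Psi X E)"
| "y \<in> dom \<S> \<Longrightarrow> (\<And>x E. \<S> x = Some E \<Longrightarrow> wf_expr E) \<Longrightarrow> wf_expr (Rec y \<S>)"

inductive occurs_free :: "'v \<Rightarrow> ('a, 'v) expr \<Rightarrow> bool" for x where
  "occurs_free x (Var x)"
| "occurs_free x E \<Longrightarrow> occurs_free x (Prefix \<alpha> E)"
| "occurs_free x E \<Longrightarrow> occurs_free x (Plus E F)"
| "occurs_free x F \<Longrightarrow> occurs_free x (Plus E F)"
| "occurs_free x E \<Longrightarrow> occurs_free x (Par S E F)"
| "occurs_free x F \<Longrightarrow> occurs_free x (Par S E F)"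
| "occurs_free x E \<Longrightarrow> occurs_free x (Hide I E)"
| "occurs_free x E \<Longrightarrow> occurs_free x (Rename R E)"
| "occurs_free x E \<Longrightarrow> occurs_free x (Theta L U E)"
| "occurs_free x E \<Longrightarrow> occurs_free x (Psi X E)"
| "\<S> z = Some E \<Longrightarrow> occurs_free x E \<Longrightarrow> x \<notin> dom \<S> \<Longrightarrow> occurs_free x (Rec y \<S>)"

inductive subexpr :: "('a, 'v) expr \<Rightarrow> ('a, 'v) expr \<Rightarrow> bool" for G where
  "subexpr G G"
| "subexpr G E \<Longrightarrow> subexpr G (Prefix \<alpha> E)"
| "subexpr G E \<Longrightarrow> subexpr G (Plus E F)"
| "subexpr G F \<Longrightarrow> subexpr G (Plus E F)"
| "subexpr G E \<Longrightarrow> subexpr G (Par S E F)"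
| "subexpr G F \<Longrightarrow> subexpr G (Par S E F)"
| "subexpr G E \<Longrightarrow> subexpr G (Hide I E)"
| "subexpr G E \<Longrightarrow> subexpr G (Rename R E)"
| "subexpr G E \<Longrightarrow> subexpr G (Theta L U E)"
| "subexpr G E \<Longrightarrow> subexpr G (Psi X E)"
| "\<S> x = Some E \<Longrightarrow> subexpr G E \<Longrightarrow> subexpr G (Rec y \<S>)"

text \<open>
  An occurrence of \<open>x\<close> that is free in \<open>F\<close> is bound in \<open>E\<close> iff some \<open>\<langle>y|\<S>\<rangle>\<close> with \<open>x \<in> dom \<S>\<close>
  lies between \<open>F\<close> and \<open>E\<close>.
\<close>

definition valid :: "('a, 'v) expr \<Rightarrow> bool" where
  "valid E \<longleftrightarrow>
     \<not> (\<exists>y \<S> G F x. subexpr (Rec y \<S>) E \<and> subexpr G (Rec y \<S>) \<and>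
          ((\<exists>L U. G = Theta L U F) \<or> (\<exists>X. G = Psi X F)) \<and>
          occurs_free x F \<and> x \<in> dom \<S>)"

definition valid_exprs :: "('a, 'v) expr set" where
  "valid_exprs = {E. wf_expr E \<and> valid E}"

definition process :: "('a, 'v) expr \<Rightarrow> bool" where
  "process P \<longleftrightarrow> P \<in> valid_exprs \<and> (\<forall>x. \<not> occurs_free x P)"

text \<open>
  Simultaneous substitution without renaming of bound variables. It agrees with capture-avoiding
  substitution whenever the substituted expressions are closed, and only such substitutions
  are needed below: for a process \<open>\<langle>x|\<S>\<rangle>\<close>, all \<open>\<langle>y|\<S>\<rangle>\<close> are closed.
\<close>

primrec subst :: "('a, 'v) expr \<Rightarrow> ('v \<Rightarrow> ('a, 'v) expr option) \<Rightarrow> ('a, 'v) expr" where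
  "subst Inaction \<rho> = Inaction"
| "subst (Var x) \<rho> = (case \<rho> x of None \<Rightarrow> Var x | Some P \<Rightarrow> P)"
| "subst (Prefix \<alpha> E) \<rho> = Prefix \<alpha> (subst E \<rho>)"
| "subst (Plus E F) \<rho> = Plus (subst E \<rho>) (subst F \<rho>)"
| "subst (Par S E F) \<rho> = Par S (subst E \<rho>) (subst F \<rho>)"
| "subst (Hide I E) \<rho> = Hide I (subst E \<rho>)"
| "subst (Rename R E) \<rho> = Rename R (subst E \<rho>)"
| "subst (Theta L U E) \<rho> = Theta L U (subst E \<rho>)"
| "subst (Psi X E) \<rho> = Psi X (subst E \<rho>)"
| "subst (Rec y \<S>) \<rho> = Rec y (\<lambda>x. map_option (\<lambda>E. subst E (\<rho> |` (- dom \<S>))) (\<S> x))"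

text \<open>\<open>unfold_rec E \<S>\<close> is \<open>\<langle>E|\<S>\<rangle>\<close>.\<close>

definition unfold_rec :: "('a, 'v) expr \<Rightarrow> ('a, 'v) rspec \<Rightarrow> ('a, 'v) expr" where
  "unfold_rec E \<S> = subst E (\<lambda>y. if y \<in> dom \<S> then Some (Rec y \<S>) else None)"

type_synonym ('a, 'v) lts = "('a, 'v) expr \<Rightarrow> 'a act \<Rightarrow> ('a, 'v) expr \<Rightarrow> bool"

definition initials :: "('a, 'v) lts \<Rightarrow> ('a, 'v) expr \<Rightarrow> 'a act set" where
  "initials T P = {\<alpha>. \<alpha> \<noteq> Timeout \<and> (\<exists>Q. T P \<alpha> Q)}"

text \<open>
  Because of the negative premises of \<open>\<theta>\<close> and \<open>\<psi>\<close>, the transition rules are not monotone.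
  \<open>derivable N\<close> is the least relation satisfying the rules when the negative premises
  are evaluated in the fixed relation \<open>N\<close>; it is antitone in \<open>N\<close>. The transition relation \<open>step\<close>
  is the well-founded model of the rules, i.e. the alternating fixed point.
  The theorem \<open>step_iff_derivable_step\<close> at the end shows that on processes it is a
  fixed point of \<open>derivable\<close> itself: \<open>step\<close> is least among the relations satisfying the rules
  with negative premises evaluated in \<open>step\<close>.
\<close>

inductive derivable :: "('a, 'v) lts \<Rightarrow> ('a, 'v) lts" for N where
  "derivable N (Prefix \<alpha> P) \<alpha> P"
| "derivable N P \<alpha> P' \<Longrightarrow> derivable N (Plus P Q) \<alpha> P'"
| "derivable N P \<alpha> P' \<Longrightarrow> derivable N (Plus Q P) \<alpha> P'"
| "derivable N P (Vis a) P' \<Longrightarrow> (a, b) \<in> R \<Longrightarrow> derivable N (Rename R P) (Vis b) (Rename R P')"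
| "derivable N P Tau P' \<Longrightarrow> derivable N (Rename R P) Tau (Rename R P')"
| "derivable N P Timeout P' \<Longrightarrow> derivable N (Rename R P) Timeout (Rename R P')"
| "derivable N P \<alpha> P' \<Longrightarrow> \<alpha> \<notin> Vis ` S \<Longrightarrow> derivable N (Par S P Q) \<alpha> (Par S P' Q)"
| "derivable N P \<alpha> P' \<Longrightarrow> \<alpha> \<notin> Vis ` S \<Longrightarrow> derivable N (Par S Q P) \<alpha> (Par S Q P')"
| "derivable N P (Vis a) P' \<Longrightarrow> derivable N Q (Vis a) Q' \<Longrightarrow> a \<in> S \<Longrightarrow>
     derivable N (Par S P Q) (Vis a) (Par S P' Q')"
| "derivable N P \<alpha> P' \<Longrightarrow> \<alpha> \<notin> Vis ` I \<Longrightarrow> derivable N (Hide I P) \<alpha> (Hide I P')"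
| "derivable N P (Vis a) P' \<Longrightarrow> a \<in> I \<Longrightarrow> derivable N (Hide I P) Tau (Hide I P')"
| "\<S> x = Some E \<Longrightarrow> derivable N (unfold_rec E \<S>) \<alpha> P' \<Longrightarrow> derivable N (Rec x \<S>) \<alpha> P'"
| "derivable N P Tau P' \<Longrightarrow> derivable N (Theta L U P) Tau (Theta L U P')"
| "derivable N P (Vis a) P' \<Longrightarrow> a \<in> U \<Longrightarrow> derivable N (Theta L U P) (Vis a) P'"
| "derivable N P \<alpha> P' \<Longrightarrow> initials N P \<inter> (Vis ` L \<union> {Tau}) = {} \<Longrightarrow> derivable N (Theta L U P) \<alpha> P'"
| "derivable N P \<alpha> P' \<Longrightarrow> \<alpha> \<noteq> Timeout \<Longrightarrow> derivable N (Psi X P) \<alpha> P'"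
| "derivable N P Timeout P' \<Longrightarrow> initials N P \<inter> (Vis ` X \<union> {Tau}) = {} \<Longrightarrow>
     derivable N (Psi X P) Timeout (Theta X X P')"

definition step :: "('a, 'v) lts" where
  "step = lfp (\<lambda>T. derivable (derivable T))"

definition weak_step :: "('a, 'v) expr \<Rightarrow> ('a, 'v) expr \<Rightarrow> bool" where
  "weak_step = (\<lambda>P Q. step P Tau Q)\<^sup>*\<^sup>*"

definition opt_step :: "('a, 'v) lts" where
  "opt_step P \<alpha> P' \<longleftrightarrow> (\<alpha> = Tau \<and> P = P') \<or> step P \<alpha> P'"

definition stable :: "('a, 'v) expr \<Rightarrow> bool" where
  "stable P \<longleftrightarrow> (\<nexists>Q. step P Tau Q)"

definition idle :: "'a set \<Rightarrow> ('a, 'v) expr \<Rightarrow> bool" where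
  "idle X P \<longleftrightarrow> initials step P \<inter> (Vis ` X \<union> {Tau}) = {}"

text \<open>
  A relation on pairs \<open>(P, Q)\<close> and triples \<open>(P, X, Q)\<close> of processes is represented by its two parts.
\<close>

type_synonym ('a, 'v) rel2 = "('a, 'v) expr \<Rightarrow> ('a, 'v) expr \<Rightarrow> bool"
type_synonym ('a, 'v) rel3 = "('a, 'v) expr \<Rightarrow> 'a set \<Rightarrow> ('a, 'v) expr \<Rightarrow> bool"

definition sym_on_processes :: "('a, 'v) rel2 \<Rightarrow> bool" where
  "sym_on_processes R \<longleftrightarrow> (\<forall>P Q. R P Q \<longrightarrow> process P \<and> process Q \<and> R Q P)"

definition sym3_on_processes :: "('a, 'v) rel3 \<Rightarrow> bool" where
  "sym3_on_processes R \<longleftrightarrow> (\<forall>P X Q. R P X Q \<longrightarrow> process P \<and> process Q \<and> R Q X P)"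

definition branching_reactive_bisim :: "('a, 'v) rel2 \<Rightarrow> ('a, 'v) rel3 \<Rightarrow> bool" where
  "branching_reactive_bisim R R3 \<longleftrightarrow>
     sym_on_processes R \<and> sym3_on_processes R3 \<and>
     (\<forall>P Q. R P Q \<longrightarrow>
        (\<forall>\<alpha> P'. step P \<alpha> P' \<and> \<alpha> \<noteq> Timeout \<longrightarrow>
           (\<exists>Q1 Q2. weak_step Q Q1 \<and> opt_step Q1 \<alpha> Q2 \<and> R P Q1 \<and> R P' Q2)) \<and>
        (\<forall>Y. R3 P Y Q)) \<and>
     (\<forall>P X Q. R3 P X Q \<longrightarrow>
        (\<forall>P'. step P Tau P' \<longrightarrow>
           (\<exists>Q1 Q2. weak_step Q Q1 \<and> opt_step Q1 Tau Q2 \<and> R3 P X Q1 \<and> R3 P' X Q2)) \<and>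
        (\<forall>a P'. step P (Vis a) P' \<and> a \<in> X \<longrightarrow>
           (\<exists>Q1 Q2. weak_step Q Q1 \<and> step Q1 (Vis a) Q2 \<and> R3 P X Q1 \<and> R P' Q2)) \<and>
        (idle X P \<longrightarrow> (\<exists>Q0. weak_step Q Q0 \<and> R P Q0)) \<and>
        (\<forall>P'. idle X P \<and> step P Timeout P' \<longrightarrow>
           (\<exists>Q1 Q2. weak_step Q Q1 \<and> step Q1 Timeout Q2 \<and> R3 P' X Q2)) \<and>
        (stable P \<longrightarrow> (\<exists>Q0. weak_step Q Q0 \<and> stable Q0)))"

definition br_bisimilar :: "('a, 'v) rel2" where
  "br_bisimilar P Q \<longleftrightarrow> (\<exists>R R3. branching_reactive_bisim R R3 \<and> R P Q)"

definition br_bisimilar_in :: "('a, 'v) rel3" where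
  "br_bisimilar_in P X Q \<longleftrightarrow> (\<exists>R R3. branching_reactive_bisim R R3 \<and> R3 P X Q)"

definition rooted_branching_reactive_bisim :: "('a, 'v) rel2 \<Rightarrow> ('a, 'v) rel3 \<Rightarrow> bool" where
  "rooted_branching_reactive_bisim R R3 \<longleftrightarrow>
     sym_on_processes R \<and> sym3_on_processes R3 \<and>
     (\<forall>P Q. R P Q \<longrightarrow>
        (\<forall>\<alpha> P'. step P \<alpha> P' \<and> \<alpha> \<noteq> Timeout \<longrightarrow>
           (\<exists>Q'. step Q \<alpha> Q' \<and> br_bisimilar P' Q')) \<and>
        (\<forall>Y. R3 P Y Q)) \<and>
     (\<forall>P X Q. R3 P X Q \<longrightarrow>
        (\<forall>P'. step P Tau P' \<longrightarrow>
           (\<exists>Q'. step Q Tau Q' \<and> br_bisimilar_in P' X Q')) \<and>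
        (\<forall>a P'. step P (Vis a) P' \<and> a \<in> X \<longrightarrow>
           (\<exists>Q'. step Q (Vis a) Q' \<and> br_bisimilar P' Q')) \<and>
        (idle X P \<longrightarrow> R P Q) \<and>
        (\<forall>P'. idle X P \<and> step P Timeout P' \<longrightarrow>
           (\<exists>Q'. step Q Timeout Q' \<and> br_bisimilar_in P' X Q')))"

definition rbr_bisimilar :: "('a, 'v) rel2" where
  "rbr_bisimilar P Q \<longleftrightarrow> (\<exists>R R3. rooted_branching_reactive_bisim R R3 \<and> R P Q)"

text \<open>In the following two relations, time-outs are treated like any other action.\<close>

definition branching_bisim :: "('a, 'v) rel2 \<Rightarrow> bool" where
  "branching_bisim R \<longleftrightarrow>
     sym_on_processes R \<and>
     (\<forall>P Q. R P Q \<longrightarrow>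
        (\<forall>\<alpha> P'. step P \<alpha> P' \<longrightarrow>
           (\<exists>Q1 Q2. weak_step Q Q1 \<and> opt_step Q1 \<alpha> Q2 \<and> R P Q1 \<and> R P' Q2)) \<and>
        (stable P \<longrightarrow> (\<exists>Q0. weak_step Q Q0 \<and> stable Q0)))"

definition b_bisimilar :: "('a, 'v) rel2" where
  "b_bisimilar P Q \<longleftrightarrow> (\<exists>R. branching_bisim R \<and> R P Q)"

definition rooted_branching_bisim :: "('a, 'v) rel2 \<Rightarrow> bool" where
  "rooted_branching_bisim R \<longleftrightarrow>
     sym_on_processes R \<and>
     (\<forall>P Q. R P Q \<longrightarrow>
        (\<forall>\<alpha> P'. step P \<alpha> P' \<longrightarrow> (\<exists>Q'. step Q \<alpha> Q' \<and> b_bisimilar P' Q')))"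

definition rb_bisimilar :: "('a, 'v) rel2" where
  "rb_bisimilar P Q \<longleftrightarrow> (\<exists>R. rooted_branching_bisim R \<and> R P Q)"

definition open_extension :: "('a, 'v) rel2 \<Rightarrow> (('a, 'v) expr \<times> ('a, 'v) expr) set" where
  "open_extension R =
     {(E, F). E \<in> valid_exprs \<and> F \<in> valid_exprs \<and>
        (\<forall>\<rho>. (\<forall>x. process (\<rho> x)) \<longrightarrow> R (subst E (Some \<circ> \<rho>)) (subst F (Some \<circ> \<rho>)))}"

definition operator_congruence :: "(('a, 'v) expr \<times> ('a, 'v) expr) set \<Rightarrow> bool" where
  "operator_congruence r \<longleftrightarrow>
     (Inaction, Inaction) \<in> r \<and>
     (\<forall>\<alpha> P Q. (P, Q) \<in> r \<longrightarrow> (Prefix \<alpha> P, Prefix \<alpha> Q) \<in> r) \<and>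
     (\<forall>P0 Q0 P1 Q1. (P0, Q0) \<in> r \<and> (P1, Q1) \<in> r \<longrightarrow> (Plus P0 P1, Plus Q0 Q1) \<in> r) \<and>
     (\<forall>S P0 Q0 P1 Q1. (P0, Q0) \<in> r \<and> (P1, Q1) \<in> r \<longrightarrow> (Par S P0 P1, Par S Q0 Q1) \<in> r) \<and>
     (\<forall>I P Q. (P, Q) \<in> r \<longrightarrow> (Hide I P, Hide I Q) \<in> r) \<and>
     (\<forall>R P Q. (\<forall>a. finite {b. (a, b) \<in> R}) \<and> (P, Q) \<in> r \<longrightarrow> (Rename R P, Rename R Q) \<in> r) \<and>
     (\<forall>L U P Q. L \<subseteq> U \<and> (P, Q) \<in> r \<longrightarrow> (Theta L U P, Theta L U Q) \<in> r) \<and>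
     (\<forall>X P Q. (P, Q) \<in> r \<longrightarrow> (Psi X P, Psi X Q) \<in> r)"

definition recursion_congruence :: "(('a, 'v) expr \<times> ('a, 'v) expr) set \<Rightarrow> bool" where
  "recursion_congruence r \<longleftrightarrow>
     (\<forall>\<S> \<S>' x. dom \<S> = dom \<S>' \<and> x \<in> dom \<S> \<and>
        process (Rec x \<S>) \<and> process (Rec x \<S>') \<and>
        (\<forall>y \<in> dom \<S>. (the (\<S> y), the (\<S>' y)) \<in> r) \<longrightarrow>
        (Rec x \<S>, Rec x \<S>') \<in> r)"

definition full_congruence :: "(('a, 'v) expr \<times> ('a, 'v) expr) set \<Rightarrow> bool" where
  "full_congruence r \<longleftrightarrow>
     equiv valid_exprs r \<and> operator_congruence r \<and> recursion_congruence r"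

text \<open>The transition relation satisfies its rules.\<close>

lemma derivable_antimono:
  assumes "N \<le> M"
  shows "derivable M \<le> derivable N"
proof -
  have init: "initials N P \<subseteq> initials M P" for P
    using assms unfolding initials_def le_fun_def le_bool_def by blast
  have "derivable M P \<alpha> Q \<Longrightarrow> derivable N P \<alpha> Q" for P \<alpha> Q
  proof (induction rule: derivable.induct)
    case (15 P \<alpha> P' L U)
    have "initials N P \<inter> (Vis ` L \<union> {Tau}) = {}"
      using 15(2) init[of P] by blast
    with 15(3) show ?case by (rule derivable.intros(15))
  next
    case (17 P P' X)
    have "initials N P \<inter> (Vis ` X \<union> {Tau}) = {}"
      using 17(2) init[of P] by blast
    with 17(3) show ?case by (rule derivable.intros(17))
  qed (blast intro: derivable.intros)+
  then show ?thesis unfolding le_fun_def le_bool_def by blast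
qed

lemma mono_derivable2: "mono (\<lambda>T. derivable (derivable T))"
  by (intro monoI derivable_antimono)

lemma step_unfold: "derivable (derivable step) = step"
  unfolding step_def by (rule lfp_unfold[OF mono_derivable2, symmetric])

lemma step_le_derivable_step: "step \<le> derivable step"
proof -
  have "derivable (derivable (derivable step)) \<le> derivable step"
    by (simp add: step_unfold)
  then show ?thesis
    unfolding step_def by (intro lfp_lowerbound) (simp flip: step_def)
qed

definition guard :: "('a, 'v) expr \<Rightarrow> ('a, 'v) expr \<Rightarrow> bool" where
  "guard F E \<longleftrightarrow> (\<exists>L U. subexpr (Theta L U F) E) \<or> (\<exists>X. subexpr (Psi X F) E)"

definition determined :: "('a, 'v) expr \<Rightarrow> bool" where
  "determined P \<longleftrightarrow> (\<forall>\<alpha> Q. derivable step P \<alpha> Q \<longrightarrow> step P \<alpha> Q)"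

definition guards_ok :: "('a, 'v) expr \<Rightarrow> bool" where
  "guards_ok P \<longleftrightarrow> (\<forall>F. guard F P \<longrightarrow> (\<forall>x. \<not> occurs_free x F) \<and> determined F)"

inductive_cases subexpr_PrefixE: "subexpr G (Prefix \<alpha> E)"
inductive_cases subexpr_InactionE: "subexpr G Inaction"
inductive_cases subexpr_VarE: "subexpr G (Var x)"
inductive_cases subexpr_PlusE: "subexpr G (Plus E F)"
inductive_cases subexpr_ParE: "subexpr G (Par S E F)"
inductive_cases subexpr_HideE: "subexpr G (Hide I E)"
inductive_cases subexpr_RenameE: "subexpr G (Rename R E)"
inductive_cases subexpr_ThetaE: "subexpr G (Theta L U E)"
inductive_cases subexpr_PsiE: "subexpr G (Psi X E)"
inductive_cases subexpr_RecE: "subexpr G (Rec y \<S>)"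

lemmas subexpr_elims = subexpr_PrefixE subexpr_InactionE subexpr_VarE subexpr_PlusE
  subexpr_ParE subexpr_HideE subexpr_RenameE subexpr_ThetaE subexpr_PsiE subexpr_RecE

lemma subexpr_trans: "subexpr F E \<Longrightarrow> subexpr G F \<Longrightarrow> subexpr G E"
  by (induction rule: subexpr.induct) (auto intro: subexpr.intros)

lemma step_derivable: "step P \<alpha> Q \<Longrightarrow> derivable step P \<alpha> Q"
  using step_le_derivable_step unfolding le_fun_def le_bool_def by blast

lemma guard_simps:
  "\<not> guard F Inaction"
  "\<not> guard F (Var x)"
  "guard F (Prefix \<alpha> E) \<longleftrightarrow> guard F E"
  "guard F (Plus E E') \<longleftrightarrow> guard F E \<or> guard F E'"
  "guard F (Par S E E') \<longleftrightarrow> guard F E \<or> guard F E'"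
  "guard F (Hide I E) \<longleftrightarrow> guard F E"
  "guard F (Rename R E) \<longleftrightarrow> guard F E"
  "guard F (Theta L U E) \<longleftrightarrow> F = E \<or> guard F E"
  "guard F (Psi X E) \<longleftrightarrow> F = E \<or> guard F E"
  "guard F (Rec y \<S>) \<longleftrightarrow> (\<exists>x E. \<S> x = Some E \<and> guard F E)"
  unfolding guard_def by (blast intro: subexpr.intros elim: subexpr_elims)+

lemma subst_closed: "(\<And>x. occurs_free x F \<Longrightarrow> \<sigma> x = None) \<Longrightarrow> subst F \<sigma> = F"
proof (induction F arbitrary: \<sigma>)
  case (Rec y \<S>)
  have "map_option (\<lambda>E. subst E (\<sigma> |` (- dom \<S>))) (\<S> z) = \<S> z" for z
  proof (cases "\<S> z")
    case (Some E)
    have "subst E (\<sigma> |` (- dom \<S>)) = E"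
    proof (rule Rec.IH[of "\<S> z" E])
      show "(\<sigma> |` (- dom \<S>)) x = None" if "occurs_free x E" for x
        using Rec.prems occurs_free.intros(11)[of \<S> z E x y] Some that
        by (cases "x \<in> dom \<S>") (auto simp: restrict_map_def)
    qed (use Some in \<open>metis rangeI, simp\<close>)
    with Some show ?thesis by simp
  qed simp
  then show ?case by simp
qed (simp_all add: occurs_free.intros)

lemma subexpr_subst:
  "subexpr G (subst E \<sigma>) \<Longrightarrow>
     (\<exists>F \<sigma>'. subexpr F E \<and> \<sigma>' \<subseteq>\<^sub>m \<sigma> \<and> G = subst F \<sigma>') \<or> (\<exists>y Q. \<sigma> y = Some Q \<and> subexpr G Q)"
  (is "_ \<Longrightarrow> ?C E \<sigma>")
proof (induction E arbitrary: \<sigma>)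
  case Inaction
  then have "G = subst Inaction \<sigma>" by (auto elim: subexpr_elims)
  then show ?case by (blast intro: subexpr.intros(1) map_le_refl)
next
  case (Var x)
  show ?case
  proof (cases "\<sigma> x")
    case None
    with Var have "G = subst (Var x) \<sigma>" by (auto elim: subexpr_elims)
    then show ?thesis by (blast intro: subexpr.intros(1) map_le_refl)
  next
    case (Some Q)
    with Var have "subexpr G Q" by simp
    with Some show ?thesis by blast
  qed
next
  case (Prefix \<alpha> E)
  from Prefix.prems consider "G = subst (Prefix \<alpha> E) \<sigma>" | "subexpr G (subst E \<sigma>)"
    by (auto elim: subexpr_elims)
  then show ?case
  proof cases
    case 1
    then show ?thesis by (blast intro: subexpr.intros(1) map_le_refl)
  next
    case 2
    from Prefix.IH[OF this] show ?thesis by (blast intro: subexpr.intros(2))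
  qed
next
  case (Plus E F)
  from Plus.prems consider "G = subst (Plus E F) \<sigma>"
    | "subexpr G (subst E \<sigma>)" | "subexpr G (subst F \<sigma>)"
    by (auto elim: subexpr_elims)
  then show ?case
  proof cases
    case 1
    then show ?thesis by (blast intro: subexpr.intros(1) map_le_refl)
  next
    case 2
    from Plus.IH(1)[OF this] show ?thesis by (blast intro: subexpr.intros(3))
  next
    case 3
    from Plus.IH(2)[OF this] show ?thesis by (blast intro: subexpr.intros(4))
  qed
next
  case (Par S E F)
  from Par.prems consider "G = subst (Par S E F) \<sigma>"
    | "subexpr G (subst E \<sigma>)" | "subexpr G (subst F \<sigma>)"
    by (auto elim: subexpr_elims)
  then show ?case
  proof cases
    case 1
    then show ?thesis by (blast intro: subexpr.intros(1) map_le_refl)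
  next
    case 2
    from Par.IH(1)[OF this] show ?thesis by (blast intro: subexpr.intros(5))
  next
    case 3
    from Par.IH(2)[OF this] show ?thesis by (blast intro: subexpr.intros(6))
  qed
next
  case (Hide I E)
  from Hide.prems consider "G = subst (Hide I E) \<sigma>" | "subexpr G (subst E \<sigma>)"
    by (auto elim: subexpr_elims)
  then show ?case
  proof cases
    case 1
    then show ?thesis by (blast intro: subexpr.intros(1) map_le_refl)
  next
    case 2
    from Hide.IH[OF this] show ?thesis by (blast intro: subexpr.intros(7))
  qed
next
  case (Rename R E)
  from Rename.prems consider "G = subst (Rename R E) \<sigma>" | "subexpr G (subst E \<sigma>)"
    by (auto elim: subexpr_elims)
  then show ?case
  proof cases
    case 1
    then show ?thesis by (blast intro: subexpr.intros(1) map_le_refl)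
  next
    case 2
    from Rename.IH[OF this] show ?thesis by (blast intro: subexpr.intros(8))
  qed
next
  case (Theta L U E)
  from Theta.prems consider "G = subst (Theta L U E) \<sigma>" | "subexpr G (subst E \<sigma>)"
    by (auto elim: subexpr_elims)
  then show ?case
  proof cases
    case 1
    then show ?thesis by (blast intro: subexpr.intros(1) map_le_refl)
  next
    case 2
    from Theta.IH[OF this] show ?thesis by (blast intro: subexpr.intros(9))
  qed
next
  case (Psi X E)
  from Psi.prems consider "G = subst (Psi X E) \<sigma>" | "subexpr G (subst E \<sigma>)"
    by (auto elim: subexpr_elims)
  then show ?case
  proof cases
    case 1
    then show ?thesis by (blast intro: subexpr.intros(1) map_le_refl)
  next
    case 2
    from Psi.IH[OF this] show ?thesis by (blast intro: subexpr.intros(10))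
  qed
next
  case (Rec y \<S>)
  show ?case
  proof (cases "G = subst (Rec y \<S>) \<sigma>")
    case True
    then show ?thesis by (blast intro: subexpr.intros(1) map_le_refl)
  next
    case False
    with Rec.prems obtain z E where
      z: "\<S> z = Some E" and G: "subexpr G (subst E (\<sigma> |` (- dom \<S>)))"
      by (auto elim!: subexpr_RecE)
    have le: "\<sigma> |` (- dom \<S>) \<subseteq>\<^sub>m \<sigma>"
      by (auto simp: map_le_def)
    have "?C E (\<sigma> |` (- dom \<S>))"
      by (rule Rec.IH[OF _ _ G, of "\<S> z"]) (use z in \<open>metis rangeI, simp\<close>)
    then show ?thesis
    proof (elim disjE exE conjE)
      fix F \<sigma>' assume "subexpr F E" "\<sigma>' \<subseteq>\<^sub>m \<sigma> |` (- dom \<S>)" "G = subst F \<sigma>'"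
      then show ?thesis
        using subexpr.intros(11)[of \<S> z E F y, OF z] map_le_trans[OF _ le] by blast
    next
      fix x Q assume "(\<sigma> |` (- dom \<S>)) x = Some Q" "subexpr G Q"
      then have "\<sigma> x = Some Q"
        by (auto simp: restrict_map_def split: if_splits)
      with \<open>subexpr G Q\<close> show ?thesis by blast
    qed
  qed
qed

lemma guard_subst:
  assumes "guard G (subst E \<sigma>)"
  shows "(\<exists>F \<sigma>'. guard F E \<and> G = subst F \<sigma>') \<or> (\<exists>y Q. \<sigma> y = Some Q \<and> guard G Q)"
proof -
  obtain H where H: "subexpr H (subst E \<sigma>)" and HG: "(\<exists>L U. H = Theta L U G) \<or> (\<exists>X. H = Psi X G)"
    using assms by (auto simp: guard_def)
  from subexpr_subst[OF H] show ?thesis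
  proof (elim disjE exE conjE)
    fix F \<sigma>' assume F: "subexpr F E" and le: "\<sigma>' \<subseteq>\<^sub>m \<sigma>" and eq: "H = subst F \<sigma>'"
    show ?thesis
    proof (cases "\<exists>x. F = Var x")
      case True
      then obtain x where x: "F = Var x" by blast
      have "\<sigma>' x = Some H"
        using eq HG by (auto simp: x split: option.splits)
      then have "\<sigma> x = Some H"
        using le by (metis domI map_le_def)
      moreover have "guard G H"
        using HG by (auto simp: guard_simps)
      ultimately show ?thesis by blast
    next
      case False
      then obtain F0 where "guard F0 F" "G = subst F0 \<sigma>'"
        using eq HG by (cases F) (auto simp: guard_simps)
      moreover have "guard F0 E" if "guard F0 F"
        using that F subexpr_trans unfolding guard_def by blast
      ultimately show ?thesis by blast
    qed
  next
    fix y Q assume "\<sigma> y = Some Q" "subexpr H Q"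
    then show ?thesis using HG unfolding guard_def by blast
  qed
qed

lemma guards_ok_unfold:
  assumes ok: "guards_ok (Rec x \<S>)" and E: "\<S> x = Some E"
  shows "guards_ok (unfold_rec E \<S>)"
  unfolding guards_ok_def
proof (intro allI impI)
  fix G assume "guard G (unfold_rec E \<S>)"
  from guard_subst[OF this[unfolded unfold_rec_def]]
  have "guard G (Rec x \<S>)"
  proof (elim disjE exE conjE)
    fix F \<sigma>' assume F: "guard F E" and G: "G = subst F \<sigma>'"
    have rec: "guard F (Rec x \<S>)" using F E by (auto simp: guard_simps)
    have "\<forall>z. \<not> occurs_free z F" using ok rec by (auto simp: guards_ok_def)
    then have "G = F" using G subst_closed by metis
    with rec show ?thesis by simp
  qed (auto simp: guard_simps split: if_splits)
  then show "(\<forall>x. \<not> occurs_free x G) \<and> determined G"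
    using ok by (auto simp: guards_ok_def)
qed

lemma initials_determined: "determined P \<Longrightarrow> initials (derivable step) P = initials step P"
  unfolding initials_def determined_def using step_derivable by blast

lemma step_intro: "derivable (derivable step) P \<alpha> Q \<Longrightarrow> step P \<alpha> Q"
  by (simp add: step_unfold)

lemma step_elim: "step P \<alpha> Q \<Longrightarrow> derivable (derivable step) P \<alpha> Q"
  by (simp add: step_unfold)

lemma guards_ok_step: "derivable step P \<alpha> Q \<Longrightarrow> guards_ok P \<Longrightarrow> derivable (derivable step) P \<alpha> Q"
proof (induction rule: derivable.induct)
  case (12 \<S> x E \<alpha> P')
  then show ?case by (blast intro: derivable.intros(12) guards_ok_unfold)
next
  case (15 P \<alpha> P' L U)
  then have "determined P" "guards_ok P" by (auto simp: guards_ok_def guard_simps)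
  with 15 show ?case by (intro derivable.intros(15)) (simp_all add: initials_determined)
next
  case (17 P P' X)
  then have "determined P" "guards_ok P" by (auto simp: guards_ok_def guard_simps)
  with 17 show ?case by (intro derivable.intros(17)) (simp_all add: initials_determined)
qed (auto simp: guards_ok_def guard_simps intro: derivable.intros)

lemma guards_ok_determined: "guards_ok P \<Longrightarrow> determined P"
  unfolding determined_def by (blast intro: step_intro guards_ok_step)

lemma closed_guards_ok: "(\<And>F x. guard F E \<Longrightarrow> \<not> occurs_free x F) \<Longrightarrow> guards_ok E"
proof (induction E)
  case (Theta L U E)
  then have "guards_ok E" by (auto simp: guard_simps)
  with Theta.prems guards_ok_determined[OF this] show ?case
    by (auto simp: guards_ok_def guard_simps)
next
  case (Psi X E)
  then have "guards_ok E" by (auto simp: guard_simps)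
  with Psi.prems guards_ok_determined[OF this] show ?case
    by (auto simp: guards_ok_def guard_simps)
next
  case (Rec y \<S>)
  have "guards_ok E" if "\<S> x = Some E" for x E
    using Rec.IH[OF rangeI[of \<S> x], of E] that Rec.prems by (auto simp: guard_simps)
  then show ?case by (auto simp: guards_ok_def guard_simps)
qed (auto simp: guards_ok_def guard_simps)

lemma bound_between:
  "subexpr F E \<Longrightarrow> occurs_free x F \<Longrightarrow> \<not> occurs_free x E \<Longrightarrow>
     \<exists>y \<S>. subexpr F (Rec y \<S>) \<and> subexpr (Rec y \<S>) E \<and> x \<in> dom \<S>"
proof (induction rule: subexpr.induct)
  case (11 \<S> z E y)
  show ?case
  proof (cases "occurs_free x E")
    case True
    then have "x \<in> dom \<S>" using 11 by (blast intro: occurs_free.intros(11))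
    moreover have "subexpr F (Rec y \<S>)" using 11 by (blast intro: subexpr.intros(11))
    ultimately show ?thesis by (blast intro: subexpr.intros(1))
  next
    case False
    with 11 show ?thesis by (blast intro: subexpr.intros(11))
  qed
qed (blast intro: subexpr.intros occurs_free.intros)+

lemma process_guard_closed:
  assumes P: "process P" and G: "guard F P"
  shows "\<not> occurs_free x F"
proof
  assume x: "occurs_free x F"
  obtain H where H: "subexpr H P" and HF: "(\<exists>L U. H = Theta L U F) \<or> (\<exists>X. H = Psi X F)"
    using G by (auto simp: guard_def)
  have "occurs_free x H" using x HF by (auto intro: occurs_free.intros)
  moreover have "\<not> occurs_free x P" using P by (simp add: process_def)
  ultimately obtain y \<S> where "subexpr H (Rec y \<S>)" "subexpr (Rec y \<S>) P" "x \<in> dom \<S>"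
    using bound_between[OF H] by blast
  with HF x have "\<not> valid P" unfolding valid_def by blast
  with P show False by (simp add: process_def valid_exprs_def)
qed

theorem step_iff_derivable_step:
  assumes "process P"
  shows "step P \<alpha> Q \<longleftrightarrow> derivable step P \<alpha> Q"
proof -
  have "determined P"
    by (intro guards_ok_determined closed_guards_ok process_guard_closed[OF assms])
  then show ?thesis
    using step_derivable unfolding determined_def by blast
qed

end

theory Submission
  imports Defs
begin

text \<open>
  Rooted bisimilarity is a one-step matching of strong transitions into bisimilarity, hence it
  suffices to know that bisimilarity is a congruence for the operators that survive a transition
  (parallel composition, hiding, renaming and \<open>\<theta>\<close>) and that strong bisimulations up to
  bisimilarity are sound. For the reactive equivalence the time-out clause depends on the set \<open>X\<close>
  of actions allowed by the environment, and each operator translates \<open>X\<close> into the set of actions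
  allowed to its argument.

  Recursion is handled by the least relation that contains rooted bisimilarity and the pairs
  \<open>\<langle>y|\<S>\<rangle>\<close>, \<open>\<langle>y|\<S>'\<rangle>\<close> and is closed under contexts. In a process the arguments of \<open>\<theta>\<close> and \<open>\<psi>\<close>
  inside a recursive specification are closed, so these two operators are never contexts of the
  recursion, negative premises do not interfere, and an induction on the derivation of a transition
  shows that the relation is a strong bisimulation up to bisimilarity.
\<close>

section \<open>Processes and closed substitutions\<close>

text \<open>Working up to bisimilarity is forced: after one transition a rooted pair is only
  bisimilar, and bisimilarity is in general no congruence for \<open>Plus\<close>, so neither rooted
  bisimilarity nor its context closure contains the derivatives. It is affordable because this
  residue of bisimilarity only ever lies under operators that a transition preserves. After a
  time-out the residue is weaker still: the derivatives are related in one environment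
  \<open>X\<close> only. Hence the static operators need a congruence property for triples as well,
  and \<open>\<psi>\<close> works because the \<open>\<theta>\<close> that it leaves behind turns a
  relation in the environment \<open>X\<close> back into an unrestricted one. The second obstacle is
  that idleness of a parallel composition depends on what both components offer, so time-outs cannot
  be matched componentwise. The way out is to compare initial actions before time-outs; this relies
  on exact one-step matching, which rootedness supplies.\<close>

lemma occurs_free_simps [simp]:
  "\<not> occurs_free x Inaction"
  "occurs_free x (Var y) \<longleftrightarrow> x = y"
  "occurs_free x (Prefix \<alpha> E) \<longleftrightarrow> occurs_free x E"
  "occurs_free x (Plus E F) \<longleftrightarrow> occurs_free x E \<or> occurs_free x F"
  "occurs_free x (Par S E F) \<longleftrightarrow> occurs_free x E \<or> occurs_free x F"
  "occurs_free x (Hide I E) \<longleftrightarrow> occurs_free x E"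
  "occurs_free x (Rename R E) \<longleftrightarrow> occurs_free x E"
  "occurs_free x (Theta L U E) \<longleftrightarrow> occurs_free x E"
  "occurs_free x (Psi X E) \<longleftrightarrow> occurs_free x E"
  "occurs_free x (Rec y \<S>) \<longleftrightarrow> x \<notin> dom \<S> \<and> (\<exists>z E. \<S> z = Some E \<and> occurs_free x E)"
  by (auto elim: occurs_free.cases intro: occurs_free.intros)

lemma wf_expr_simps [simp]:
  "wf_expr Inaction"
  "wf_expr (Var y)"
  "wf_expr (Prefix \<alpha> E) \<longleftrightarrow> wf_expr E"
  "wf_expr (Plus E F) \<longleftrightarrow> wf_expr E \<and> wf_expr F"
  "wf_expr (Par S E F) \<longleftrightarrow> wf_expr E \<and> wf_expr F"
  "wf_expr (Hide I E) \<longleftrightarrow> wf_expr E"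
  "wf_expr (Rename R E) \<longleftrightarrow> wf_expr E \<and> (\<forall>a. finite {b. (a, b) \<in> R})"
  "wf_expr (Theta L U E) \<longleftrightarrow> wf_expr E \<and> L \<subseteq> U"
  "wf_expr (Psi X E) \<longleftrightarrow> wf_expr E"
  "wf_expr (Rec y \<S>) \<longleftrightarrow> y \<in> dom \<S> \<and> (\<forall>x E. \<S> x = Some E \<longrightarrow> wf_expr E)"
  by (auto elim: wf_expr.cases intro: wf_expr.intros)

lemma valid_alt:
  "valid E \<longleftrightarrow>
     (\<forall>y \<S> F x. subexpr (Rec y \<S>) E \<longrightarrow> guard F (Rec y \<S>) \<longrightarrow> occurs_free x F \<longrightarrow> x \<notin> dom \<S>)"
  unfolding valid_def guard_def by blast

text \<open>Restricting the subexpression relation to recursive candidates removes its reflexive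
  case at every other constructor, so validity can be decomposed along the syntax.\<close>

lemma subexpr_Rec_simps:
  "\<not> subexpr (Rec y \<S>) Inaction"
  "\<not> subexpr (Rec y \<S>) (Var x)"
  "subexpr (Rec y \<S>) (Prefix \<alpha> E) \<longleftrightarrow> subexpr (Rec y \<S>) E"
  "subexpr (Rec y \<S>) (Plus E F) \<longleftrightarrow> subexpr (Rec y \<S>) E \<or> subexpr (Rec y \<S>) F"
  "subexpr (Rec y \<S>) (Par S E F) \<longleftrightarrow> subexpr (Rec y \<S>) E \<or> subexpr (Rec y \<S>) F"
  "subexpr (Rec y \<S>) (Hide I E) \<longleftrightarrow> subexpr (Rec y \<S>) E"
  "subexpr (Rec y \<S>) (Rename R E) \<longleftrightarrow> subexpr (Rec y \<S>) E"
  "subexpr (Rec y \<S>) (Theta L U E) \<longleftrightarrow> subexpr (Rec y \<S>) E"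
  "subexpr (Rec y \<S>) (Psi X E) \<longleftrightarrow> subexpr (Rec y \<S>) E"
  "subexpr (Rec y \<S>) (Rec z \<T>) \<longleftrightarrow>
     y = z \<and> \<S> = \<T> \<or> (\<exists>x E. \<T> x = Some E \<and> subexpr (Rec y \<S>) E)"
  by (blast elim: subexpr_elims intro: subexpr.intros)+

text \<open>Violations at inner specifications are already violations in the bodies; the outermost
  binder adds only the condition on the variables of \<open>dom \<S>\<close>.\<close>

lemma valid_Rec [simp]:
  "valid (Rec y \<S>) \<longleftrightarrow> (\<forall>x E. \<S> x = Some E \<longrightarrow>
     valid E \<and> (\<forall>F z. guard F E \<longrightarrow> occurs_free z F \<longrightarrow> z \<notin> dom \<S>))"
  (is "_ \<longleftrightarrow> ?R")
proof
  assume v: "valid (Rec y \<S>)"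
  show ?R
  proof (intro allI impI conjI)
    fix x E assume E: "\<S> x = Some E"
    show "valid E"
      using v E unfolding valid_alt subexpr_Rec_simps by blast
    fix F z assume "guard F E" "occurs_free z F"
    then show "z \<notin> dom \<S>"
      using v E guard_simps(10)[of F y \<S>] subexpr.intros(1) unfolding valid_alt by blast
  qed
next
  assume ?R
  then show "valid (Rec y \<S>)"
    unfolding valid_alt subexpr_Rec_simps guard_simps by blast
qed

lemma valid_simps [simp]:
  "valid Inaction"
  "valid (Var y)"
  "valid (Prefix \<alpha> E) \<longleftrightarrow> valid E"
  "valid (Plus E F) \<longleftrightarrow> valid E \<and> valid F"
  "valid (Par S E F) \<longleftrightarrow> valid E \<and> valid F"
  "valid (Hide I E) \<longleftrightarrow> valid E"
  "valid (Rename R E) \<longleftrightarrow> valid E"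
  "valid (Theta L U E) \<longleftrightarrow> valid E"
  "valid (Psi X E) \<longleftrightarrow> valid E"
  by (simp_all add: valid_alt subexpr_Rec_simps del: valid_Rec domIff) blast+

lemma process_alt: "process P \<longleftrightarrow> wf_expr P \<and> valid P \<and> (\<forall>x. \<not> occurs_free x P)"
  by (auto simp: process_def valid_exprs_def)

lemma process_simps [simp]:
  "process Inaction"
  "\<not> process (Var x)"
  "process (Prefix \<alpha> E) \<longleftrightarrow> process E"
  "process (Plus E F) \<longleftrightarrow> process E \<and> process F"
  "process (Par S E F) \<longleftrightarrow> process E \<and> process F"
  "process (Hide I E) \<longleftrightarrow> process E"
  "process (Rename R E) \<longleftrightarrow> process E \<and> (\<forall>a. finite {b. (a, b) \<in> R})"
  "process (Theta L U E) \<longleftrightarrow> process E \<and> L \<subseteq> U"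
  "process (Psi X E) \<longleftrightarrow> process E"
  by (auto simp: process_alt)

definition closed_map :: "('v \<Rightarrow> ('a, 'v) expr option) \<Rightarrow> bool" where
  "closed_map \<sigma> \<longleftrightarrow> (\<forall>x P. \<sigma> x = Some P \<longrightarrow> process P)"

lemma closed_map_restrict: "closed_map \<sigma> \<Longrightarrow> closed_map (\<sigma> |` A)"
  by (auto simp: closed_map_def restrict_map_def)

lemma occurs_free_subst:
  "closed_map \<sigma> \<Longrightarrow> occurs_free x (subst E \<sigma>) \<longleftrightarrow> occurs_free x E \<and> \<sigma> x = None"
proof (induction E arbitrary: \<sigma>)
  case (Var y)
  then show ?case by (auto simp: closed_map_def process_alt split: option.splits)
next
  case (Rec y \<S>)
  have "occurs_free x (subst E (\<sigma> |` (- dom \<S>))) \<longleftrightarrow>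
      occurs_free x E \<and> (\<sigma> |` (- dom \<S>)) x = None" if "\<S> z = Some E" for z E
    by (rule Rec.IH[OF rangeI[of \<S> z]]) (use that Rec.prems closed_map_restrict in auto)
  then have "occurs_free x (subst (Rec y \<S>) \<sigma>) \<longleftrightarrow>
      x \<notin> dom \<S> \<and> (\<exists>z E. \<S> z = Some E \<and> occurs_free x E \<and> (\<sigma> |` (- dom \<S>)) x = None)"
    by (auto simp: dom_def)
  then show ?case by (auto simp: restrict_map_def)
qed auto

lemma wf_subst: "closed_map \<sigma> \<Longrightarrow> wf_expr E \<Longrightarrow> wf_expr (subst E \<sigma>)"
proof (induction E arbitrary: \<sigma>)
  case (Var y)
  then show ?case by (auto simp: closed_map_def process_alt split: option.splits)
next
  case (Rec y \<S>)
  have "wf_expr (subst E (\<sigma> |` (- dom \<S>)))" if "\<S> z = Some E" for z E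
    by (rule Rec.IH[OF rangeI[of \<S> z]]) (use that Rec.prems closed_map_restrict in auto)
  with Rec.prems show ?case by (auto simp: dom_def)
qed auto

text \<open>A substituted process has only closed arguments below \<open>\<theta>\<close> and
  \<open>\<psi>\<close>, so a variable that is free in such an argument after substitution was free
  in one before. This is the reason why closed substitutions preserve validity.\<close>

lemma guard_subst_free:
  "closed_map \<sigma> \<Longrightarrow> guard G (subst E \<sigma>) \<Longrightarrow> occurs_free x G \<Longrightarrow> \<exists>F. guard F E \<and> occurs_free x F"
proof (induction E arbitrary: \<sigma>)
  case (Var y)
  then show ?case
    by (auto simp: closed_map_def guard_simps dest: process_guard_closed split: option.splits)
next
  case (Rec y \<S>)
  then obtain z E where z: "\<S> z = Some E" "guard G (subst E (\<sigma> |` (- dom \<S>)))"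
    by (auto simp: guard_simps)
  have "\<exists>F. guard F E \<and> occurs_free x F"
    by (rule Rec.IH[OF rangeI[of \<S> z] _ _ z(2)])
      (use z Rec.prems closed_map_restrict in auto)
  with z show ?case by (auto simp: guard_simps)
qed (fastforce simp: guard_simps occurs_free_subst)+

lemma valid_subst: "closed_map \<sigma> \<Longrightarrow> valid E \<Longrightarrow> valid (subst E \<sigma>)"
proof (induction E arbitrary: \<sigma>)
  case (Var y)
  then show ?case by (auto simp: closed_map_def process_alt split: option.splits)
next
  case (Rec y \<S>)
  let ?\<sigma> = "\<sigma> |` (- dom \<S>)"
  have closed: "closed_map ?\<sigma>"
    using Rec.prems(1) by (rule closed_map_restrict)
  have "valid (subst E ?\<sigma>) \<and> (\<forall>F z. guard F (subst E ?\<sigma>) \<longrightarrow> occurs_free z F \<longrightarrow> z \<notin> dom \<S>)"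
    if E: "\<S> u = Some E" for u E
  proof -
    have v: "valid E" "\<And>F z. guard F E \<Longrightarrow> occurs_free z F \<Longrightarrow> z \<notin> dom \<S>"
      using Rec.prems(2) E unfolding valid_Rec by metis+
    have "valid (subst E ?\<sigma>)"
      by (rule Rec.IH[OF rangeI[of \<S> u]]) (use E v closed in auto)
    with v(2) guard_subst_free[OF closed] show ?thesis by metis
  qed
  moreover have "dom (\<lambda>x. map_option f (\<S> x)) = dom \<S>" for f :: "('b, 'a) expr \<Rightarrow> ('b, 'a) expr"
    by (auto simp: dom_def)
  ultimately show ?case
    by (simp del: domIff) metis
qed auto

lemma process_subst:
  assumes "closed_map \<sigma>" "E \<in> valid_exprs" "\<And>x. occurs_free x E \<Longrightarrow> \<sigma> x \<noteq> None"
  shows "process (subst E \<sigma>)"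
  using assms by (auto simp: process_alt valid_exprs_def occurs_free_subst wf_subst valid_subst)

text \<open>The values of \<open>\<sigma>\<close> are closed and hence untouched by
  \<open>\<tau>\<close>, so \<open>\<sigma>\<close> takes precedence in the union; restriction below
  a binder distributes over that union.\<close>

lemma subst_subst:
  "closed_map \<sigma> \<Longrightarrow> subst (subst E \<sigma>) \<tau> = subst E (\<tau> ++ \<sigma>)"
proof (induction E arbitrary: \<sigma> \<tau>)
  case (Var x)
  show ?case
  proof (cases "\<sigma> x")
    case (Some P)
    then have "subst P \<tau> = P"
      using Var subst_closed[of P \<tau>] by (auto simp: closed_map_def process_alt)
    with Some show ?thesis by (simp add: map_add_def)
  qed (simp add: map_add_def)
next
  case (Rec y \<S>)
  have dom: "dom (\<lambda>x. map_option f (\<S> x)) = dom \<S>" for f :: "('b, 'a) expr \<Rightarrow> ('b, 'a) expr"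
    by (auto simp: dom_def)
  have "subst (subst E (\<sigma> |` (- dom \<S>))) (\<tau> |` (- dom \<S>)) = subst E ((\<tau> ++ \<sigma>) |` (- dom \<S>))"
    if "\<S> z = Some E" for z E
  proof -
    have "subst (subst E (\<sigma> |` (- dom \<S>))) (\<tau> |` (- dom \<S>)) =
        subst E (\<tau> |` (- dom \<S>) ++ \<sigma> |` (- dom \<S>))"
      by (rule Rec.IH[OF rangeI[of \<S> z]]) (use that Rec.prems closed_map_restrict in auto)
    also have "\<tau> |` (- dom \<S>) ++ \<sigma> |` (- dom \<S>) = (\<tau> ++ \<sigma>) |` (- dom \<S>)"
      by (auto simp: restrict_map_def map_add_def)
    finally show ?thesis .
  qed
  then show ?case
    by (auto simp: dom option.map_comp comp_def intro!: option.map_cong0 option.map_cong)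
qed auto

definition rec_map :: "('a, 'v) rspec \<Rightarrow> 'v \<Rightarrow> ('a, 'v) expr option" where
  "rec_map \<S> = (\<lambda>y. if y \<in> dom \<S> then Some (Rec y \<S>) else None)"

lemma unfold_rec_map: "unfold_rec E \<S> = subst E (rec_map \<S>)"
  by (simp add: unfold_rec_def rec_map_def)

lemma process_Rec_cong: "process (Rec x \<S>) \<Longrightarrow> y \<in> dom \<S> \<Longrightarrow> process (Rec y \<S>)"
  by (auto simp: process_alt)

lemma closed_rec_map: "process (Rec x \<S>) \<Longrightarrow> closed_map (rec_map \<S>)"
  by (auto simp: closed_map_def rec_map_def process_Rec_cong split: if_splits)

lemma process_Rec_body:
  "process (Rec x \<S>) \<Longrightarrow> \<S> y = Some E \<Longrightarrow> E \<in> valid_exprs \<and> (\<forall>x. occurs_free x E \<longrightarrow> x \<in> dom \<S>)"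
  by (auto simp: process_alt valid_exprs_def)

lemma process_unfold:
  assumes "process (Rec x \<S>)" "\<S> y = Some E"
  shows "process (unfold_rec E \<S>)"
  unfolding unfold_rec_map
  using process_Rec_body[OF assms] closed_rec_map[OF assms(1)]
  by (intro process_subst) (auto simp: rec_map_def)

lemma derivable_process: "derivable N P \<alpha> P' \<Longrightarrow> process P \<Longrightarrow> process P'"
  by (induction rule: derivable.induct) (auto dest: process_unfold)

lemma step_process: "step P \<alpha> P' \<Longrightarrow> process P \<Longrightarrow> process P'"
  using derivable_process step_derivable by blast

section \<open>Transitions of processes, operator by operator\<close>

inductive_cases derivable_InactionE: "derivable N Inaction \<alpha> P'"
inductive_cases derivable_PrefixE: "derivable N (Prefix \<beta> P) \<alpha> P'"
inductive_cases derivable_PlusE: "derivable N (Plus P Q) \<alpha> P'"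
inductive_cases derivable_ParE: "derivable N (Par S P Q) \<alpha> P'"
inductive_cases derivable_HideE: "derivable N (Hide I P) \<alpha> P'"
inductive_cases derivable_RenameE: "derivable N (Rename R P) \<alpha> P'"
inductive_cases derivable_ThetaE: "derivable N (Theta L U P) \<alpha> P'"
inductive_cases derivable_PsiE: "derivable N (Psi X P) \<alpha> P'"
inductive_cases derivable_RecE: "derivable N (Rec x \<S>) \<alpha> P'"

lemma step_Prefix: "process P \<Longrightarrow> step (Prefix \<beta> P) \<alpha> R \<longleftrightarrow> \<alpha> = \<beta> \<and> R = P"
  by (auto simp: step_iff_derivable_step intro: derivable.intros elim: derivable_PrefixE)

lemma step_Plus: "process P \<Longrightarrow> process Q \<Longrightarrow> step (Plus P Q) \<alpha> R \<longleftrightarrow> step P \<alpha> R \<or> step Q \<alpha> R"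
  by (auto simp: step_iff_derivable_step intro: derivable.intros elim: derivable_PlusE)

lemma step_Par:
  "process P \<Longrightarrow> process Q \<Longrightarrow> step (Par S P Q) \<alpha> R \<longleftrightarrow>
     (\<exists>P'. step P \<alpha> P' \<and> \<alpha> \<notin> Vis ` S \<and> R = Par S P' Q) \<or>
     (\<exists>Q'. step Q \<alpha> Q' \<and> \<alpha> \<notin> Vis ` S \<and> R = Par S P Q') \<or>
     (\<exists>a P' Q'. \<alpha> = Vis a \<and> a \<in> S \<and> step P \<alpha> P' \<and> step Q \<alpha> Q' \<and> R = Par S P' Q')"
  by (auto simp: step_iff_derivable_step intro: derivable.intros elim!: derivable_ParE)

lemma step_Hide:
  "process P \<Longrightarrow> step (Hide I P) \<alpha> R \<longleftrightarrow>
     (\<exists>P'. R = Hide I P' \<and> (step P \<alpha> P' \<and> \<alpha> \<notin> Vis ` I \<or> \<alpha> = Tau \<and> (\<exists>a\<in>I. step P (Vis a) P')))"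
  by (auto simp: step_iff_derivable_step intro: derivable.intros elim!: derivable_HideE)

lemma step_Rename:
  "process (Rename \<R> P) \<Longrightarrow> step (Rename \<R> P) \<alpha> R \<longleftrightarrow>
     (\<exists>P'. R = Rename \<R> P' \<and>
       ((\<exists>a b. (a, b) \<in> \<R> \<and> \<alpha> = Vis b \<and> step P (Vis a) P') \<or> \<alpha> \<in> {Tau, Timeout} \<and> step P \<alpha> P'))"
  using step_iff_derivable_step[of "Rename \<R> P"] step_iff_derivable_step[of P]
  by (auto intro: derivable.intros elim!: derivable_RenameE)


lemma step_Theta:
  assumes "process P" "L \<subseteq> U"
  shows "step (Theta L U P) \<alpha> R \<longleftrightarrow>
     (\<exists>P'. step P Tau P' \<and> \<alpha> = Tau \<and> R = Theta L U P') \<or> (step P \<alpha> R \<and> (\<alpha> \<in> Vis ` U \<or> idle L P))"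
    (is "_ \<longleftrightarrow> ?R")
proof -
  have "process (Theta L U P)" using assms by simp
  note iff = step_iff_derivable_step[OF this] step_iff_derivable_step[OF assms(1)]
  show ?thesis
  proof
    assume "step (Theta L U P) \<alpha> R"
    then show ?R unfolding iff idle_def by (cases rule: derivable_ThetaE) auto
  next
    assume ?R
    then show "step (Theta L U P) \<alpha> R"
      unfolding iff idle_def
      by (auto simp del: Un_insert_right intro: derivable.intros(13,14) dest: derivable.intros(15)[where U = U])
  qed
qed

lemma step_Psi:
  assumes "process P"
  shows "step (Psi X P) \<alpha> R \<longleftrightarrow> (step P \<alpha> R \<and> \<alpha> \<noteq> Timeout) \<or>
     (\<exists>P'. step P Timeout P' \<and> \<alpha> = Timeout \<and> idle X P \<and> R = Theta X X P')"
    (is "_ \<longleftrightarrow> ?R")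
proof -
  have "process (Psi X P)" using assms by simp
  note iff = step_iff_derivable_step[OF this] step_iff_derivable_step[OF assms(1)]
  show ?thesis
  proof
    assume "step (Psi X P) \<alpha> R"
    then show ?R unfolding iff idle_def by (cases rule: derivable_PsiE) auto
  next
    assume ?R
    then show "step (Psi X P) \<alpha> R"
      unfolding iff idle_def
      by (auto simp del: Un_insert_right intro: derivable.intros(16) dest: derivable.intros(17))
  qed
qed

lemma step_Rec:
  assumes "process (Rec x \<S>)" "\<S> x = Some E"
  shows "step (Rec x \<S>) \<alpha> R \<longleftrightarrow> step (unfold_rec E \<S>) \<alpha> R"
  unfolding step_iff_derivable_step[OF assms(1)] step_iff_derivable_step[OF process_unfold[OF assms]]
  using assms(2) by (auto elim: derivable_RecE intro: derivable.intros(12))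

section \<open>Reactive and non-reactive branching bisimilarity\<close>

text \<open>
  The flag \<open>rea\<close> selects one of the two equivalences of the theorem. For \<open>rea = False\<close> the triple
  part of a bisimulation is forced to coincide with the binary part, whatever its set argument.
\<close>

definition okt :: "bool \<Rightarrow> 'a set \<Rightarrow> ('a, 'v) expr \<Rightarrow> bool" where
  "okt rea X P \<longleftrightarrow> (rea \<longrightarrow> idle X P)"

text \<open>The target relations are parameters, separate from the relation that the pair comes
  from, so that the same clauses serve for bisimulations and for coinduction up to union with
  \<open>sim\<close>.\<close>

definition prog2 :: "('a, 'v) rel2 \<Rightarrow> ('a, 'v) rel3 \<Rightarrow> ('a, 'v) rel2" where
  "prog2 D D3 P Q \<longleftrightarrow>
     (\<forall>\<alpha> P'. step P \<alpha> P' \<and> \<alpha> \<noteq> Timeout \<longrightarrow>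
        (\<exists>Q1 Q2. weak_step Q Q1 \<and> opt_step Q1 \<alpha> Q2 \<and> D P Q1 \<and> D P' Q2)) \<and>
     (\<forall>Y. D3 P Y Q)"

text \<open>For \<open>rea = False\<close> three deviations encode ordinary branching bisimulation:
  a time-out may happen without idleness, its answer starts from a process still related to
  \<open>P\<close>, and every triple is backed by a pair. For \<open>rea = True\<close> all three
  vanish.\<close>

definition prog3 :: "bool \<Rightarrow> ('a, 'v) rel2 \<Rightarrow> ('a, 'v) rel3 \<Rightarrow> ('a, 'v) rel3" where
  "prog3 rea D D3 P X Q \<longleftrightarrow>
     (\<forall>P'. step P Tau P' \<longrightarrow>
        (\<exists>Q1 Q2. weak_step Q Q1 \<and> opt_step Q1 Tau Q2 \<and> D3 P X Q1 \<and> D3 P' X Q2)) \<and>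
     (\<forall>a P'. step P (Vis a) P' \<and> a \<in> X \<longrightarrow>
        (\<exists>Q1 Q2. weak_step Q Q1 \<and> step Q1 (Vis a) Q2 \<and> D3 P X Q1 \<and> D P' Q2)) \<and>
     (idle X P \<longrightarrow> (\<exists>Q0. weak_step Q Q0 \<and> D P Q0)) \<and>
     (\<forall>P'. okt rea X P \<and> step P Timeout P' \<longrightarrow>
        (\<exists>Q1 Q2. weak_step Q Q1 \<and> step Q1 Timeout Q2 \<and> D3 P' X Q2 \<and> (\<not> rea \<longrightarrow> D P Q1))) \<and>
     (stable P \<longrightarrow> (\<exists>Q0. weak_step Q Q0 \<and> stable Q0)) \<and>
     (\<not> rea \<longrightarrow> D P Q)"

definition gbisim :: "bool \<Rightarrow> ('a, 'v) rel2 \<Rightarrow> ('a, 'v) rel3 \<Rightarrow> bool" where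
  "gbisim rea D D3 \<longleftrightarrow> sym_on_processes D \<and> sym3_on_processes D3 \<and>
     (\<forall>P Q. D P Q \<longrightarrow> prog2 D D3 P Q) \<and> (\<forall>P X Q. D3 P X Q \<longrightarrow> prog3 rea D D3 P X Q)"

definition sim :: "bool \<Rightarrow> ('a, 'v) rel2" where
  "sim rea P Q \<longleftrightarrow> (\<exists>D D3. gbisim rea D D3 \<and> D P Q)"

definition sim3 :: "bool \<Rightarrow> ('a, 'v) rel3" where
  "sim3 rea P X Q \<longleftrightarrow> (\<exists>D D3. gbisim rea D D3 \<and> D3 P X Q)"

lemma prog2D:
  assumes "prog2 D D3 P Q"
  shows "step P \<alpha> P' \<Longrightarrow> \<alpha> \<noteq> Timeout \<Longrightarrow>
      \<exists>Q1 Q2. weak_step Q Q1 \<and> opt_step Q1 \<alpha> Q2 \<and> D P Q1 \<and> D P' Q2"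
    "D3 P Y Q"
  using assms by (simp_all add: prog2_def)

lemma prog3D:
  assumes "prog3 rea D D3 P X Q"
  shows "step P Tau P' \<Longrightarrow> \<exists>Q1 Q2. weak_step Q Q1 \<and> opt_step Q1 Tau Q2 \<and> D3 P X Q1 \<and> D3 P' X Q2"
    "step P (Vis a) P' \<Longrightarrow> a \<in> X \<Longrightarrow>
      \<exists>Q1 Q2. weak_step Q Q1 \<and> step Q1 (Vis a) Q2 \<and> D3 P X Q1 \<and> D P' Q2"
    "idle X P \<Longrightarrow> \<exists>Q0. weak_step Q Q0 \<and> D P Q0"
    "okt rea X P \<Longrightarrow> step P Timeout P' \<Longrightarrow>
      \<exists>Q1 Q2. weak_step Q Q1 \<and> step Q1 Timeout Q2 \<and> D3 P' X Q2 \<and> (\<not> rea \<longrightarrow> D P Q1)"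
    "stable P \<Longrightarrow> \<exists>Q0. weak_step Q Q0 \<and> stable Q0"
    "\<not> rea \<Longrightarrow> D P Q"
  using assms unfolding prog3_def by simp_all

lemma prog2_mono: "prog2 D D3 P Q \<Longrightarrow> D \<le> E \<Longrightarrow> D3 \<le> E3 \<Longrightarrow> prog2 E E3 P Q"
  unfolding prog2_def le_fun_def le_bool_def by (elim conjE, intro conjI) blast+

lemma prog3_mono: "prog3 rea D D3 P X Q \<Longrightarrow> D \<le> E \<Longrightarrow> D3 \<le> E3 \<Longrightarrow> prog3 rea E E3 P X Q"
  unfolding prog3_def le_fun_def le_bool_def by (elim conjE, intro conjI) blast+

lemma gbisimD:
  assumes "gbisim rea D D3"
  shows "D P Q \<Longrightarrow> process P \<and> process Q \<and> D Q P" "D3 P X Q \<Longrightarrow> process P \<and> process Q \<and> D3 Q X P"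
    "D P Q \<Longrightarrow> prog2 D D3 P Q" "D3 P X Q \<Longrightarrow> prog3 rea D D3 P X Q"
  using assms by (simp_all add: gbisim_def sym_on_processes_def sym3_on_processes_def)

lemma gbisimI:
  assumes "\<And>P Q. D P Q \<Longrightarrow> process P \<and> process Q \<and> D Q P"
    "\<And>P X Q. D3 P X Q \<Longrightarrow> process P \<and> process Q \<and> D3 Q X P"
    "\<And>P Q. D P Q \<Longrightarrow> prog2 D D3 P Q" "\<And>P X Q. D3 P X Q \<Longrightarrow> prog3 rea D D3 P X Q"
  shows "gbisim rea D D3"
  using assms by (simp add: gbisim_def sym_on_processes_def sym3_on_processes_def)

lemma simI: "gbisim rea D D3 \<Longrightarrow> D P Q \<Longrightarrow> sim rea P Q"
  unfolding sim_def by (intro exI conjI)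

lemma sim3I: "gbisim rea D D3 \<Longrightarrow> D3 P X Q \<Longrightarrow> sim3 rea P X Q"
  unfolding sim3_def by (intro exI conjI)

lemma gbisim_sim: "gbisim rea (sim rea :: ('a, 'v) rel2) (sim3 rea)"
proof -
  have le: "D \<le> sim rea" "D3 \<le> sim3 rea" if "gbisim rea D D3" for D :: "('a, 'v) rel2" and D3
    using simI[OF that] sim3I[OF that] by (auto simp: le_fun_def)
  show ?thesis
  proof (rule gbisimI)
    fix P Q :: "('a, 'v) expr" assume "sim rea P Q"
    then obtain D D3 where D: "gbisim rea D D3" "D P Q" unfolding sim_def by blast
    show "process P \<and> process Q \<and> sim rea Q P"
      using gbisimD(1)[OF D] simI[OF D(1)] by blast
    show "prog2 (sim rea) (sim3 rea) P Q"
      by (rule prog2_mono[OF gbisimD(3)[OF D] le[OF D(1)]])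
  next
    fix P Q :: "('a, 'v) expr" and X assume "sim3 rea P X Q"
    then obtain D D3 where D: "gbisim rea D D3" "D3 P X Q" unfolding sim3_def by blast
    show "process P \<and> process Q \<and> sim3 rea Q X P"
      using gbisimD(2)[OF D] sim3I[OF D(1)] by blast
    show "prog3 rea (sim rea) (sim3 rea) P X Q"
      by (rule prog3_mono[OF gbisimD(4)[OF D] le[OF D(1)]])
  qed
qed

text \<open>The union of the candidate with bisimilarity is again a bisimulation. This suits
  operators such as \<open>\<theta>\<close> that a visible action removes, leaving a pair that is
  merely bisimilar.\<close>

lemma sim_coinduct:
  assumes D: "\<And>P Q. D P Q \<Longrightarrow> process P \<and> process Q \<and> D Q P"
    and D3: "\<And>P X Q. D3 P X Q \<Longrightarrow> process P \<and> process Q \<and> D3 Q X P"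
    and p2: "\<And>P Q. D P Q \<Longrightarrow>
      prog2 (\<lambda>P Q. D P Q \<or> sim rea P Q) (\<lambda>P X Q. D3 P X Q \<or> sim3 rea P X Q) P Q"
    and p3: "\<And>P X Q. D3 P X Q \<Longrightarrow>
      prog3 rea (\<lambda>P Q. D P Q \<or> sim rea P Q) (\<lambda>P X Q. D3 P X Q \<or> sim3 rea P X Q) P X Q"
  shows "D P Q \<Longrightarrow> sim rea P Q" "D3 P X Q \<Longrightarrow> sim3 rea P X Q"
proof -
  let ?D = "\<lambda>P Q. D P Q \<or> sim rea P Q" and ?D3 = "\<lambda>P X Q. D3 P X Q \<or> sim3 rea P X Q"
  have le: "sim rea \<le> ?D" "sim3 rea \<le> ?D3"
    by (simp_all add: le_fun_def)
  have "gbisim rea ?D ?D3"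
  proof (rule gbisimI)
    fix P Q assume PQ: "?D P Q"
    then show "process P \<and> process Q \<and> ?D Q P"
      using D gbisimD(1)[OF gbisim_sim] by blast
    show "prog2 ?D ?D3 P Q"
      using PQ p2 prog2_mono[OF gbisimD(3)[OF gbisim_sim] le] by (elim disjE) assumption+
  next
    fix P X Q assume PQ: "?D3 P X Q"
    then show "process P \<and> process Q \<and> ?D3 Q X P"
      using D3 gbisimD(2)[OF gbisim_sim] by blast
    show "prog3 rea ?D ?D3 P X Q"
      using PQ p3 prog3_mono[OF gbisimD(4)[OF gbisim_sim] le] by (elim disjE) assumption+
  qed
  then show "D P Q \<Longrightarrow> sim rea P Q" "D3 P X Q \<Longrightarrow> sim3 rea P X Q"
    by (auto intro: simI sim3I)
qed

section \<open>Agreement with the given bisimilarities\<close>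

lemma br_bisimilar_sim:
  "br_bisimilar = (sim True :: ('a, 'v) rel2)" "br_bisimilar_in = (sim3 True :: ('a, 'v) rel3)"
proof -
  have "branching_reactive_bisim D D3 = gbisim True D D3" for D :: "('a, 'v) rel2" and D3
    by (simp only: branching_reactive_bisim_def gbisim_def prog2_def prog3_def okt_def simp_thms)
  then show "br_bisimilar = (sim True :: ('a, 'v) rel2)" "br_bisimilar_in = (sim3 True :: ('a, 'v) rel3)"
    by (intro ext; simp only: br_bisimilar_def sim_def br_bisimilar_in_def sim3_def)+
qed

lemma opt_step_Vis [simp]: "opt_step P (Vis a) P' \<longleftrightarrow> step P (Vis a) P'"
  by (simp add: opt_step_def)

lemma opt_step_Timeout [simp]: "opt_step P Timeout P' \<longleftrightarrow> step P Timeout P'"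
  by (simp add: opt_step_def)

lemma weak_step_refl [simp, intro]: "weak_step P P"
  by (simp add: weak_step_def)

lemma weak_step_trans [trans]: "weak_step P Q \<Longrightarrow> weak_step Q R \<Longrightarrow> weak_step P R"
  by (simp add: weak_step_def)

lemma weak_step_step: "weak_step P Q \<Longrightarrow> step Q Tau R \<Longrightarrow> weak_step P R"
  unfolding weak_step_def by (rule rtranclp.rtrancl_into_rtrancl)

lemma weak_step_opt: "weak_step P Q \<Longrightarrow> opt_step Q Tau R \<Longrightarrow> weak_step P R"
  by (auto simp: opt_step_def weak_step_step)

lemma weak_step_induct [consumes 1, case_names refl step]:
  assumes "weak_step P Q" "A P" "\<And>Q R. weak_step P Q \<Longrightarrow> step Q Tau R \<Longrightarrow> A Q \<Longrightarrow> A R"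
  shows "A Q"
  using assms(1) unfolding weak_step_def
  by (induction rule: rtranclp_induct) (use assms(2,3) in \<open>auto simp: weak_step_def\<close>)

lemma weak_step_stable: "weak_step P Q \<Longrightarrow> stable P \<Longrightarrow> Q = P"
  by (induction rule: weak_step_induct) (auto simp: stable_def)

lemma weak_step_process: "weak_step P Q \<Longrightarrow> process P \<Longrightarrow> process Q"
  by (induction rule: weak_step_induct) (auto intro: step_process)

lemma idle_alt: "idle X P \<longleftrightarrow> stable P \<and> (\<forall>a\<in>X. \<forall>Q. \<not> step P (Vis a) Q)"
  by (auto simp: idle_def stable_def initials_def)

lemma idle_stable: "idle X P \<Longrightarrow> stable P"
  by (simp add: idle_alt)

lemma sim3_False: "sim3 False P X Q \<longleftrightarrow> sim False P Q"
proof
  assume "sim3 False P X Q"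
  from gbisimD(4)[OF gbisim_sim this] show "sim False P Q" by (simp add: prog3_def)
next
  assume "sim False P Q"
  from gbisimD(3)[OF gbisim_sim this] show "sim3 False P X Q" by (simp add: prog2_def)
qed

text \<open>In one direction the triple part is taken constant in its set. Conversely, time-outs and
  stability, which are clauses on triples, are read off at an arbitrary set, because
  \<open>sim3 False\<close> ignores it.\<close>

lemma b_bisimilar_sim: "b_bisimilar = (sim False :: ('a, 'v) rel2)"
proof (intro ext iffI)
  fix P Q :: "('a, 'v) expr" assume "b_bisimilar P Q"
  then obtain D where D: "branching_bisim D" "D P Q"
    unfolding b_bisimilar_def by blast
  have t: "\<exists>Q1 Q2. weak_step Q Q1 \<and> opt_step Q1 \<alpha> Q2 \<and> D P Q1 \<and> D P' Q2"
    if "D P Q" "step P \<alpha> P'" for P Q P' \<alpha>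
    using D(1) that unfolding branching_bisim_def by metis
  have e: "\<exists>Q0. weak_step Q Q0 \<and> stable Q0" if "D P Q" "stable P" for P Q
    using D(1) that unfolding branching_bisim_def by metis
  have sym: "process P \<and> process Q \<and> D Q P" if "D P Q" for P Q
    using D(1) that unfolding branching_bisim_def sym_on_processes_def by metis
  have "gbisim False D (\<lambda>P X Q. D P Q)"
  proof (rule gbisimI)
    fix P Q assume PQ: "D P Q"
    show "prog2 D (\<lambda>P X Q. D P Q) P Q"
      using t[OF PQ] PQ by (simp add: prog2_def)
  next
    fix P X Q assume PQ: "D P Q"
    show "prog3 False D (\<lambda>P X Q. D P Q) P X Q"
      unfolding prog3_def
    proof (intro conjI allI impI)
      fix P' assume "okt False X P \<and> step P Timeout P'"
      then show "\<exists>Q1 Q2. weak_step Q Q1 \<and> step Q1 Timeout Q2 \<and> D P' Q2 \<and> (\<not> False \<longrightarrow> D P Q1)"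
        using t[OF PQ, of Timeout P'] by auto
    next
      fix a P' assume "step P (Vis a) P' \<and> a \<in> X"
      then show "\<exists>Q1 Q2. weak_step Q Q1 \<and> step Q1 (Vis a) Q2 \<and> D P Q1 \<and> D P' Q2"
        using t[OF PQ, of "Vis a" P'] by simp
    qed (use t[OF PQ] e[OF PQ] PQ in auto)
  qed (use sym in blast)+
  then show "sim False P Q" using D(2) by (rule simI)
next
  fix P Q :: "('a, 'v) expr" assume PQ: "sim False P Q"
  have "branching_bisim (sim False :: ('a, 'v) rel2)"
    unfolding branching_bisim_def
  proof (intro conjI allI impI)
    show "sym_on_processes (sim False :: ('a, 'v) rel2)"
      unfolding sym_on_processes_def by (intro allI impI gbisimD(1)[OF gbisim_sim])
  next
    fix P Q P' :: "('a, 'v) expr" and \<alpha> assume PQ: "sim False P Q" and P': "step P \<alpha> P'"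
    show "\<exists>Q1 Q2. weak_step Q Q1 \<and> opt_step Q1 \<alpha> Q2 \<and> sim False P Q1 \<and> sim False P' Q2"
    proof (cases "\<alpha> = Timeout")
      case True
      with P' show ?thesis
        using prog3D(4)[OF gbisimD(4)[OF gbisim_sim], of False P "{}" Q] PQ
        by (simp add: okt_def sim3_False) metis
    next
      case False
      with P' show ?thesis
        using gbisimD(3)[OF gbisim_sim PQ] by (auto simp: prog2_def)
    qed
  next
    fix P Q :: "('a, 'v) expr" assume "sim False P Q" "stable P"
    then show "\<exists>Q0. weak_step Q Q0 \<and> stable Q0"
      using gbisimD(4)[OF gbisim_sim, of False P "{}" Q] by (simp add: prog3_def sim3_False)
  qed
  with PQ show "b_bisimilar P Q" unfolding b_bisimilar_def by (intro exI conjI)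
qed

text \<open>
  The clauses of a bisimulation, strengthened so that they compose without symmetry: the process
  that answers an idle (stable) one is required to be idle (stable) itself.
\<close>

locale gsim =
  fixes rea :: bool and D :: "('a, 'v) rel2" and D3 :: "('a, 'v) rel3"
  assumes act: "D P Q \<Longrightarrow> step P \<alpha> P' \<Longrightarrow> \<alpha> \<noteq> Timeout \<Longrightarrow>
      \<exists>Q1 Q2. weak_step Q Q1 \<and> opt_step Q1 \<alpha> Q2 \<and> D P Q1 \<and> D P' Q2"
    and timeout: "D P Q \<Longrightarrow> step P Timeout P' \<Longrightarrow> okt rea X P \<Longrightarrow>
      \<exists>Q1 Q2. weak_step Q Q1 \<and> step Q1 Timeout Q2 \<and> okt rea X Q1 \<and> D P Q1 \<and> D3 P' X Q2"
    and triple: "D P Q \<Longrightarrow> D3 P X Q"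
    and tau3: "D3 P X Q \<Longrightarrow> step P Tau P' \<Longrightarrow>
      \<exists>Q1 Q2. weak_step Q Q1 \<and> opt_step Q1 Tau Q2 \<and> D3 P X Q1 \<and> D3 P' X Q2"
    and vis3: "D3 P X Q \<Longrightarrow> step P (Vis a) P' \<Longrightarrow> a \<in> X \<Longrightarrow>
      \<exists>Q1 Q2. weak_step Q Q1 \<and> step Q1 (Vis a) Q2 \<and> D3 P X Q1 \<and> D P' Q2"
    and idle3: "D3 P X Q \<Longrightarrow> idle X P \<Longrightarrow> \<exists>Q0. weak_step Q Q0 \<and> idle X Q0 \<and> D P Q0"
    and stable3: "D3 P X Q \<Longrightarrow> stable P \<Longrightarrow> \<exists>Q0. weak_step Q Q0 \<and> stable Q0 \<and> D3 P X Q0"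
    and pair: "D3 P X Q \<Longrightarrow> \<not> rea \<Longrightarrow> D P Q"
begin

lemma weak: "weak_step P P' \<Longrightarrow> D P Q \<Longrightarrow> \<exists>Q'. weak_step Q Q' \<and> D P' Q'"
proof (induction rule: weak_step_induct)
  case (step P' P'')
  then obtain Q' where "weak_step Q Q'" "D P' Q'" by blast
  with act[OF this(2) step(2)] show ?case
    by (auto intro: weak_step_trans weak_step_opt)
qed blast

lemma weak3: "weak_step P P' \<Longrightarrow> D3 P X Q \<Longrightarrow> \<exists>Q'. weak_step Q Q' \<and> D3 P' X Q'"
proof (induction rule: weak_step_induct)
  case (step P' P'')
  then obtain Q' where "weak_step Q Q'" "D3 P' X Q'" by blast
  with tau3[OF this(2) step(2)] show ?case
    by (auto intro: weak_step_trans weak_step_opt)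
qed blast

text \<open>In the reactive case \<open>okt\<close> is idleness, which upgrades the triple to a pair
  after internal moves of \<open>Q\<close>; in the other case every triple is a pair. The clause for
  pairs then applies.\<close>

lemma timeout3:
  assumes "D3 P X Q" "step P Timeout P'" "okt rea X P"
  shows "\<exists>Q1 Q2. weak_step Q Q1 \<and> step Q1 Timeout Q2 \<and> okt rea X Q1 \<and> D P Q1 \<and> D3 P' X Q2"
proof -
  have "\<exists>Q0. weak_step Q Q0 \<and> D P Q0"
  proof (cases rea)
    case True
    then show ?thesis using idle3[OF assms(1)] assms(3) unfolding okt_def by blast
  next
    case False
    then show ?thesis using pair[OF assms(1)] by blast
  qed
  then obtain Q0 where "weak_step Q Q0" "D P Q0" by blast
  with timeout[OF this(2) assms(2,3)] show ?thesis by (meson weak_step_trans)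
qed

end

text \<open>A move of the first process is answered by the middle one after internal moves, which
  \<open>weak\<close> and \<open>weak3\<close> carry over to the third. That the answering process
  is itself idle, stable or \<open>okt\<close> is exactly what lets the second relation continue
  from there.\<close>

lemma gsim_comp:
  assumes "gsim rea D D3" "gsim rea E E3"
  shows "gsim rea (\<lambda>P Q. \<exists>R. D P R \<and> E R Q) (\<lambda>P X Q. \<exists>R. D3 P X R \<and> E3 R X Q)"
proof -
  interpret D: gsim rea D D3 by fact
  interpret E: gsim rea E E3 by fact
  show ?thesis
  proof (unfold_locales, goal_cases)
    case (1 P Q \<alpha> P')
    then obtain R where R: "D P R" "E R Q" by blast
    obtain R1 R2 where R1: "weak_step R R1" "opt_step R1 \<alpha> R2" "D P R1" "D P' R2"
      using D.act R(1) 1 by blast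
    obtain Q1 where Q1: "weak_step Q Q1" "E R1 Q1"
      using E.weak R(2) R1(1) by blast
    show ?case
    proof (cases "\<alpha> = Tau \<and> R1 = R2")
      case True
      then show ?thesis using Q1 R1 unfolding opt_step_def by blast
    next
      case False
      then have "step R1 \<alpha> R2" using R1(2) by (auto simp: opt_step_def)
      from E.act[OF Q1(2) this 1(3)] show ?thesis
        using R1 Q1 weak_step_trans by blast
    qed
  next
    case (2 P Q P' X)
    then obtain R where R: "D P R" "E R Q" by blast
    obtain R1 R2 where R1: "weak_step R R1" "step R1 Timeout R2" "okt rea X R1" "D P R1" "D3 P' X R2"
      using D.timeout R(1) 2 by blast
    obtain Q1 where Q1: "weak_step Q Q1" "E R1 Q1"
      using E.weak R(2) R1(1) by blast
    from E.timeout[OF Q1(2) R1(2,3)] show ?case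
      using R1 Q1 weak_step_trans by blast
  next
    case (3 P Q X)
    then show ?case using D.triple E.triple by blast
  next
    case (4 P X Q P')
    then obtain R where R: "D3 P X R" "E3 R X Q" by blast
    obtain R1 R2 where R1: "weak_step R R1" "opt_step R1 Tau R2" "D3 P X R1" "D3 P' X R2"
      using D.tau3 R(1) 4 by blast
    obtain Q1 where Q1: "weak_step Q Q1" "E3 R1 X Q1"
      using E.weak3 R(2) R1(1) by blast
    show ?case
    proof (cases "R1 = R2")
      case True
      then show ?thesis using Q1 R1 unfolding opt_step_def by blast
    next
      case False
      then have "step R1 Tau R2" using R1(2) by (auto simp: opt_step_def)
      from E.tau3[OF Q1(2) this] show ?thesis
        using R1 Q1 weak_step_trans by blast
    qed
  next
    case (5 P X Q a P')
    then obtain R where R: "D3 P X R" "E3 R X Q" by blast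
    obtain R1 R2 where R1: "weak_step R R1" "step R1 (Vis a) R2" "D3 P X R1" "D P' R2"
      using D.vis3 R(1) 5 by blast
    obtain Q1 where Q1: "weak_step Q Q1" "E3 R1 X Q1"
      using E.weak3 R(2) R1(1) by blast
    from E.vis3[OF Q1(2) R1(2) 5(3)] show ?case
      using R1 Q1 weak_step_trans by blast
  next
    case (6 P X Q)
    then obtain R where R: "D3 P X R" "E3 R X Q" by blast
    obtain R1 where R1: "weak_step R R1" "idle X R1" "D P R1"
      using D.idle3 R(1) 6 by blast
    obtain Q1 where Q1: "weak_step Q Q1" "E3 R1 X Q1"
      using E.weak3 R(2) R1(1) by blast
    from E.idle3[OF Q1(2) R1(2)] show ?case
      using R1 Q1 weak_step_trans by blast
  next
    case (7 P X Q)
    then obtain R where R: "D3 P X R" "E3 R X Q" by blast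
    obtain R1 where R1: "weak_step R R1" "stable R1" "D3 P X R1"
      using D.stable3 R(1) 7 by blast
    obtain Q1 where Q1: "weak_step Q Q1" "E3 R1 X Q1"
      using E.weak3 R(2) R1(1) by blast
    from E.stable3[OF Q1(2) R1(2)] show ?case
      using R1 Q1 weak_step_trans by blast
  next
    case (8 P X Q)
    then show ?case using D.pair E.pair by blast
  qed
qed

lemma gsim_gbisim:
  assumes "gsim rea D D3" "sym_on_processes D" "sym3_on_processes D3"
  shows "gbisim rea D D3"
proof -
  interpret gsim rea D D3 by fact
  show ?thesis
  proof (rule gbisimI)
    fix P Q assume PQ: "D P Q"
    show "process P \<and> process Q \<and> D Q P"
      using assms(2) PQ by (simp add: sym_on_processes_def)
    show "prog2 D D3 P Q"
      using act[OF PQ] triple[OF PQ] by (simp add: prog2_def)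
  next
    fix P X Q assume PQ: "D3 P X Q"
    show "process P \<and> process Q \<and> D3 Q X P"
      using assms(3) PQ by (simp add: sym3_on_processes_def)
    show "prog3 rea D D3 P X Q"
      unfolding prog3_def
    proof (intro conjI allI impI)
      show "\<exists>Q0. weak_step Q Q0 \<and> D P Q0" if "idle X P"
        using idle3[OF PQ that] by blast
      show "\<exists>Q1 Q2. weak_step Q Q1 \<and> step Q1 Timeout Q2 \<and> D3 P' X Q2 \<and> (\<not> rea \<longrightarrow> D P Q1)"
        if "okt rea X P \<and> step P Timeout P'" for P'
        using timeout3[OF PQ, of P'] that by blast
      show "\<exists>Q0. weak_step Q Q0 \<and> stable Q0" if "stable P"
        using stable3[OF PQ that] by blast
    qed (use tau3[OF PQ] vis3[OF PQ] pair[OF PQ] in simp_all)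
  qed
qed

text \<open>An idle \<open>P\<close> can answer internal moves of its partner only by staying put.
  The partner may therefore run to a stable state without losing the relation, and by symmetry it
  then offers no action of \<open>X\<close>, since \<open>P\<close> could not answer it.\<close>

lemma gbisim_gsim:
  assumes b: "gbisim rea D D3"
  shows "gsim rea D D3"
proof -
  note p2 = gbisimD(3)[OF b] and p3 = gbisimD(4)[OF b]
  have sym: "D P Q \<Longrightarrow> D Q P" and sym3: "D3 P X Q \<Longrightarrow> D3 Q X P" for P X Q
    using gbisimD(1,2)[OF b] by simp_all
  have act: "\<exists>Q1 Q2. weak_step Q Q1 \<and> opt_step Q1 \<alpha> Q2 \<and> D P Q1 \<and> D P' Q2"
    if "D P Q" "step P \<alpha> P'" "\<alpha> \<noteq> Timeout" for P Q \<alpha> P'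
    using prog2D(1)[OF p2] that by blast
  have triple: "D P Q \<Longrightarrow> D3 P X Q" for P Q X
    using prog2D(2)[OF p2] by blast
  have tau3: "\<exists>Q1 Q2. weak_step Q Q1 \<and> opt_step Q1 Tau Q2 \<and> D3 P X Q1 \<and> D3 P' X Q2"
    if "D3 P X Q" "step P Tau P'" for P X Q P'
    using prog3D(1)[OF p3] that by blast
  have stable: "\<exists>Q0. weak_step Q Q0 \<and> stable Q0" if "D3 P X Q" "stable P" for P X Q
    using prog3D(5)[OF p3] that by blast
  have weak: "\<exists>Q'. weak_step Q Q' \<and> D P' Q'" if "weak_step P P'" "D P Q" for P P' Q
    using that
  proof (induction rule: weak_step_induct)
    case (step P' P'')
    then obtain Q' where "weak_step Q Q'" "D P' Q'" by blast
    with act[OF this(2) step(2)] show ?case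
      by (auto intro: weak_step_trans weak_step_opt)
  qed blast
  have weak3: "\<exists>Q'. weak_step Q Q' \<and> D3 P' X Q'" if "weak_step P P'" "D3 P X Q" for P P' X Q
    using that
  proof (induction rule: weak_step_induct)
    case (step P' P'')
    then obtain Q' where "weak_step Q Q'" "D3 P' X Q'" by blast
    with tau3[OF this(2) step(2)] show ?case
      by (auto intro: weak_step_trans weak_step_opt)
  qed blast
  have idle3: "\<exists>Q0. weak_step Q Q0 \<and> idle X Q0 \<and> D P Q0" if PQ: "D3 P X Q" and P: "idle X P" for P X Q
  proof -
    obtain Q0 where Q0: "weak_step Q Q0" "D P Q0"
      using prog3D(3)[OF p3[OF PQ] P] by blast
    obtain Q1 where Q1: "weak_step Q0 Q1" "stable Q1"
      using stable triple Q0(2) idle_stable P by blast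
    have D: "D Q1 P"
      using weak[OF Q1(1) sym[OF Q0(2)]] weak_step_stable idle_stable[OF P] by blast
    have "\<not> step Q1 (Vis a) R" if "a \<in> X" for a R
      using act[OF D, of "Vis a" R] weak_step_stable idle_stable[OF P] P that
      by (auto simp: idle_alt)
    then have "idle X Q1" using Q1 by (auto simp: idle_alt)
    then show ?thesis using D sym Q0 Q1 weak_step_trans by blast
  qed
  show ?thesis
  proof (unfold_locales, goal_cases)
    case (2 P Q P' X)
    show ?case
    proof (cases rea)
      case True
      then have P: "idle X P" using 2 by (simp add: okt_def)
      \<comment> \<open>Being stable, \<open>Q0\<close> is itself the process that performs the
        answering time-out; this yields both \<open>okt\<close> and the relation to
        \<open>P\<close>.\<close>
      obtain Q0 where Q0: "weak_step Q Q0" "idle X Q0" "D P Q0"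
        using idle3 triple 2(1) P by blast
      have "\<exists>Q1 Q2. weak_step Q0 Q1 \<and> step Q1 Timeout Q2 \<and> D3 P' X Q2"
        using prog3D(4)[OF p3[OF triple[OF Q0(3)]] 2(3,2)] by blast
      then show ?thesis
        using Q0 weak_step_stable[OF _ idle_stable[OF Q0(2)]] by (auto simp: okt_def)
    next
      case False
      then show ?thesis
        using prog3D(4)[OF p3[OF triple[OF 2(1)]] 2(3,2)] by (auto simp: okt_def)
    qed
  next
    case (5 P X Q a P')
    then show ?case using prog3D(2)[OF p3] by blast
  next
    case (7 P X Q)
    \<comment> \<open>The stable \<open>P\<close> mirrors the run of \<open>Q\<close> to a stable
      state by not moving at all, so the triple survives.\<close>
    then show ?case
      using stable weak3 sym3 weak_step_stable by metis
  next
    case (8 P X Q)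
    then show ?case using prog3D(6)[OF p3] by blast
  qed (use act triple tau3 idle3 in blast)+
qed

interpretation sim: gsim rea "sim rea" "sim3 rea" for rea
  by (rule gbisim_gsim[OF gbisim_sim])

lemma sim_sym: "sim rea P Q \<Longrightarrow> sim rea Q P"
  and sim_process: "sim rea P Q \<Longrightarrow> process P \<and> process Q"
  using gbisimD(1)[OF gbisim_sim, of rea P Q] by simp_all

lemma sim3_sym: "sim3 rea P X Q \<Longrightarrow> sim3 rea Q X P"
  and sim3_process: "sim3 rea P X Q \<Longrightarrow> process P \<and> process Q"
  using gbisimD(2)[OF gbisim_sim, of rea P X Q] by simp_all

lemma sim_if_gsim:
  assumes "gsim rea D D3" "sym_on_processes D" "sym3_on_processes D3"
  shows "D P Q \<Longrightarrow> sim rea P Q" "D3 P X Q \<Longrightarrow> sim3 rea P X Q"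
  using simI[OF gsim_gbisim[OF assms]] sim3I[OF gsim_gbisim[OF assms]] by simp_all

lemma sim_refl:
  assumes "process P"
  shows "sim rea P P"
proof -
  let ?D = "\<lambda>P Q. process P \<and> P = Q" and ?D3 = "\<lambda>P X Q. process P \<and> P = Q"
  have "gsim rea ?D ?D3"
    by unfold_locales (auto simp: opt_step_def intro: step_process)
  then show ?thesis
    by (rule sim_if_gsim) (use assms in \<open>auto simp: sym_on_processes_def sym3_on_processes_def\<close>)
qed

lemma sim3_refl: "process P \<Longrightarrow> sim3 rea P X P"
  by (rule sim.triple[OF sim_refl])

lemma sim_comp:
  fixes P Q :: "('a, 'v) expr"
  shows "(\<exists>R. sim rea P R \<and> sim rea R Q) \<Longrightarrow> sim rea P Q"
    "(\<exists>R. sim3 rea P X R \<and> sim3 rea R X Q) \<Longrightarrow> sim3 rea P X Q"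
proof -
  have sym: "sym_on_processes (\<lambda>P Q :: ('a, 'v) expr. \<exists>R. sim rea P R \<and> sim rea R Q)"
    unfolding sym_on_processes_def using sim_sym sim_process by blast
  have sym3: "sym3_on_processes (\<lambda>(P :: ('a, 'v) expr) X Q. \<exists>R. sim3 rea P X R \<and> sim3 rea R X Q)"
    unfolding sym3_on_processes_def using sim3_sym sim3_process by blast
  show "(\<exists>R. sim rea P R \<and> sim rea R Q) \<Longrightarrow> sim rea P Q"
    by (rule sim_if_gsim(1)[OF gsim_comp[OF sim.gsim_axioms sim.gsim_axioms] sym sym3])
  show "(\<exists>R. sim3 rea P X R \<and> sim3 rea R X Q) \<Longrightarrow> sim3 rea P X Q"
    by (rule sim_if_gsim(2)[OF gsim_comp[OF sim.gsim_axioms sim.gsim_axioms] sym sym3])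
qed

lemma sim_trans [trans]: "sim rea P Q \<Longrightarrow> sim rea Q R \<Longrightarrow> sim rea P R"
  using sim_comp(1) by blast

lemma sim3_trans [trans]: "sim3 rea P X Q \<Longrightarrow> sim3 rea Q X R \<Longrightarrow> sim3 rea P X R"
  using sim_comp(2) by blast

section \<open>Strong bisimulation up to bisimilarity\<close>

text \<open>A time-out happens in an environment that allows just \<open>X\<close>, and this
  environment persists, so the derivatives need to agree only there. Derivatives of any other action
  are compared without reference to an environment.\<close>

definition sim_after :: "bool \<Rightarrow> 'a act \<Rightarrow> 'a set \<Rightarrow> ('a, 'v) rel2" where
  "sim_after rea \<alpha> X P Q \<longleftrightarrow> (if \<alpha> = Timeout then sim3 rea P X Q else sim rea P Q)"

text \<open>\<open>C\<close> matches single steps by single steps, hence related processes have the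
  same initial actions and idleness passes across \<open>C\<close>. Bisimilarity is allowed only on
  the side of the answer; \<open>C\<close> followed by \<open>sim\<close> is then a
  \<open>gsim\<close>, though not a symmetric one in general.\<close>

lemma sim_upto:
  fixes C :: "('a, 'v) rel2"
  assumes C: "sym_on_processes C"
    and step: "\<And>P Q \<alpha> P' X. C P Q \<Longrightarrow> step P \<alpha> P' \<Longrightarrow> (\<alpha> = Timeout \<Longrightarrow> okt rea X P) \<Longrightarrow>
      \<exists>R Q'. step Q \<alpha> Q' \<and> C P' R \<and> sim_after rea \<alpha> X R Q'"
  shows "C P Q \<Longrightarrow> sim rea P Q"
proof -
  have sym: "C P Q \<Longrightarrow> C Q P" for P Q
    using C unfolding sym_on_processes_def by blast
  have proc: "C P Q \<Longrightarrow> process P \<and> process Q" for P Q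
    using C unfolding sym_on_processes_def by blast
  have act: "\<exists>R Q'. step Q \<alpha> Q' \<and> C P' R \<and> sim rea R Q'"
    if "C P Q" "step P \<alpha> P'" "\<alpha> \<noteq> Timeout" for P Q \<alpha> P'
    using step that unfolding sim_after_def by meson
  have timeout: "\<exists>R Q'. step Q Timeout Q' \<and> C P' R \<and> sim3 rea R X Q'"
    if "C P Q" "step P Timeout P'" "okt rea X P" for P Q P' X
    using step[of P Q Timeout P' X] that unfolding sim_after_def by auto
  have stable: "stable Q" if "C P Q" "stable P" for P Q
    using act[OF sym[OF that(1)]] that unfolding stable_def by blast
  have idle: "idle X Q" if "C P Q" "idle X P" for P Q X
    using act[OF sym[OF that(1)]] that stable unfolding idle_alt by blast
  have okt: "okt rea X Q" if "C P Q" "okt rea X P" for P Q X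
    using that idle unfolding okt_def by blast
  let ?E = "\<lambda>P Q. \<exists>R. C P R \<and> sim rea R Q" and ?E3 = "\<lambda>P X Q. \<exists>R. C P R \<and> sim3 rea R X Q"
  have E: "gsim rea ?E ?E3"
  proof (unfold_locales, goal_cases)
    case (1 P Q \<alpha> P')
    then obtain R where R: "C P R" "sim rea R Q" by blast
    obtain R' S where "step R \<alpha> R'" "C P' S" "sim rea S R'"
      using act R(1) 1 by blast
    with sim.act[OF R(2) this(1) 1(3)] R show ?case using sim_trans by blast
  next
    case (2 P Q P' X)
    then obtain R where R: "C P R" "sim rea R Q" by blast
    obtain R' S where "step R Timeout R'" "C P' S" "sim3 rea S X R'"
      using timeout R(1) 2 by blast
    with sim.timeout[OF R(2) this(1) okt[OF R(1) 2(3)]] R show ?case using sim3_trans by blast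
  next
    case (3 P Q X)
    then show ?case using sim.triple by blast
  next
    case (4 P X Q P')
    then obtain R where R: "C P R" "sim3 rea R X Q" by blast
    obtain R' S where "step R Tau R'" "C P' S" "sim rea S R'"
      using act[OF R(1) 4(2)] by blast
    with sim.tau3[OF R(2) this(1)] R show ?case using sim3_trans sim.triple by blast
  next
    case (5 P X Q a P')
    then obtain R where R: "C P R" "sim3 rea R X Q" by blast
    obtain R' S where "step R (Vis a) R'" "C P' S" "sim rea S R'"
      using act[OF R(1) 5(2)] by blast
    with sim.vis3[OF R(2) this(1) 5(3)] R show ?case using sim_trans by blast
  next
    case (6 P X Q)
    then show ?case using idle sim.idle3 by blast
  next
    case (7 P X Q)
    then show ?case using stable sim.stable3 by blast
  next
    case (8 P X Q)
    then show ?case using sim.pair by blast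
  qed
  assume PQ: "C P Q"
  show "sim rea P Q"
  \<comment> \<open>Putting \<open>sim\<close> in front as well restores symmetry, because
    \<open>C\<close> and \<open>sim\<close> are symmetric; reflexivity of \<open>sim\<close> embeds
    \<open>C\<close>.\<close>
  proof (rule sim_if_gsim(1)[OF gsim_comp[OF sim.gsim_axioms[of rea] E]])
    show "\<exists>R. sim rea P R \<and> (\<exists>S. C R S \<and> sim rea S Q)"
      using PQ proc sim_refl by blast
  next
    show "sym_on_processes (\<lambda>P Q. \<exists>R. sim rea P R \<and> (\<exists>S. C R S \<and> sim rea S Q))"
      unfolding sym_on_processes_def using sim_sym sym sim_process by blast
  next
    show "sym3_on_processes (\<lambda>P X Q. \<exists>R. sim3 rea P X R \<and> (\<exists>S. C R S \<and> sim3 rea S X Q))"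
      unfolding sym3_on_processes_def using sim3_sym sym sim3_process by blast
  qed
qed

section \<open>Congruence for the static operators\<close>

text \<open>Hiding and renaming act on labels only: \<open>ren \<beta> \<alpha>\<close> reads as "a
  \<open>\<beta>\<close> of the argument shows as \<open>\<alpha>\<close>". It is a relation because
  renaming may be many-valued and may block actions. A visible action may become \<open>Tau\<close>;
  time-outs stay time-outs.\<close>

locale relabel =
  fixes f :: "('a, 'v) expr \<Rightarrow> ('a, 'v) expr" and ren :: "'a act \<Rightarrow> 'a act \<Rightarrow> bool"
  assumes process: "process (f P) \<longleftrightarrow> process P"
    and step: "process P \<Longrightarrow> step (f P) \<alpha> R \<longleftrightarrow> (\<exists>\<beta> P'. step P \<beta> P' \<and> ren \<beta> \<alpha> \<and> R = f P')"
    and Tau: "ren Tau \<alpha> \<longleftrightarrow> \<alpha> = Tau"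
    and Timeout: "ren \<beta> Timeout \<longleftrightarrow> \<beta> = Timeout" "ren Timeout \<alpha> \<longleftrightarrow> \<alpha> = Timeout"
begin

text \<open>An action that \<open>f\<close> turns into \<open>Tau\<close> belongs to
  \<open>pre X\<close> for every \<open>X\<close>, as no environment of \<open>f P\<close> can block
  it; \<open>pre {}\<close> thus consists of the hidden actions.\<close>

definition pre :: "'a set \<Rightarrow> 'a set" where
  "pre X = {a. \<exists>\<alpha> \<in> Vis ` X \<union> {Tau}. ren (Vis a) \<alpha>}"

lemma idle_iff:
  assumes "process P"
  shows "idle X (f P) \<longleftrightarrow> idle (pre X) P"
proof -
  have "idle X (f P) \<longleftrightarrow> (\<forall>\<alpha> \<in> Vis ` X \<union> {Tau}. \<forall>\<beta> P'. step P \<beta> P' \<longrightarrow> \<not> ren \<beta> \<alpha>)"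
    unfolding idle_alt stable_def step[OF assms] by simp blast
  also have "\<dots> \<longleftrightarrow> idle (pre X) P"
  proof
    assume "\<forall>\<alpha> \<in> Vis ` X \<union> {Tau}. \<forall>\<beta> P'. step P \<beta> P' \<longrightarrow> \<not> ren \<beta> \<alpha>"
    then show "idle (pre X) P" by (auto simp: idle_alt stable_def pre_def Tau)
  next
    assume *: "idle (pre X) P"
    have "\<not> ren \<beta> \<alpha>" if "\<alpha> \<in> Vis ` X \<union> {Tau}" "step P \<beta> P'" for \<alpha> \<beta> P'
      using * that by (cases \<beta>) (auto simp: idle_alt stable_def pre_def Tau Timeout)
    then show "\<forall>\<alpha> \<in> Vis ` X \<union> {Tau}. \<forall>\<beta> P'. step P \<beta> P' \<longrightarrow> \<not> ren \<beta> \<alpha>" by blast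
  qed
  finally show ?thesis .
qed

lemma stable_iff: "process P \<Longrightarrow> stable (f P) \<longleftrightarrow> idle (pre {}) P"
  using idle_iff[of P "{}"] by (simp add: idle_alt)

lemma opt: "process P \<Longrightarrow> opt_step P \<beta> P' \<Longrightarrow> ren \<beta> \<alpha> \<Longrightarrow> opt_step (f P) \<alpha> (f P')"
  by (auto simp: opt_step_def step Tau)

lemma weak: "weak_step P P' \<Longrightarrow> process P \<Longrightarrow> weak_step (f P) (f P')"
proof (induction rule: weak_step_induct)
  case (step P' P'')
  then have "step (f P') Tau (f P'')"
    using relabel.step[OF relabel_axioms] weak_step_process Tau by blast
  with step show ?case by (simp add: weak_step_step)
qed simp

text \<open>The argument runs in the environment \<open>pre X\<close>. An internal move of
  \<open>f P\<close> may stem from a visible action of \<open>P\<close>; since this action lies in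
  \<open>pre X\<close>, it is matched, even with derivatives that form a pair.\<close>

lemma gbisim:
  "gbisim rea (\<lambda>A B. \<exists>P Q. A = f P \<and> B = f Q \<and> sim rea P Q)
     (\<lambda>A X B. \<exists>P Q. A = f P \<and> B = f Q \<and> sim3 rea P (pre X) Q)"
  (is "gbisim _ ?D ?D3")
proof (rule gbisimI)
  fix A B assume "?D A B"
  then obtain P Q where AB: "A = f P" "B = f Q" and PQ: "sim rea P Q" by blast
  note proc = sim_process[OF PQ]
  show "process A \<and> process B \<and> ?D B A"
    unfolding AB process using PQ proc sim_sym by blast
  show "prog2 ?D ?D3 A B"
    unfolding prog2_def
  proof (intro conjI allI impI)
    fix \<alpha> A' assume "step A \<alpha> A' \<and> \<alpha> \<noteq> Timeout"
    then obtain \<beta> P' where P': "step P \<beta> P'" "ren \<beta> \<alpha>" "A' = f P'" "\<beta> \<noteq> Timeout"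
      using step proc AB Timeout by blast
    obtain Q1 Q2 where Q: "weak_step Q Q1" "opt_step Q1 \<beta> Q2" "sim rea P Q1" "sim rea P' Q2"
      using sim.act[OF PQ P'(1,4)] by blast
    then have "weak_step B (f Q1)" "opt_step (f Q1) \<alpha> (f Q2)"
      using AB proc weak opt P'(2) weak_step_process by blast+
    with Q AB P' show "\<exists>Q1 Q2. weak_step B Q1 \<and> opt_step Q1 \<alpha> Q2 \<and> ?D A Q1 \<and> ?D A' Q2"
      by blast
  next
    fix Y show "?D3 A Y B" using AB sim.triple[OF PQ] by blast
  qed
next
  fix A X B assume "?D3 A X B"
  then obtain P Q where AB: "A = f P" "B = f Q" and PQ: "sim3 rea P (pre X) Q" by blast
  note proc = sim3_process[OF PQ]
  show "process A \<and> process B \<and> ?D3 B X A"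
    unfolding AB process using PQ proc sim3_sym by blast
  have vis: "\<exists>Q1 Q2. weak_step B (f Q1) \<and> step (f Q1) \<alpha> (f Q2) \<and> sim3 rea P (pre X) Q1 \<and> sim rea P' Q2"
    if a: "step P (Vis a) P'" "ren (Vis a) \<alpha>" "a \<in> pre X" for a \<alpha> P'
  proof -
    obtain Q1 Q2 where Q: "weak_step Q Q1" "step Q1 (Vis a) Q2" "sim3 rea P (pre X) Q1" "sim rea P' Q2"
      using sim.vis3[OF PQ a(1,3)] by blast
    then have "weak_step B (f Q1)" "step (f Q1) \<alpha> (f Q2)"
      using AB proc weak step a(2) weak_step_process by blast+
    with Q show ?thesis by blast
  qed
  show "prog3 rea ?D ?D3 A X B"
    unfolding prog3_def
  proof (intro conjI allI impI)
    fix A' assume "step A Tau A'"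
    then obtain \<beta> P' where P': "step P \<beta> P'" "ren \<beta> Tau" "A' = f P'"
      using step proc AB by blast
    show "\<exists>Q1 Q2. weak_step B Q1 \<and> opt_step Q1 Tau Q2 \<and> ?D3 A X Q1 \<and> ?D3 A' X Q2"
    proof (cases \<beta>)
      case (Vis a)
      then have "a \<in> pre X" using P' by (auto simp: pre_def)
      then obtain Q1 Q2 where "weak_step B (f Q1)" "step (f Q1) Tau (f Q2)"
          "sim3 rea P (pre X) Q1" "sim rea P' Q2"
        using vis P' Vis by blast
      then show ?thesis using AB P' sim.triple unfolding opt_step_def by blast
    next
      case Tau
      then obtain Q1 Q2 where Q: "weak_step Q Q1" "opt_step Q1 Tau Q2"
          "sim3 rea P (pre X) Q1" "sim3 rea P' (pre X) Q2"
        using sim.tau3[OF PQ] P' by blast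
      then have "weak_step B (f Q1)" "opt_step (f Q1) Tau (f Q2)"
        using AB proc weak opt P'(2) weak_step_process Tau by blast+
      with Q AB P' show ?thesis by blast
    next
      case t: Timeout
      then show ?thesis using P' Timeout by simp
    qed
  next
    fix b A' assume "step A (Vis b) A' \<and> b \<in> X"
    then obtain \<beta> P' where P': "step P \<beta> P'" "ren \<beta> (Vis b)" "A' = f P'" and b: "b \<in> X"
      using step proc AB by blast
    then obtain a where a: "\<beta> = Vis a" "a \<in> pre X"
      by (cases \<beta>) (auto simp: pre_def Tau Timeout)
    then obtain Q1 Q2 where "weak_step B (f Q1)" "step (f Q1) (Vis b) (f Q2)"
        "sim3 rea P (pre X) Q1" "sim rea P' Q2"
      using vis P' by blast
    then show "\<exists>Q1 Q2. weak_step B Q1 \<and> step Q1 (Vis b) Q2 \<and> ?D3 A X Q1 \<and> ?D A' Q2"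
      using AB P' by blast
  next
    assume "idle X A"
    then have "idle (pre X) P" using AB proc idle_iff by blast
    then obtain Q0 where "weak_step Q Q0" "sim rea P Q0"
      using sim.idle3[OF PQ] by blast
    then show "\<exists>Q0. weak_step B Q0 \<and> ?D A Q0"
      using AB weak proc by blast
  next
    fix A' assume A': "okt rea X A \<and> step A Timeout A'"
    then have okt: "okt rea (pre X) P" using AB proc idle_iff by (auto simp: okt_def)
    obtain P' where P': "step P Timeout P'" "A' = f P'"
      using A' proc AB by (auto simp: step Timeout)
    obtain Q1 Q2 where Q: "weak_step Q Q1" "step Q1 Timeout Q2" "sim rea P Q1" "sim3 rea P' (pre X) Q2"
      using sim.timeout3[OF PQ P'(1) okt] by blast
    then have "weak_step B (f Q1)" "step (f Q1) Timeout (f Q2)"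
      using AB proc weak step weak_step_process Timeout by blast+
    with Q AB P' show "\<exists>Q1 Q2. weak_step B Q1 \<and> step Q1 Timeout Q2 \<and> ?D3 A' X Q2 \<and>
        (\<not> rea \<longrightarrow> ?D A Q1)" by blast
  next
    assume "stable A"
    then have P: "idle (pre {}) P" using AB proc stable_iff by blast
    then obtain Q0 where Q0: "weak_step Q Q0" "stable Q0" "sim3 rea P (pre X) Q0"
      using sim.stable3[OF PQ idle_stable] by blast
    \<comment> \<open>For \<open>f Q0\<close> to be stable, \<open>Q0\<close> must not perform a
      hidden action either. As \<open>pre {} \<subseteq> pre X\<close>, such an action would have to
      be matched by \<open>P\<close>, which is idle on \<open>pre {}\<close>.\<close>
    have "\<not> step Q0 (Vis a) R" if "a \<in> pre {}" for a R
    proof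
      assume "step Q0 (Vis a) R"
      moreover have "a \<in> pre X" using that by (auto simp: pre_def)
      ultimately have "\<exists>P1 P2. weak_step P P1 \<and> step P1 (Vis a) P2"
        using sim.vis3[OF sim3_sym[OF Q0(3)]] by blast
      then show False using P weak_step_stable that unfolding idle_alt by blast
    qed
    then have "stable (f Q0)"
      using Q0(2) stable_iff[of Q0] sim3_process[OF Q0(3)] by (auto simp: idle_alt)
    then show "\<exists>Q0. weak_step B Q0 \<and> stable Q0"
      using AB weak proc Q0 by blast
  next
    assume "\<not> rea"
    then show "?D A B" using AB sim.pair[OF PQ] by blast
  qed
qed

lemma sim_cong: "sim rea P Q \<Longrightarrow> sim rea (f P) (f Q)"
  by (rule simI[OF gbisim]) blast

lemma sim3_cong: "sim3 rea P (pre X) Q \<Longrightarrow> sim3 rea (f P) X (f Q)"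
  by (rule sim3I[OF gbisim]) blast

end

definition hide_act :: "'a set \<Rightarrow> 'a act \<Rightarrow> 'a act \<Rightarrow> bool" where
  "hide_act I \<beta> \<alpha> \<longleftrightarrow> \<alpha> = (if \<beta> \<in> Vis ` I then Tau else \<beta>)"

definition rename_act :: "('a \<times> 'a) set \<Rightarrow> 'a act \<Rightarrow> 'a act \<Rightarrow> bool" where
  "rename_act \<R> \<beta> \<alpha> \<longleftrightarrow> \<beta> = \<alpha> \<and> \<alpha> \<in> {Tau, Timeout} \<or> (\<exists>(a, b) \<in> \<R>. \<beta> = Vis a \<and> \<alpha> = Vis b)"

lemma relabel_Hide: "relabel (Hide I) (hide_act I)"
proof
  fix P R :: "('a, 'v) expr" and \<alpha> assume P: "process P"
  show "step (Hide I P) \<alpha> R \<longleftrightarrow> (\<exists>\<beta> P'. step P \<beta> P' \<and> hide_act I \<beta> \<alpha> \<and> R = Hide I P')"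
    unfolding step_Hide[OF P] hide_act_def by auto
qed (auto simp: hide_act_def)

lemma relabel_Rename:
  assumes "\<And>a. finite {b. (a, b) \<in> \<R>}"
  shows "relabel (Rename \<R>) (rename_act \<R>)"
proof
  fix P R :: "('a, 'v) expr" and \<alpha> assume P: "process P"
  have "process (Rename \<R> P)" using P assms by simp
  from step_Rename[OF this]
  show "step (Rename \<R> P) \<alpha> R \<longleftrightarrow> (\<exists>\<beta> P'. step P \<beta> P' \<and> rename_act \<R> \<beta> \<alpha> \<and> R = Rename \<R> P')"
    unfolding rename_act_def by auto
qed (use assms in \<open>auto simp: rename_act_def\<close>)

text \<open>
  The actions that \<open>P\<close> can perform in \<open>Par S P G\<close> when the environment allows \<open>X\<close> and \<open>G\<close> is idle.
\<close>

definition avail :: "'a set \<Rightarrow> 'a set \<Rightarrow> ('a, 'v) expr \<Rightarrow> 'a set" where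
  "avail X S G = {a \<in> X. a \<in> S \<longrightarrow> Vis a \<in> initials step G}"

section \<open>Parallel composition\<close>

lemma stable_Par:
  assumes "process P" "process G"
  shows "stable (Par S P G) \<longleftrightarrow> stable P \<and> stable G"
  unfolding stable_def step_Par[OF assms] by auto

text \<open>Outside \<open>S\<close> each component can act alone; inside \<open>S\<close> both
  must, so actions of \<open>S\<close> count only against \<open>P\<close>, and only those that
  \<open>G\<close> offers. The split is deliberately asymmetric: the whole synchronization burden is
  put on the first component.\<close>

lemma idle_Par:
  assumes "process P" "process G"
  shows "idle X (Par S P G) \<longleftrightarrow> idle (avail X S G) P \<and> idle (X - S) G"
proof -
  have "(\<forall>R. \<not> step (Par S P G) (Vis a) R) \<longleftrightarrow>
      (if a \<in> S then (\<forall>R. \<not> step P (Vis a) R) \<or> (\<forall>R. \<not> step G (Vis a) R)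
       else (\<forall>R. \<not> step P (Vis a) R) \<and> (\<forall>R. \<not> step G (Vis a) R))" for a
    unfolding step_Par[OF assms] by auto
  then show ?thesis
    unfolding idle_alt stable_Par[OF assms] avail_def initials_def by auto
qed

lemma step_Par_left: "step P \<alpha> P' \<Longrightarrow> \<alpha> \<notin> Vis ` S \<Longrightarrow> process P \<Longrightarrow> process Q \<Longrightarrow>
    step (Par S P Q) \<alpha> (Par S P' Q)"
  and step_Par_right: "step Q \<alpha> Q' \<Longrightarrow> \<alpha> \<notin> Vis ` S \<Longrightarrow> process P \<Longrightarrow> process Q \<Longrightarrow>
    step (Par S P Q) \<alpha> (Par S P Q')"
  and step_Par_sync: "step P (Vis a) P' \<Longrightarrow> step Q (Vis a) Q' \<Longrightarrow> a \<in> S \<Longrightarrow> process P \<Longrightarrow> process Q \<Longrightarrow>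
    step (Par S P Q) (Vis a) (Par S P' Q')"
  by (auto simp: step_Par)

lemma opt_Par: "opt_step P \<alpha> P' \<Longrightarrow> \<alpha> \<notin> Vis ` S \<Longrightarrow> process P \<Longrightarrow> process G \<Longrightarrow>
    opt_step (Par S P G) \<alpha> (Par S P' G)"
  by (auto simp: opt_step_def step_Par)

lemma weak_Par: "weak_step P P' \<Longrightarrow> process P \<Longrightarrow> process G \<Longrightarrow> weak_step (Par S P G) (Par S P' G)"
proof (induction rule: weak_step_induct)
  case (step P' P'')
  then have "step (Par S P' G) Tau (Par S P'' G)"
    using weak_step_process step_Par_left[of P' Tau P'' S G] by auto
  with step show ?case by (simp add: weak_step_step)
qed simp

text \<open>The environment \<open>avail X S G\<close> of \<open>P\<close> changes with
  \<open>G\<close>, so a triple can be kept only while \<open>G\<close> stays put. Idleness of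
  \<open>G\<close> on \<open>X - S\<close> ensures this: among the moves that a triple must match,
  \<open>G\<close> takes part only by synchronizing, after which the derivatives of the other
  component form a pair, or by a time-out, and then \<open>P\<close> is idle and its triple becomes
  a pair.\<close>

lemma gbisim_Par:
  "gbisim rea (\<lambda>A B. \<exists>P Q G. A = Par S P G \<and> B = Par S Q G \<and> process G \<and> sim rea P Q)
     (\<lambda>A X B. \<exists>P Q G. A = Par S P G \<and> B = Par S Q G \<and> process G \<and>
        (sim rea P Q \<or> rea \<and> idle (X - S) G \<and> sim3 rea P (avail X S G) Q))"
  (is "gbisim _ ?D ?D3")
proof -
  have act: "\<exists>B1 B2. weak_step B B1 \<and> opt_step B1 \<alpha> B2 \<and> ?D A B1 \<and> ?D A' B2"
    if D: "?D A B" and A': "step A \<alpha> A'" "\<alpha> \<noteq> Timeout" for A B A' \<alpha>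
  proof -
    obtain P Q G where AB: "A = Par S P G" "B = Par S Q G" "process G" and PQ: "sim rea P Q"
      using D by blast
    note proc = sim_process[OF PQ]
    consider (left) P' where "step P \<alpha> P'" "\<alpha> \<notin> Vis ` S" "A' = Par S P' G"
      | (right) G' where "step G \<alpha> G'" "\<alpha> \<notin> Vis ` S" "A' = Par S P G'"
      | (sync) a P' G' where "\<alpha> = Vis a" "a \<in> S" "step P \<alpha> P'" "step G \<alpha> G'" "A' = Par S P' G'"
      using A' proc AB by (auto simp: step_Par)
    then show ?thesis
    proof cases
      case left
      obtain Q1 Q2 where Q: "weak_step Q Q1" "opt_step Q1 \<alpha> Q2" "sim rea P Q1" "sim rea P' Q2"
        using sim.act[OF PQ left(1) A'(2)] by blast
      then have "weak_step B (Par S Q1 G)" "opt_step (Par S Q1 G) \<alpha> (Par S Q2 G)"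
        using AB proc weak_Par opt_Par left weak_step_process by blast+
      with Q AB left show ?thesis by blast
    next
      case right
      then have "opt_step B \<alpha> (Par S Q G')" "process G'"
        using AB proc step_process by (auto simp: opt_step_def step_Par)
      with PQ AB right show ?thesis by blast
    next
      case sync
      obtain Q1 Q2 where Q: "weak_step Q Q1" "step Q1 \<alpha> Q2" "sim rea P Q1" "sim rea P' Q2"
        using sim.act[OF PQ sync(3) A'(2)] sync by auto
      then have "weak_step B (Par S Q1 G)" "opt_step (Par S Q1 G) \<alpha> (Par S Q2 G')" "process G'"
        using AB proc weak_Par[of Q Q1 G S] sync step_process sim_process[OF Q(3)]
          step_Par_sync[of Q1 a Q2 G G' S]
        by (auto simp: opt_step_def)
      with Q AB sync show ?thesis by blast
    qed
  qed
  show ?thesis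
  proof (rule gbisimI)
    fix A B assume D: "?D A B"
    then show "process A \<and> process B \<and> ?D B A"
      by (elim exE conjE, simp, intro conjI; use sim_process sim_sym in blast)
    show "prog2 ?D ?D3 A B"
      unfolding prog2_def using act[OF D] D by blast
  next
    fix A X B assume "?D3 A X B"
    then obtain P Q G where AB: "A = Par S P G" "B = Par S Q G" "process G"
      and PQ': "sim rea P Q \<or> rea \<and> idle (X - S) G \<and> sim3 rea P (avail X S G) Q" by blast
    then have PQ: "sim3 rea P (avail X S G) Q" using sim.triple by blast
    note proc = sim3_process[OF PQ]
    show "process A \<and> process B \<and> ?D3 B X A"
      using PQ' proc AB(3) sim_sym sim3_sym unfolding AB(1,2) process_simps by blast
    have idle: "idle (X - S) G" if "\<not> sim rea P Q"
      using PQ' that by blast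
    have D: "?D A B" if "sim rea P Q"
      using AB that by blast
    have D_D3: "?D3 A X B" if "?D A B" for A B
      using that by blast
    show "prog3 rea ?D ?D3 A X B"
      unfolding prog3_def
    proof (intro conjI allI impI)
      fix A' assume A': "step A Tau A'"
      show "\<exists>Q1 Q2. weak_step B Q1 \<and> opt_step Q1 Tau Q2 \<and> ?D3 A X Q1 \<and> ?D3 A' X Q2"
      proof (cases "sim rea P Q")
        case True
        then show ?thesis using act[OF D A'] D_D3 by blast
      next
        case False
        then have G: "rea" "idle (X - S) G" using PQ' by blast+
        then have "\<not> step G Tau G'" for G' by (auto simp: idle_alt stable_def)
        then obtain P' where P': "step P Tau P'" "A' = Par S P' G"
          using A' proc AB by (auto simp: step_Par)
        obtain Q1 Q2 where Q: "weak_step Q Q1" "opt_step Q1 Tau Q2"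
            "sim3 rea P (avail X S G) Q1" "sim3 rea P' (avail X S G) Q2"
          using sim.tau3[OF PQ P'(1)] by blast
        then have "weak_step B (Par S Q1 G)" "opt_step (Par S Q1 G) Tau (Par S Q2 G)"
          using AB proc weak_Par[of Q Q1 G S] opt_Par[of Q1 Tau Q2 S G] sim3_process[OF Q(3)] by auto
        moreover have "?D3 A X (Par S Q1 G)" "?D3 A' X (Par S Q2 G)"
          using G Q AB P' by blast+
        ultimately show ?thesis by blast
      qed
    next
      fix a A' assume A': "step A (Vis a) A' \<and> a \<in> X"
      show "\<exists>Q1 Q2. weak_step B Q1 \<and> step Q1 (Vis a) Q2 \<and> ?D3 A X Q1 \<and> ?D A' Q2"
      proof (cases "sim rea P Q")
        case True
        then show ?thesis using act[OF D, of "Vis a" A'] A' D_D3 by simp blast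
      next
        case False
        then have G: "rea" "idle (X - S) G" using PQ' by blast+
        then have "\<not> step G (Vis a) G'" if "a \<notin> S" for G'
          using that A' by (auto simp: idle_alt)
        then have "\<exists>P' G'. step P (Vis a) P' \<and> A' = Par S P' G' \<and> process G' \<and>
            (a \<notin> S \<and> G' = G \<or> a \<in> S \<and> step G (Vis a) G')"
          using A' proc AB step_process[of G "Vis a"] by (auto simp: step_Par)
        then obtain P' G' where P': "step P (Vis a) P'" "A' = Par S P' G'" "process G'"
          and G': "a \<notin> S \<and> G' = G \<or> a \<in> S \<and> step G (Vis a) G'" by blast
        have "a \<in> avail X S G"
          using A' G' by (auto simp: avail_def initials_def)
        then obtain Q1 Q2 where Q: "weak_step Q Q1" "step Q1 (Vis a) Q2"
            "sim3 rea P (avail X S G) Q1" "sim rea P' Q2"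
          using sim.vis3[OF PQ P'(1)] by blast
        then have "weak_step B (Par S Q1 G)" "step (Par S Q1 G) (Vis a) (Par S Q2 G')"
          using AB proc weak_Par[of Q Q1 G S] G' sim3_process[OF Q(3)] by (auto simp: step_Par)
        moreover have "?D3 A X (Par S Q1 G)" "?D A' (Par S Q2 G')"
          using G Q AB P' by blast+
        ultimately show ?thesis by blast
      qed
    next
      assume "idle X A"
      then have "idle (avail X S G) P"
        using AB proc idle_Par by blast
      then obtain Q0 where Q0: "weak_step Q Q0" "sim rea P Q0"
        using sim.idle3[OF PQ] by blast
      then have "weak_step B (Par S Q0 G)"
        using AB proc weak_Par by blast
      with Q0 AB show "\<exists>Q0. weak_step B Q0 \<and> ?D A Q0" by blast
    next
      fix A' assume A': "okt rea X A \<and> step A Timeout A'"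
      then have okt: "okt rea (avail X S G) P" "okt rea (X - S) G"
        using AB proc idle_Par by (auto simp: okt_def)
      consider (left) P' where "step P Timeout P'" "A' = Par S P' G"
        | (right) G' where "step G Timeout G'" "A' = Par S P G'"
        using A' proc AB by (auto simp: step_Par)
      then show "\<exists>Q1 Q2. weak_step B Q1 \<and> step Q1 Timeout Q2 \<and> ?D3 A' X Q2 \<and> (\<not> rea \<longrightarrow> ?D A Q1)"
      proof cases
        case left
        obtain Q1 Q2 where Q: "weak_step Q Q1" "step Q1 Timeout Q2" "sim rea P Q1"
            "sim3 rea P' (avail X S G) Q2"
          using sim.timeout3[OF PQ left(1) okt(1)] by blast
        then have "weak_step B (Par S Q1 G)" "step (Par S Q1 G) Timeout (Par S Q2 G)"
          using AB proc weak_Par[of Q Q1 G S] sim_process[OF Q(3)] by (auto simp: step_Par)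
        moreover have "?D A (Par S Q1 G)" using AB Q by blast
        moreover have "?D3 A' X (Par S Q2 G)"
          using AB Q left okt(2) sim.pair by (cases rea) (auto simp: okt_def)
        ultimately show ?thesis by blast
      next
        case right
        \<comment> \<open>After its time-out, \<open>G\<close> may offer other actions and cease to
          be idle, so only a pair survives. In the reactive case the idleness of \<open>P\<close>
          provides it; otherwise the triple is already a pair.\<close>
        have "\<exists>Q0. weak_step Q Q0 \<and> sim rea P Q0"
          using okt(1) sim.idle3[OF PQ] sim.pair[OF PQ] by (cases rea) (auto simp: okt_def)
        then obtain Q0 where Q0: "weak_step Q Q0" "sim rea P Q0" by blast
        then have "weak_step B (Par S Q0 G)" "step (Par S Q0 G) Timeout (Par S Q0 G')" "process G'"
          using AB proc weak_Par[of Q Q0 G S] sim_process[OF Q0(2)] right step_process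
          by (auto simp: step_Par)
        moreover have "?D A (Par S Q0 G)" "?D A' (Par S Q0 G')"
          using AB Q0 right \<open>process G'\<close> by blast+
        ultimately show ?thesis using D_D3 by blast
      qed
    next
      assume "stable A"
      then have PG: "stable P" "stable G" using AB proc stable_Par by blast+
      then obtain Q0 where Q0: "weak_step Q Q0" "stable Q0"
        using sim.stable3[OF PQ] by blast
      then have "weak_step B (Par S Q0 G)" "stable (Par S Q0 G)"
        using AB proc weak_Par stable_Par weak_step_process PG by blast+
      then show "\<exists>Q0. weak_step B Q0 \<and> stable Q0" by blast
    next
      assume "\<not> rea"
      then show "?D A B" using D PQ' by blast
    qed
  qed
qed

lemma sim_Par_left: "sim rea P Q \<Longrightarrow> process G \<Longrightarrow> sim rea (Par S P G) (Par S Q G)"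
  by (rule simI[OF gbisim_Par]) blast

lemma sim3_Par_left:
  assumes "sim3 rea P (avail X S G) Q" "okt rea (X - S) G" "process G"
  shows "sim3 rea (Par S P G) X (Par S Q G)"
proof (rule sim3I[OF gbisim_Par])
  show "\<exists>P' Q' G'. Par S P G = Par S P' G' \<and> Par S Q G = Par S Q' G' \<and> process G' \<and>
      (sim rea P' Q' \<or> rea \<and> idle (X - S) G' \<and> sim3 rea P' (avail X S G') Q')"
    using assms sim.pair[OF assms(1)] by (cases rea) (auto simp: okt_def)
qed

text \<open>Swapping the components is a strong bisimulation. It reduces changes of the right
  component to changes of the left one.\<close>

lemma sim_Par_commute:
  assumes "process P" "process Q"
  shows "sim rea (Par S P Q) (Par S Q P)"
proof (rule sim_upto)
  let ?C = "\<lambda>A B. \<exists>P Q. A = Par S P Q \<and> B = Par S Q P \<and> process P \<and> process Q"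
  show "sym_on_processes ?C" by (auto simp: sym_on_processes_def)
  show "?C (Par S P Q) (Par S Q P)" using assms by blast
  fix A B :: "('a, 'v) expr" and \<alpha> A' X assume "?C A B" "step A \<alpha> A'"
  then obtain B' where B': "step B \<alpha> B'" "?C A' B'"
    by (auto simp: step_Par intro: step_process; metis step_process)
  then have "sim_after rea \<alpha> X B' B'"
    by (auto simp: sim_after_def intro: sim_refl sim3_refl)
  with B' show "\<exists>R Q'. step B \<alpha> Q' \<and> ?C A' R \<and> sim_after rea \<alpha> X R Q'" by blast
qed

lemma sim_Par:
  assumes "sim rea P Q" "sim rea G H"
  shows "sim rea (Par S P G) (Par S Q H)"
proof -
  have proc: "process P" "process Q" "process G" "process H"
    using assms sim_process by blast+
  have "sim rea (Par S P G) (Par S Q G)" using sim_Par_left assms proc by blast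
  also have "sim rea (Par S Q G) (Par S G Q)" using sim_Par_commute proc by blast
  also have "sim rea (Par S G Q) (Par S H Q)" using sim_Par_left assms proc by blast
  also have "sim rea (Par S H Q) (Par S Q H)" using sim_Par_commute proc by blast
  finally show ?thesis .
qed

lemma sim3_Par_right:
  assumes "sim3 rea P (avail X S G) Q" "okt rea (X - S) G" "process G"
  shows "sim3 rea (Par S G P) X (Par S G Q)"
proof -
  have proc: "process P" "process Q" using assms(1) sim3_process by blast+
  have "sim3 rea (Par S G P) X (Par S P G)"
    using sim_Par_commute proc assms sim.triple by blast
  also have "sim3 rea (Par S P G) X (Par S Q G)" by (rule sim3_Par_left[OF assms])
  also have "sim3 rea (Par S Q G) X (Par S G Q)"
    using sim_Par_commute proc assms sim.triple by blast
  finally show ?thesis .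
qed

section \<open>The operator \<theta>\<close>

lemma opt_Theta: "opt_step P Tau P' \<Longrightarrow> process P \<Longrightarrow> L \<subseteq> U \<Longrightarrow>
    opt_step (Theta L U P) Tau (Theta L U P')"
  by (auto simp: opt_step_def step_Theta)

lemma weak_Theta: "weak_step P P' \<Longrightarrow> process P \<Longrightarrow> L \<subseteq> U \<Longrightarrow>
    weak_step (Theta L U P) (Theta L U P')"
proof (induction rule: weak_step_induct)
  case (step P' P'')
  then have "step (Theta L U P') Tau (Theta L U P'')"
    using weak_step_process step_Theta[of P' L U Tau "Theta L U P''"] by auto
  with step show ?case by (simp add: weak_step_step)
qed simp

lemma stable_Theta: "process P \<Longrightarrow> L \<subseteq> U \<Longrightarrow> stable (Theta L U P) \<longleftrightarrow> stable P"
  by (auto simp: stable_def step_Theta)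

lemma idle_Theta:
  "process P \<Longrightarrow> L \<subseteq> U \<Longrightarrow> idle L P \<Longrightarrow> idle X (Theta L U P) \<longleftrightarrow> idle X P"
  by (auto simp: idle_alt stable_Theta step_Theta)

text \<open>
  Both congruence properties of \<open>\<theta>\<close> need the same bisimulation, since a derivative of \<open>\<theta>\<^sub>U\<^sup>U(P)\<close>
  that stays below \<open>\<theta>\<close> is only known to be related in the environment \<open>U\<close>.
\<close>

definition theta_rel :: "bool \<Rightarrow> 'a set \<Rightarrow> 'a set \<Rightarrow> ('a, 'v) rel2" where
  "theta_rel rea L U P Q \<longleftrightarrow> L \<subseteq> U \<and> (sim rea P Q \<or> L = U \<and> sim3 rea P U Q)"

text \<open>\<open>\<theta>\<close> fixes the environment of its argument, so the triple part of the
  bisimulation can be constant in the outer one. A visible action outside \<open>U\<close> or a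
  time-out passes only if the argument is idle on \<open>L\<close>; for \<open>L = U\<close> this is
  precisely the condition under which a triple in \<open>U\<close> becomes a pair.\<close>

lemma theta_rel_sim:
  assumes "theta_rel rea L U P Q"
  shows "sim rea (Theta L U P) (Theta L U Q)"
proof -
  let ?K = "theta_rel rea"
  have tau: "\<exists>Q1 Q2. weak_step Q Q1 \<and> opt_step Q1 Tau Q2 \<and> ?K L U P Q1 \<and> ?K L U P' Q2"
    if K: "?K L U P Q" and P': "step P Tau P'" for L U and P Q P' :: "('a, 'v) expr"
  proof (cases "sim rea P Q")
    case True
    then show ?thesis using sim.act[OF True P'] K unfolding theta_rel_def by blast
  next
    case False
    then show ?thesis using sim.tau3[of rea P U Q P'] K P' unfolding theta_rel_def by blast
  qed
  have vis: "\<exists>Q1 Q2. weak_step Q Q1 \<and> step Q1 (Vis a) Q2 \<and> ?K L U P Q1 \<and> sim rea P' Q2"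
    if K: "?K L U P Q" and P': "step P (Vis a) P'" "a \<in> U" for L U a and P Q P' :: "('a, 'v) expr"
  proof (cases "sim rea P Q")
    case True
    then show ?thesis using sim.act[OF True P'(1)] K unfolding theta_rel_def by auto
  next
    case False
    then show ?thesis using sim.vis3[of rea P U Q a P'] K P' unfolding theta_rel_def by blast
  qed
  have idle: "\<exists>Q0. weak_step Q Q0 \<and> idle L Q0 \<and> sim rea P Q0 \<and> ?K L U P Q0"
    if K: "?K L U P Q" and P: "idle L P" for L U and P Q :: "('a, 'v) expr"
    using K P sim.idle3[of rea P L Q] sim.triple[of rea P Q L] unfolding theta_rel_def by blast
  have stable: "\<exists>Q0. weak_step Q Q0 \<and> stable Q0"
    if K: "?K L U P Q" and P: "stable P" for L U and P Q :: "('a, 'v) expr"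
    using K P sim.stable3[of rea P U Q] sim.triple[of rea P Q U] unfolding theta_rel_def by blast
  have sym: "process P \<and> process Q \<and> L \<subseteq> U \<and> ?K L U Q P" if K: "?K L U P Q"
    for L U and P Q :: "('a, 'v) expr"
    using K sim_process sim3_process sim_sym sim3_sym unfolding theta_rel_def by blast
  let ?D = "\<lambda>A B. \<exists>L U P Q. A = Theta L U P \<and> B = Theta L U Q \<and> ?K L U P Q"
  have act: "\<exists>B1 B2. weak_step B B1 \<and> opt_step B1 \<alpha> B2 \<and> ?D A B1 \<and> (?D A' B2 \<or> sim rea A' B2)"
    if D: "?D A B" and A': "step A \<alpha> A'" "\<alpha> \<noteq> Timeout" for A B A' :: "('a, 'v) expr" and \<alpha>
  proof -
    obtain L U P Q where AB: "A = Theta L U P" "B = Theta L U Q" and K: "?K L U P Q"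
      using D by blast
    have proc: "process P" "process Q" and LU: "L \<subseteq> U" using sym[OF K] by blast+
    consider (tau) P' where "\<alpha> = Tau" "step P Tau P'" "A' = Theta L U P'"
      | (vis) a where "\<alpha> = Vis a" "a \<in> U" "step P (Vis a) A'"
      | (idle) "idle L P" "step P \<alpha> A'"
      using A' AB proc LU by (auto simp: step_Theta)
    then show ?thesis
    proof cases
      case tau': tau
      obtain Q1 Q2 where Q: "weak_step Q Q1" "opt_step Q1 Tau Q2" "?K L U P Q1" "?K L U P' Q2"
        using tau[OF K tau'(2)] by blast
      have "weak_step B (Theta L U Q1)"
        unfolding AB by (rule weak_Theta[OF Q(1) proc(2) LU])
      moreover have "opt_step (Theta L U Q1) \<alpha> (Theta L U Q2)"
        unfolding tau'(1) by (rule opt_Theta[OF Q(2) weak_step_process[OF Q(1) proc(2)] LU])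
      moreover have "?D A (Theta L U Q1)" "?D A' (Theta L U Q2)"
        using Q AB tau'(3) by blast+
      ultimately show ?thesis by blast
    next
      case vis': vis
      obtain Q1 Q2 where Q: "weak_step Q Q1" "step Q1 (Vis a) Q2" "?K L U P Q1" "sim rea A' Q2"
        using vis[OF K vis'(3,2)] by blast
      then have "weak_step B (Theta L U Q1)"
        using AB proc LU weak_Theta by blast
      moreover have "process Q1" using Q(1) proc weak_step_process by blast
      then have "opt_step (Theta L U Q1) \<alpha> Q2"
        using Q(2) vis' LU by (simp add: step_Theta)
      ultimately show ?thesis using Q AB by blast
    next
      case idle': idle
      obtain Q0 where Q0: "weak_step Q Q0" "idle L Q0" "sim rea P Q0" "?K L U P Q0"
        using idle[OF K idle'(1)] by blast
      obtain Q1 Q2 where Q: "weak_step Q0 Q1" "opt_step Q1 \<alpha> Q2" "sim rea A' Q2"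
        using sim.act[OF Q0(3) idle'(2) A'(2)] by blast
      \<comment> \<open>\<open>Q0\<close> is stable and \<open>\<alpha>\<close> is not internal, so
        the answer is a single step of \<open>Q0\<close> itself, and its idleness on
        \<open>L\<close> lets that step pass through \<open>\<theta>\<close>.\<close>
      have "\<alpha> \<noteq> Tau" using idle' by (auto simp: idle_alt stable_def)
      then have "step Q0 \<alpha> Q2"
        using Q weak_step_stable[OF Q(1) idle_stable[OF Q0(2)]] by (simp add: opt_step_def)
      moreover have "process Q0" using Q0(1) proc weak_step_process by blast
      ultimately have "opt_step (Theta L U Q0) \<alpha> Q2"
        using Q0(2) LU by (simp add: step_Theta opt_step_def)
      moreover have "weak_step B (Theta L U Q0)"
        using AB proc LU weak_Theta Q0(1) by blast
      ultimately show ?thesis using Q(3) Q0(4) AB by blast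
    qed
  qed
  show ?thesis
  proof (rule sim_coinduct(1)[of ?D "\<lambda>A X B. ?D A B"])
    show "?D (Theta L U P) (Theta L U Q)" using assms by blast
  next
    fix A B :: "('a, 'v) expr" assume D: "?D A B"
    then obtain L U P Q where AB: "A = Theta L U P" "B = Theta L U Q" and K: "?K L U P Q" by blast
    then show "process A \<and> process B \<and> ?D B A" using sym[OF K] by auto
    show "process A \<and> process B \<and> ?D B A" by fact
    have proc: "process P" "process Q" and LU: "L \<subseteq> U" using sym[OF K] by blast+
    show "prog2 (\<lambda>A B. ?D A B \<or> sim rea A B) (\<lambda>A X B. ?D A B \<or> sim3 rea A X B) A B"
      unfolding prog2_def
    proof (intro conjI allI impI)
      fix \<alpha> A' assume A': "step A \<alpha> A' \<and> \<alpha> \<noteq> Timeout"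
      obtain B1 B2 where "weak_step B B1" "opt_step B1 \<alpha> B2" "?D A B1" "?D A' B2 \<or> sim rea A' B2"
        using act[OF D, of \<alpha> A'] A' by (elim conjE exE) metis
      then show "\<exists>B1 B2. weak_step B B1 \<and> opt_step B1 \<alpha> B2 \<and> (?D A B1 \<or> sim rea A B1) \<and>
          (?D A' B2 \<or> sim rea A' B2)" by metis
    qed (use D in simp)
    fix X
    show "prog3 rea (\<lambda>A B. ?D A B \<or> sim rea A B) (\<lambda>A X B. ?D A B \<or> sim3 rea A X B) A X B"
      unfolding prog3_def
    proof (intro conjI allI impI)
      fix A' assume "step A Tau A'"
      then show "\<exists>Q1 Q2. weak_step B Q1 \<and> opt_step Q1 Tau Q2 \<and> (?D A Q1 \<or> sim3 rea A X Q1) \<and>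
          (?D A' Q2 \<or> sim3 rea A' X Q2)"
        using act[OF D, of Tau A'] sim.triple by blast
    next
      fix a A' assume "step A (Vis a) A' \<and> a \<in> X"
      then show "\<exists>Q1 Q2. weak_step B Q1 \<and> step Q1 (Vis a) Q2 \<and> (?D A Q1 \<or> sim3 rea A X Q1) \<and>
          (?D A' Q2 \<or> sim rea A' Q2)"
        using act[OF D, of "Vis a" A'] by simp blast
    next
      show "\<exists>Q0. weak_step B Q0 \<and> (?D A Q0 \<or> sim rea A Q0)" using D by blast
    next
      fix A' assume A': "okt rea X A \<and> step A Timeout A'"
      then have t: "step P Timeout A'" "idle L P"
        using AB proc LU by (auto simp: step_Theta)
      \<comment> \<open>While \<open>P\<close> is idle on \<open>L\<close>, \<open>\<theta>\<close>
        is transparent, so idleness in the outer environment \<open>X\<close> is idleness of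
        \<open>P\<close> there.\<close>
      have okt: "okt rea X P"
        using A' AB idle_Theta[OF proc(1) LU t(2)] by (simp add: okt_def)
      obtain Q0 where Q0: "weak_step Q Q0" "idle L Q0" "sim rea P Q0" "?K L U P Q0"
        using idle[OF K t(2)] by blast
      obtain Q1 Q2 where Q: "weak_step Q0 Q1" "step Q1 Timeout Q2" "sim3 rea A' X Q2"
        using sim.timeout[OF Q0(3) t(1) okt] by blast
      have "step Q0 Timeout Q2"
        using Q weak_step_stable[OF Q(1) idle_stable[OF Q0(2)]] by simp
      moreover have "process Q0" using Q0(1) proc weak_step_process by blast
      ultimately have "step (Theta L U Q0) Timeout Q2"
        using Q0(2) LU by (simp add: step_Theta)
      moreover have "weak_step B (Theta L U Q0)"
        using AB proc LU weak_Theta Q0(1) by blast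
      moreover have "?D A (Theta L U Q0)" using Q0(4) AB by blast
      ultimately show "\<exists>Q1 Q2. weak_step B Q1 \<and> step Q1 Timeout Q2 \<and>
          (?D A' Q2 \<or> sim3 rea A' X Q2) \<and> (\<not> rea \<longrightarrow> ?D A Q1 \<or> sim rea A Q1)"
        using Q(3) by metis
    next
      assume "stable A"
      then have "stable P" using AB stable_Theta[OF proc(1) LU] by simp
      then obtain Q0 where Q0: "weak_step Q Q0" "stable Q0"
        using stable[OF K] by blast
      then have "weak_step B (Theta L U Q0)" "stable (Theta L U Q0)"
        using AB weak_Theta[OF Q0(1) proc(2) LU] Q0(2)
          stable_Theta[OF weak_step_process[OF Q0(1) proc(2)] LU] by simp_all
      then show "\<exists>Q0. weak_step B Q0 \<and> stable Q0" by blast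
    next
      show "?D A B \<or> sim rea A B" using D by blast
    qed
  qed
qed

lemma sim_Theta: "sim rea P Q \<Longrightarrow> L \<subseteq> U \<Longrightarrow> sim rea (Theta L U P) (Theta L U Q)"
  by (rule theta_rel_sim) (simp add: theta_rel_def)

text \<open>After a time-out \<open>\<psi>\<close> leaves exactly such a \<open>\<theta>\<close>
  around the derivative; it removes the environment to which the time-out has tied the
  relation.\<close>

lemma sim3_Theta: "sim3 rea P X Q \<Longrightarrow> sim rea (Theta X X P) (Theta X X Q)"
  by (rule theta_rel_sim) (simp add: theta_rel_def)

section \<open>Rooted bisimilarity\<close>

text \<open>A binary relation suffices: at the root, the triple clauses for internal and visible
  actions follow from those for pairs, so only the time-out clause remains, for all environments at
  once.\<close>

definition rmatch :: "bool \<Rightarrow> ('a, 'v) rel2" where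
  "rmatch rea P Q \<longleftrightarrow> (\<forall>\<alpha> P' X. step P \<alpha> P' \<longrightarrow> (\<alpha> = Timeout \<longrightarrow> okt rea X P) \<longrightarrow>
     (\<exists>Q'. step Q \<alpha> Q' \<and> sim_after rea \<alpha> X P' Q'))"

definition rooted :: "bool \<Rightarrow> ('a, 'v) rel2" where
  "rooted rea P Q \<longleftrightarrow> process P \<and> process Q \<and> rmatch rea P Q \<and> rmatch rea Q P"

lemma sim_after_refl: "process P \<Longrightarrow> sim_after rea \<alpha> X P P"
  by (simp add: sim_after_def sim_refl sim3_refl)

lemma sim_after_trans: "sim_after rea \<alpha> X P Q \<Longrightarrow> sim_after rea \<alpha> X Q R \<Longrightarrow> sim_after rea \<alpha> X P R"
  unfolding sim_after_def using sim_trans sim3_trans by (cases "\<alpha> = Timeout") auto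

lemma sim_sim_after: "sim rea P Q \<Longrightarrow> sim_after rea \<alpha> X P Q"
  by (simp add: sim_after_def sim.triple)

lemma rmatchD: "rmatch rea P Q \<Longrightarrow> step P \<alpha> P' \<Longrightarrow> (\<alpha> = Timeout \<Longrightarrow> okt rea X P) \<Longrightarrow>
    \<exists>Q'. step Q \<alpha> Q' \<and> sim_after rea \<alpha> X P' Q'"
  unfolding rmatch_def by blast

lemma rmatch_initials: "rmatch rea P Q \<Longrightarrow> initials step P \<subseteq> initials step Q"
  unfolding initials_def using rmatchD by blast

lemma okt_initials: "initials step P = initials step Q \<Longrightarrow> okt rea X P \<longleftrightarrow> okt rea X Q"
  by (simp add: okt_def idle_def)

lemma rooted_initials: "rooted rea P Q \<Longrightarrow> initials step P = initials step Q"
  unfolding rooted_def using rmatch_initials by blast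

lemma rooted_refl: "process P \<Longrightarrow> rooted rea P P"
  unfolding rooted_def rmatch_def using sim_after_refl step_process by blast

lemma rooted_sym: "rooted rea P Q \<Longrightarrow> rooted rea Q P"
  unfolding rooted_def by blast

text \<open>The middle process must satisfy \<open>okt\<close> before its own time-out clause
  applies; equal initial actions carry idleness over to it.\<close>

lemma rmatch_trans:
  assumes "rmatch rea P Q" "rmatch rea Q R" "initials step P = initials step Q"
  shows "rmatch rea P R"
  unfolding rmatch_def
proof (intro allI impI)
  fix \<alpha> P' X assume "step P \<alpha> P'" and okt: "\<alpha> = Timeout \<longrightarrow> okt rea X P"
  then obtain Q' where Q': "step Q \<alpha> Q'" "sim_after rea \<alpha> X P' Q'"
    using rmatchD[OF assms(1)] by blast
  then obtain R' where "step R \<alpha> R'" "sim_after rea \<alpha> X Q' R'"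
    using rmatchD[OF assms(2) Q'(1)] okt okt_initials[OF assms(3)] by blast
  with Q' show "\<exists>R'. step R \<alpha> R' \<and> sim_after rea \<alpha> X P' R'"
    using sim_after_trans by blast
qed

lemma rooted_trans:
  assumes "rooted rea P Q" "rooted rea Q R"
  shows "rooted rea P R"
  using assms rooted_initials[OF assms(1)] rooted_initials[OF assms(2)]
    rmatch_trans[of rea P Q R] rmatch_trans[of rea R Q P]
  unfolding rooted_def by simp

text \<open>Since the equivalence is read off at pairs, the triple part may be taken constant in its
  set; the clause that leads from triples back to pairs is then trivial.\<close>

lemma rbr_bisimilar_rooted: "rbr_bisimilar = (rooted True :: ('a, 'v) rel2)"
proof (intro ext iffI)
  fix P Q :: "('a, 'v) expr" assume "rbr_bisimilar P Q"
  then obtain R R3 where b: "rooted_branching_reactive_bisim R R3" and PQ: "R P Q"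
    unfolding rbr_bisimilar_def by (elim exE conjE)
  note b' = b[unfolded rooted_branching_reactive_bisim_def br_bisimilar_sim]
  note clauses2 = conjunct1[OF conjunct2[OF conjunct2[OF b']], rule_format]
    and clauses3 = conjunct2[OF conjunct2[OF conjunct2[OF b']], rule_format]
  have sym: "process P \<and> process Q \<and> R Q P" if "R P Q" for P Q
    using conjunct1[OF b'] that by (simp add: sym_on_processes_def)
  have "rmatch True P Q" if "R P Q" for P Q
    unfolding rmatch_def
  proof (intro allI impI)
    fix \<alpha> P' X assume P': "step P \<alpha> P'" and okt: "\<alpha> = Timeout \<longrightarrow> okt True X P"
    have R3: "R3 P X Q" using clauses2[OF that] by blast
    show "\<exists>Q'. step Q \<alpha> Q' \<and> sim_after True \<alpha> X P' Q'"
    proof (cases "\<alpha> = Timeout")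
      case True
      with okt P' have "idle X P \<and> step P Timeout P'" by (simp add: okt_def)
      then show ?thesis
        using clauses3[OF R3] True by (simp add: sim_after_def)
    next
      case False
      then show ?thesis
        using conjunct1[OF clauses2[OF that]] P' by (simp add: sim_after_def)
    qed
  qed
  then show "rooted True P Q" unfolding rooted_def using sym PQ by blast
next
  fix P Q :: "('a, 'v) expr" assume PQ: "rooted True P Q"
  let ?R = "rooted True :: ('a, 'v) rel2"
  have m: "\<exists>Q'. step Q \<alpha> Q' \<and> sim_after True \<alpha> X P' Q'"
    if "rooted True P Q" "step P \<alpha> P'" "\<alpha> = Timeout \<Longrightarrow> idle X P" for P Q P' :: "('a, 'v) expr" and \<alpha> X
    using rmatchD[of True P Q \<alpha> P' X] that unfolding rooted_def okt_def by blast
  have "rooted_branching_reactive_bisim ?R (\<lambda>P X Q. ?R P Q)"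
    unfolding rooted_branching_reactive_bisim_def br_bisimilar_sim
  proof (intro conjI allI impI)
    show "sym_on_processes ?R" "sym3_on_processes (\<lambda>P X Q. ?R P Q)"
      unfolding sym_on_processes_def sym3_on_processes_def rooted_def by blast+
  next
    fix P Q P' :: "('a, 'v) expr" and \<alpha>
    assume "?R P Q" "step P \<alpha> P' \<and> \<alpha> \<noteq> Timeout"
    then show "\<exists>Q'. step Q \<alpha> Q' \<and> sim True P' Q'" using m[of P Q \<alpha> P'] by (auto simp: sim_after_def)
  next
    fix P Q P' :: "('a, 'v) expr" and X
    assume "?R P Q" "step P Tau P'"
    then show "\<exists>Q'. step Q Tau Q' \<and> sim3 True P' X Q'"
      using m[of P Q Tau P'] sim.triple by (fastforce simp: sim_after_def)
  next
    fix P Q P' :: "('a, 'v) expr" and X a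
    assume "?R P Q" "step P (Vis a) P' \<and> a \<in> X"
    then show "\<exists>Q'. step Q (Vis a) Q' \<and> sim True P' Q'"
      using m[of P Q "Vis a" P'] by (auto simp: sim_after_def)
  next
    fix P Q P' :: "('a, 'v) expr" and X
    assume "?R P Q" "idle X P \<and> step P Timeout P'"
    then show "\<exists>Q'. step Q Timeout Q' \<and> sim3 True P' X Q'"
      using m[of P Q Timeout P' X] by (auto simp: sim_after_def)
  qed
  then show "rbr_bisimilar P Q" unfolding rbr_bisimilar_def using PQ by (intro exI conjI)
qed

lemma sim_after_False: "sim_after False \<alpha> X P Q \<longleftrightarrow> sim False P Q"
  by (simp add: sim_after_def sim3_False)

lemma rb_bisimilar_rooted: "rb_bisimilar = (rooted False :: ('a, 'v) rel2)"
proof (intro ext iffI)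
  fix P Q :: "('a, 'v) expr" assume "rb_bisimilar P Q"
  then obtain R where b: "rooted_branching_bisim R" and PQ: "R P Q"
    unfolding rb_bisimilar_def by (elim exE conjE)
  have "rmatch False P Q" if "R P Q" for P Q
    using b that unfolding rooted_branching_bisim_def rmatch_def sim_after_False b_bisimilar_sim
    by blast
  moreover have "process P \<and> process Q \<and> R Q P"
    using b PQ by (simp add: rooted_branching_bisim_def sym_on_processes_def)
  ultimately show "rooted False P Q" unfolding rooted_def using PQ by blast
next
  fix P Q :: "('a, 'v) expr" assume PQ: "rooted False P Q"
  have "rooted_branching_bisim (rooted False :: ('a, 'v) rel2)"
    unfolding rooted_branching_bisim_def rooted_def
    by (auto simp: rmatch_def sim_after_False b_bisimilar_sim okt_def sym_on_processes_def)
  then show "rb_bisimilar P Q" unfolding rb_bisimilar_def using PQ by (intro exI conjI)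
qed

section \<open>Rooted congruence for \<theta> and \<psi>\<close>

lemma rmatch_Theta:
  assumes PQ: "rooted rea P Q" and LU: "L \<subseteq> U"
  shows "rmatch rea (Theta L U P) (Theta L U Q)"
  unfolding rmatch_def
proof (intro allI impI)
  fix \<alpha> R X assume R: "step (Theta L U P) \<alpha> R" and okt: "\<alpha> = Timeout \<longrightarrow> okt rea X (Theta L U P)"
  have proc: "process P" "process Q" and m: "rmatch rea P Q" using PQ by (auto simp: rooted_def)
  note iff = step_Theta[OF proc(2) LU]
  consider (tau) P' where "\<alpha> = Tau" "step P Tau P'" "R = Theta L U P'"
    | (vis) a where "\<alpha> = Vis a" "a \<in> U" "step P (Vis a) R"
    | (idle) "idle L P" "step P \<alpha> R"
    using R proc LU by (auto simp: step_Theta)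
  then show "\<exists>Q'. step (Theta L U Q) \<alpha> Q' \<and> sim_after rea \<alpha> X R Q'"
  proof cases
    case tau
    then obtain Q' where "step Q Tau Q'" "sim rea P' Q'"
      using rmatchD[OF m tau(2)] by (auto simp: sim_after_def)
    then have "step (Theta L U Q) \<alpha> (Theta L U Q')" "sim_after rea \<alpha> X R (Theta L U Q')"
      unfolding tau iff using sim_Theta[OF _ LU] sim_sim_after by blast+
    then show ?thesis by blast
  next
    case vis
    then show ?thesis using rmatchD[OF m vis(3)] iff by auto
  next
    case idle
    \<comment> \<open>The negative premise transfers because rooted processes have equal initial
      actions.\<close>
    have "idle L Q" using idle(1) rooted_initials[OF PQ] by (simp add: idle_def)
    moreover have "\<alpha> = Timeout \<Longrightarrow> okt rea X P"
      using okt idle_Theta[OF proc(1) LU idle(1)] by (auto simp: okt_def)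
    ultimately show ?thesis using rmatchD[OF m idle(2)] iff by blast
  qed
qed

lemma rooted_Theta: "rooted rea P Q \<Longrightarrow> L \<subseteq> U \<Longrightarrow> rooted rea (Theta L U P) (Theta L U Q)"
  using rmatch_Theta[of rea P Q L U] rmatch_Theta[of rea Q P L U] rooted_sym[of rea P Q]
  by (simp add: rooted_def)

lemma rmatch_Psi:
  assumes PQ: "rooted rea P Q"
  shows "rmatch rea (Psi Y P) (Psi Y Q)"
  unfolding rmatch_def
proof (intro allI impI)
  fix \<alpha> R X assume R: "step (Psi Y P) \<alpha> R"
  have proc: "process P" "process Q" and m: "rmatch rea P Q" using PQ by (auto simp: rooted_def)
  note iff = step_Psi[OF proc(2)]
  consider (act) "\<alpha> \<noteq> Timeout" "step P \<alpha> R"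
    | (t) P' where "\<alpha> = Timeout" "step P Timeout P'" "idle Y P" "R = Theta Y Y P'"
    using R proc by (auto simp: step_Psi)
  then show "\<exists>Q'. step (Psi Y Q) \<alpha> Q' \<and> sim_after rea \<alpha> X R Q'"
  proof cases
    case act
    then show ?thesis using rmatchD[OF m act(2)] iff by blast
  next
    case t
    have "idle Y Q" using t(3) rooted_initials[OF PQ] by (simp add: idle_def)
    \<comment> \<open>The time-out clause is used in the environment \<open>Y\<close> that
      \<open>\<psi>\<close> tests, whatever \<open>X\<close> is; the \<open>\<theta>\<close> around
      the derivatives then makes the result independent of the environment.\<close>
    obtain Q' where Q': "step Q Timeout Q'" "sim3 rea P' Y Q'"
      using rmatchD[OF m t(2), of Y] t(3) by (auto simp: okt_def sim_after_def)
    then have "step (Psi Y Q) \<alpha> (Theta Y Y Q')" using iff t \<open>idle Y Q\<close> by blast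
    moreover have "sim_after rea \<alpha> X R (Theta Y Y Q')"
      unfolding t(4) by (rule sim_sim_after[OF sim3_Theta[OF Q'(2)]])
    ultimately show ?thesis by blast
  qed
qed

lemma rooted_Psi: "rooted rea P Q \<Longrightarrow> rooted rea (Psi Y P) (Psi Y Q)"
  using rmatch_Psi[of rea P Q Y] rmatch_Psi[of rea Q P Y] rooted_sym[of rea P Q]
  by (simp add: rooted_def)

lemma (in relabel) sim_after_cong:
  "ren \<beta> \<alpha> \<Longrightarrow> sim_after rea \<beta> (pre X) P Q \<Longrightarrow> sim_after rea \<alpha> X (f P) (f Q)"
  using sim_cong sim3_cong Timeout by (auto simp: sim_after_def split: if_splits)

lemma (in relabel) okt_pre: "process P \<Longrightarrow> okt rea X (f P) \<Longrightarrow> okt rea (pre X) P"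
  by (simp add: okt_def idle_iff)

section \<open>Contexts and recursion\<close>

text \<open>
  In the last clause a nested specification is closed by \<open>\<sigma>\<close> and \<open>\<tau>\<close> before it is unfolded,
  because \<^const>\<open>subst\<close> captures variables when open expressions are substituted.
\<close>

inductive ctx :: "bool \<Rightarrow> ('a, 'v) rspec \<Rightarrow> ('a, 'v) rspec \<Rightarrow> ('a, 'v) rel2"
  for rea :: bool and \<S> \<S>' :: "('a, 'v) rspec" where
  rooted: "rooted rea P Q \<Longrightarrow> ctx rea \<S> \<S>' P Q"
| Prefix: "ctx rea \<S> \<S>' P Q \<Longrightarrow> ctx rea \<S> \<S>' (Prefix \<alpha> P) (Prefix \<alpha> Q)"
| Plus: "ctx rea \<S> \<S>' P Q \<Longrightarrow> ctx rea \<S> \<S>' G H \<Longrightarrow> ctx rea \<S> \<S>' (Plus P G) (Plus Q H)"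
| Par: "ctx rea \<S> \<S>' P Q \<Longrightarrow> ctx rea \<S> \<S>' G H \<Longrightarrow> ctx rea \<S> \<S>' (Par S P G) (Par S Q H)"
| Hide: "ctx rea \<S> \<S>' P Q \<Longrightarrow> ctx rea \<S> \<S>' (Hide I P) (Hide I Q)"
| Rename: "ctx rea \<S> \<S>' P Q \<Longrightarrow> (\<And>a. finite {b. (a, b) \<in> \<R>}) \<Longrightarrow>
    ctx rea \<S> \<S>' (Rename \<R> P) (Rename \<R> Q)"
| Rec: "y \<in> dom \<S> \<Longrightarrow> ctx rea \<S> \<S>' (Rec y \<S>) (Rec y \<S>')"
| subst: "process (subst (Rec z \<T>) \<sigma>) \<Longrightarrow> process (subst (Rec z \<T>) \<tau>) \<Longrightarrow>
    Rec z \<T> \<in> valid_exprs \<Longrightarrow>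
    (\<And>F x. guard F (Rec z \<T>) \<Longrightarrow> \<not> occurs_free x F) \<Longrightarrow>
    (\<And>x. \<sigma> x = None \<and> \<tau> x = None \<or>
      (\<exists>P Q. \<sigma> x = Some P \<and> \<tau> x = Some Q \<and> ctx rea \<S> \<S>' P Q)) \<Longrightarrow>
    ctx rea \<S> \<S>' (subst (Rec z \<T>) \<sigma>) (subst (Rec z \<T>) \<tau>)"

text \<open>\<open>body\<close> states the equivalence of the bodies for partial closed maps, so
  that it applies to \<open>rec_map\<close> without completing that map to a total
  substitution.\<close>

locale rec_pair =
  fixes rea :: bool and \<S> \<S>' :: "('a, 'v) rspec"
  assumes dom: "dom \<S> = dom \<S>'"
    and process: "y \<in> dom \<S> \<Longrightarrow> process (Rec y \<S>) \<and> process (Rec y \<S>')"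
    and body: "\<S> y = Some E \<Longrightarrow> \<S>' y = Some E' \<Longrightarrow> closed_map \<sigma> \<Longrightarrow> dom \<S> \<subseteq> dom \<sigma> \<Longrightarrow>
      rooted rea (subst E \<sigma>) (subst E' \<sigma>)"
begin

lemma ctx_process: "ctx rea \<S> \<S>' P Q \<Longrightarrow> process P \<and> process Q"
  by (induction rule: ctx.induct) (auto simp: rooted_def process)

text \<open>Arguments of \<open>\<theta>\<close> and \<open>\<psi>\<close> are closed, so both
  substitutions leave these terms alone and reflexivity of \<open>rooted\<close> covers them. A
  nested specification is handled at once by the \<open>subst\<close> clause of
  \<open>ctx\<close>.\<close>

lemma ctx_subst:
  assumes "E \<in> valid_exprs" "\<And>F x. guard F E \<Longrightarrow> \<not> occurs_free x F"
    "\<And>x. occurs_free x E \<Longrightarrow> \<sigma> x \<noteq> None"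
    "\<And>x. \<sigma> x = None \<and> \<tau> x = None \<or> (\<exists>P Q. \<sigma> x = Some P \<and> \<tau> x = Some Q \<and> ctx rea \<S> \<S>' P Q)"
  shows "ctx rea \<S> \<S>' (subst E \<sigma>) (subst E \<tau>)"
  using assms
proof (induction E)
  case Inaction
  show ?case by (simp add: ctx.rooted rooted_refl)
next
  case (Var x)
  have "\<sigma> x \<noteq> None" using Var(3) by simp
  then show ?case using Var(4)[of x] by auto
next
  case (Theta L U E)
  have closed: "\<not> occurs_free x E" for x using Theta.prems(2) by (auto simp: guard_simps)
  then have "subst (Theta L U E) \<sigma> = Theta L U E" "subst (Theta L U E) \<tau> = Theta L U E"
    using subst_closed[of "Theta L U E"] by simp_all
  moreover have "process (Theta L U E)"
    using Theta.prems(1) closed by (auto simp: process_def)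
  ultimately show ?case by (metis ctx.rooted rooted_refl)
next
  case (Psi X E)
  have closed: "\<not> occurs_free x E" for x using Psi.prems(2) by (auto simp: guard_simps)
  then have "subst (Psi X E) \<sigma> = Psi X E" "subst (Psi X E) \<tau> = Psi X E"
    using subst_closed[of "Psi X E"] by simp_all
  moreover have "process (Psi X E)"
    using Psi.prems(1) closed by (auto simp: process_def)
  ultimately show ?case by (metis ctx.rooted rooted_refl)
next
  case (Rec z \<T>)
  have closed: "closed_map \<sigma>" "closed_map \<tau>"
    using Rec.prems(4) ctx_process unfolding closed_map_def by (metis option.distinct(1) option.inject)+
  have "\<tau> x \<noteq> None" if "occurs_free x (Rec z \<T>)" for x
    using Rec.prems(3)[OF that] Rec.prems(4)[of x] by auto
  then have "process (subst (Rec z \<T>) \<sigma>)" "process (subst (Rec z \<T>) \<tau>)"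
    using process_subst closed Rec.prems(1,3) by blast+
  then show ?case
    using Rec.prems by (intro ctx.subst)
qed (auto simp: valid_exprs_def guard_simps intro: ctx.intros)

end

lemma (in rec_pair) rec_pair_sym: "rec_pair rea \<S>' \<S>"
proof
  show "rooted rea (subst E \<sigma>) (subst E' \<sigma>)"
    if "\<S>' y = Some E" "\<S> y = Some E'" "closed_map \<sigma>" "dom \<S>' \<subseteq> dom \<sigma>" for y E E' \<sigma>
    using body[OF that(2,1,3)] that(4) dom rooted_sym by blast
qed (use dom process in auto)

lemma ctx_sym: "ctx rea \<S> \<S>' P Q \<Longrightarrow> dom \<S> = dom \<S>' \<Longrightarrow> ctx rea \<S>' \<S> Q P"
proof (induction rule: ctx.induct)
  case (subst z \<T> \<sigma> \<tau>)
  then show ?case by (intro ctx.subst) blast+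
qed (auto intro: ctx.intros rooted_sym simp del: domIff)

section \<open>Inversion of the context closure\<close>

lemma ctx_PlusE:
  assumes "ctx rea \<S> \<S>' (Plus P G) Z"
  obtains "rooted rea (Plus P G) Z"
    | Q H where "Z = Plus Q H" "ctx rea \<S> \<S>' P Q" "ctx rea \<S> \<S>' G H"
  using assms by (cases rule: ctx.cases) auto

lemma ctx_PrefixE:
  assumes "ctx rea \<S> \<S>' (Prefix \<alpha> P) Z"
  obtains "rooted rea (Prefix \<alpha> P) Z" | Q where "Z = Prefix \<alpha> Q" "ctx rea \<S> \<S>' P Q"
  using assms by (cases rule: ctx.cases) auto

lemma ctx_ParE:
  assumes "ctx rea \<S> \<S>' (Par S P G) Z"
  obtains "rooted rea (Par S P G) Z"
    | Q H where "Z = Par S Q H" "ctx rea \<S> \<S>' P Q" "ctx rea \<S> \<S>' G H"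
  using assms by (cases rule: ctx.cases) auto

lemma ctx_HideE:
  assumes "ctx rea \<S> \<S>' (Hide I P) Z"
  obtains "rooted rea (Hide I P) Z" | Q where "Z = Hide I Q" "ctx rea \<S> \<S>' P Q"
  using assms by (cases rule: ctx.cases) auto

lemma ctx_RenameE:
  assumes "ctx rea \<S> \<S>' (Rename \<R> P) Z"
  obtains "rooted rea (Rename \<R> P) Z"
    | Q where "Z = Rename \<R> Q" "ctx rea \<S> \<S>' P Q" "\<And>a. finite {b. (a, b) \<in> \<R>}"
  using assms by (cases rule: ctx.cases) auto

lemma ctx_ThetaE: "ctx rea \<S> \<S>' (Theta L U P) Z \<Longrightarrow> rooted rea (Theta L U P) Z"
  by (cases rule: ctx.cases) auto

lemma ctx_PsiE: "ctx rea \<S> \<S>' (Psi X P) Z \<Longrightarrow> rooted rea (Psi X P) Z"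
  by (cases rule: ctx.cases) auto

lemma rmatch_if_steps: "process P \<Longrightarrow> (\<And>\<alpha> P'. step P \<alpha> P' \<Longrightarrow> step Q \<alpha> P') \<Longrightarrow> rmatch rea P Q"
  unfolding rmatch_def using sim_after_refl step_process by blast

text \<open>Unfolding \<open>\<S>\<close> against \<open>\<S>'\<close> changes the body and the
  calls inside it at once. Passing through the body from \<open>\<S>\<close> with calls to
  \<open>\<S>'\<close> separates the two: changing the calls stays within \<open>ctx\<close>, and
  changing the body is a rooted step that \<open>rmatch\<close> absorbs.\<close>

lemma (in rec_pair) ctx_RecE:
  assumes "ctx rea \<S> \<S>' (Rec x \<T>) Z" and E: "\<T> x = Some E"
  obtains "rooted rea (Rec x \<T>) Z" | Z' where "ctx rea \<S> \<S>' (unfold_rec E \<T>) Z'" "rmatch rea Z' Z"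
  using assms(1)
proof (cases rule: ctx.cases)
  case rooted
  then show ?thesis using that(1) by blast
next
  case Rec
  then obtain E' where E': "\<S>' x = Some E'" using dom by blast
  have proc: "process (Rec x \<S>)" "process (Rec x \<S>')" using process Rec(3) by blast+
  have ES: "\<S> x = Some E" using E Rec by simp
  have cmap: "closed_map (rec_map \<S>')" "dom \<S> \<subseteq> dom (rec_map \<S>')"
    using closed_rec_map[OF proc(2)] dom by (auto simp: rec_map_def)
  have "ctx rea \<S> \<S>' (unfold_rec E \<S>) (unfold_rec E \<S>')"
    unfolding unfold_rec_map
  proof (rule ctx_subst)
    show "\<not> occurs_free z F" if "guard F E" for F z
    proof (rule process_guard_closed[OF proc(1)])
      show "guard F (Rec x \<S>)" using that ES by (auto simp: guard_simps)
    qed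
    show "E \<in> valid_exprs" "\<And>x. occurs_free x E \<Longrightarrow> rec_map \<S> x \<noteq> None"
      using process_Rec_body[OF proc(1) ES] by (auto simp: rec_map_def)
    show "rec_map \<S> x = None \<and> rec_map \<S>' x = None \<or>
        (\<exists>P Q. rec_map \<S> x = Some P \<and> rec_map \<S>' x = Some Q \<and> ctx rea \<S> \<S>' P Q)" for x
      using ctx.Rec[of x \<S> rea \<S>'] dom by (auto simp: rec_map_def)
  qed
  moreover have "rooted rea (unfold_rec E \<S>') (unfold_rec E' \<S>')"
    unfolding unfold_rec_map by (rule body[OF ES E' cmap])
  then have "rmatch rea (unfold_rec E \<S>') Z"
    using step_Rec[OF proc(2) E'] Rec by (simp add: rooted_def rmatch_def)
  ultimately show ?thesis using that(2) Rec by blast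
next
  case (subst z \<T>0 \<sigma> \<tau>)
  have z: "z = x" using subst(1) by simp
  obtain E0 where E0: "\<T>0 x = Some E0" using subst(1) E by auto
  have dom_map: "dom (\<lambda>x. map_option f (\<T>0 x)) = dom \<T>0" for f :: "('a, 'v) expr \<Rightarrow> ('a, 'v) expr"
    by (auto simp: dom_def)
  have closed: "closed_map \<sigma>" "closed_map \<tau>"
    using subst(7) ctx_process unfolding closed_map_def by (metis option.distinct(1) option.inject)+
  \<comment> \<open>This is the nested specification as closed by \<open>\<rho>\<close>.\<close>
  define U where "U \<rho> = (\<lambda>x. map_option (\<lambda>E. subst E (\<rho> |` (- dom \<T>0))) (\<T>0 x))" for \<rho>
  have U: "subst (Rec y \<T>0) \<rho> = Rec y (U \<rho>)" "dom (U \<rho>) = dom \<T>0" for y \<rho>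
    by (simp_all add: U_def dom_map)
  \<comment> \<open>Closing and then unfolding is a single substitution into the original body:
    bound variables become calls of the closed specification, the others are replaced by
    \<open>\<rho>\<close>. In this form both sides share \<open>E0\<close>, as
    \<open>ctx_subst\<close> demands.\<close>
  have unf: "unfold_rec (subst E0 (\<rho> |` (- dom \<T>0))) (U \<rho>) = subst E0 (rec_map (U \<rho>) ++ \<rho> |` (- dom \<T>0))"
    if "closed_map \<rho>" for \<rho>
    unfolding unfold_rec_map by (rule subst_subst[OF closed_map_restrict[OF that]])
  have "\<T> = U \<sigma>" using subst(1) U(1) by simp
  have E': "E = subst E0 (\<sigma> |` (- dom \<T>0))"
    using E E0 \<open>\<T> = U \<sigma>\<close> by (simp add: U_def)
  have ctx_all: "ctx rea \<S> \<S>' (Rec y (U \<sigma>)) (Rec y (U \<tau>))" if y: "y \<in> dom \<T>0" for y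
  proof -
    have "ctx rea \<S> \<S>' (subst (Rec y \<T>0) \<sigma>) (subst (Rec y \<T>0) \<tau>)"
    proof (rule ctx.subst)
      show "process (subst (Rec y \<T>0) \<sigma>)" "process (subst (Rec y \<T>0) \<tau>)"
        using subst(3,4) y process_Rec_cong unfolding U by (metis U(2))+
      show "Rec y \<T>0 \<in> valid_exprs" using subst(5) y by (auto simp: valid_exprs_def)
      show "\<not> occurs_free v F" if "guard F (Rec y \<T>0)" for F v
        using subst(6) that by (simp add: guard_simps)
    qed (rule subst(7))
    then show ?thesis unfolding U .
  qed
  have "ctx rea \<S> \<S>' (unfold_rec E \<T>) (unfold_rec (subst E0 (\<tau> |` (- dom \<T>0))) (U \<tau>))"
    unfolding E' \<open>\<T> = U \<sigma>\<close> unf[OF closed(1)] unf[OF closed(2)]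
  proof (rule ctx_subst)
    show "E0 \<in> valid_exprs" using subst(5) E0 by (auto simp: valid_exprs_def)
    show "\<not> occurs_free v F" if "guard F E0" for F v
      using subst(6) that E0 by (auto simp: guard_simps)
    show "(rec_map (U \<sigma>) ++ \<sigma> |` (- dom \<T>0)) v \<noteq> None" if "occurs_free v E0" for v
    proof -
      have "occurs_free v (Rec z \<T>0) \<Longrightarrow> \<sigma> v \<noteq> None"
        using subst(3) occurs_free_subst[OF closed(1), of v "Rec z \<T>0"] unfolding process_alt by metis
      then show ?thesis
        using that E0 by (cases "v \<in> dom \<T>0") (auto simp: map_add_def restrict_map_def rec_map_def U(2) split: option.splits)
    qed
    show "(rec_map (U \<sigma>) ++ \<sigma> |` (- dom \<T>0)) v = None \<and> (rec_map (U \<tau>) ++ \<tau> |` (- dom \<T>0)) v = None \<or>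
      (\<exists>P Q. (rec_map (U \<sigma>) ++ \<sigma> |` (- dom \<T>0)) v = Some P \<and>
        (rec_map (U \<tau>) ++ \<tau> |` (- dom \<T>0)) v = Some Q \<and> ctx rea \<S> \<S>' P Q)" for v
    proof (cases "v \<in> dom \<T>0")
      case True
      then show ?thesis using ctx_all[OF True]
        by (auto simp: map_add_def restrict_map_def rec_map_def U(2))
    next
      case False
      then show ?thesis using subst(7)[of v]
        by (auto simp: map_add_def restrict_map_def rec_map_def U(2))
    qed
  qed
  moreover have "rmatch rea (unfold_rec (subst E0 (\<tau> |` (- dom \<T>0))) (U \<tau>)) Z"
  proof (rule rmatch_if_steps)
    have p: "process (Rec x (U \<tau>))" using subst(4) z U(1) by simp
    have b: "U \<tau> x = Some (subst E0 (\<tau> |` (- dom \<T>0)))" using E0 by (simp add: U_def)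
    show "process (unfold_rec (subst E0 (\<tau> |` (- dom \<T>0))) (U \<tau>))"
      by (rule process_unfold[OF p b])
    show "step Z \<alpha> P'" if "step (unfold_rec (subst E0 (\<tau> |` (- dom \<T>0))) (U \<tau>)) \<alpha> P'" for \<alpha> P'
      using that step_Rec[OF p b] subst(2) z U(1) by simp
  qed
  ultimately show ?thesis using that(2) by blast
qed

lemma okt_Plus: "process P \<Longrightarrow> process Q \<Longrightarrow> okt rea X (Plus P Q) \<Longrightarrow> okt rea X P \<and> okt rea X Q"
  by (auto simp: okt_def idle_def initials_def step_Plus)

lemma okt_Par_left: "process P \<Longrightarrow> process G \<Longrightarrow> okt rea X (Par S P G) \<Longrightarrow>
    okt rea (avail X S G) P \<and> okt rea (X - S) G"
  by (auto simp: okt_def idle_Par)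

lemma okt_Par_right: "process P \<Longrightarrow> process G \<Longrightarrow> okt rea X (Par S G P) \<Longrightarrow>
    okt rea (avail X S G) P \<and> okt rea (X - S) G"
proof -
  assume *: "process P" "process G" "okt rea X (Par S G P)"
  have "(\<exists>R. step (Par S G P) \<alpha> R) \<longleftrightarrow> (\<exists>R. step (Par S P G) \<alpha> R)" for \<alpha>
    using *(1,2) by (simp add: step_Par) blast
  then have "initials step (Par S G P) = initials step (Par S P G)"
    by (simp add: initials_def)
  with * show ?thesis using okt_Par_left okt_initials by blast
qed

context rec_pair
begin

text \<open>The \<open>ctx\<close> derivative and the residual bisimilarity are pushed through
  \<open>f\<close> separately, the latter from the environment \<open>pre X\<close> of the argument
  to \<open>X\<close>.\<close>

lemma ctx_relabel:
  assumes "relabel f ren" "ren \<beta> \<alpha>" "process Q"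
    and ctx_f: "\<And>P Q. ctx rea \<S> \<S>' P Q \<Longrightarrow> ctx rea \<S> \<S>' (f P) (f Q)"
    and IH: "\<exists>R Q'. step Q \<beta> Q' \<and> ctx rea \<S> \<S>' P' R \<and> sim_after rea \<beta> (relabel.pre ren X) R Q'"
  shows "\<exists>R Q'. step (f Q) \<alpha> Q' \<and> ctx rea \<S> \<S>' (f P') R \<and> sim_after rea \<alpha> X R Q'"
proof -
  obtain R Q' where R: "step Q \<beta> Q'" "ctx rea \<S> \<S>' P' R" "sim_after rea \<beta> (relabel.pre ren X) R Q'"
    using IH by blast
  have "step (f Q) \<alpha> (f Q')"
    using relabel.step[OF assms(1,3)] R(1) assms(2) by blast
  moreover have "sim_after rea \<alpha> X (f R) (f Q')"
    by (rule relabel.sim_after_cong[OF assms(1,2) R(3)])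
  ultimately show ?thesis using ctx_f[OF R(2)] by blast
qed

text \<open>
  \<open>initials_ok\<close> is needed to match time-outs of parallel compositions. It follows from
  the matching of the other actions, which does not use it.
\<close>

definition initials_ok :: bool where
  "initials_ok \<longleftrightarrow> (\<forall>P Q. ctx rea \<S> \<S>' P Q \<longrightarrow> initials step P = initials step Q)"

text \<open>\<open>P'\<close> serves as its own context partner, by reflexivity, and all of the
  matching goes into \<open>sim_after\<close>. This also settles \<open>\<theta>\<close> and
  \<open>\<psi>\<close>, whose terms enter \<open>ctx\<close> only as rooted pairs, so that negative
  premises are never analysed.\<close>

lemma rooted_case:
  assumes "rooted rea P Q" "derivable step P \<alpha> P'" "\<alpha> = Timeout \<longrightarrow> okt rea X P \<and> initials_ok"
  shows "\<exists>R Q'. step Q \<alpha> Q' \<and> ctx rea \<S> \<S>' P' R \<and> sim_after rea \<alpha> X R Q'"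
proof -
  have P: "process P" and m: "rmatch rea P Q" using assms(1) by (simp_all add: rooted_def)
  have "step P \<alpha> P'" using assms(2) step_iff_derivable_step[OF P] by blast
  moreover from this have "ctx rea \<S> \<S>' P' P'"
    using step_process P by (intro ctx.rooted rooted_refl)
  ultimately show ?thesis using rmatchD[OF m] assms(3) by blast
qed

text \<open>The induction follows the derivation because unfolding a recursion is not structurally
  decreasing. \<open>X\<close> is generalized along with \<open>Q\<close>, as an argument sees
  another environment than its context: \<open>avail X S G\<close> below \<open>Par\<close>,
  \<open>pre X\<close> below hiding and renaming.\<close>

lemma ctx_derivable_step:
  "derivable step P \<alpha> P' \<Longrightarrow> ctx rea \<S> \<S>' P Q \<Longrightarrow> (\<alpha> = Timeout \<longrightarrow> okt rea X P \<and> initials_ok) \<Longrightarrow>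
     \<exists>R Q'. step Q \<alpha> Q' \<and> ctx rea \<S> \<S>' P' R \<and> sim_after rea \<alpha> X R Q'"
proof (induction arbitrary: Q X rule: derivable.induct)
  case (1 \<alpha> P)
  note IH = 1
  from IH(1) show ?case
  proof (cases rule: ctx_PrefixE)
    case 1
    then show ?thesis by (rule rooted_case[OF _ derivable.intros(1) IH(2)])
  next
    case (2 Q')
    then show ?thesis using ctx_process[OF 2(2)] step_Prefix sim_after_refl by blast
  qed
next
  case (2 P \<alpha> P' G)
  note IH = 2
  from IH(3) show ?case
  proof (cases rule: ctx_PlusE)
    case 1
    then show ?thesis by (rule rooted_case[OF _ derivable.intros(2)[OF IH(1)] IH(4)])
  next
    case (2 Q' H)
    have "process P" "process G" "process Q'" "process H"
      using ctx_process 2 by blast+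
    then show ?thesis
      using IH(2)[OF 2(2), of X] okt_Plus[of P G rea X] IH(4) 2 step_Plus[of Q' H] by blast
  qed
next
  case (3 P \<alpha> P' G)
  note IH = 3
  from IH(3) show ?case
  proof (cases rule: ctx_PlusE)
    case 1
    then show ?thesis by (rule rooted_case[OF _ derivable.intros(3)[OF IH(1)] IH(4)])
  next
    case (2 H Q')
    have "process P" "process G" "process Q'" "process H"
      using ctx_process 2 by blast+
    then show ?thesis
      using IH(2)[OF 2(3), of X] okt_Plus[of G P rea X] IH(4) 2 step_Plus[of H Q'] by blast
  qed
next
  case (4 P a P' b \<R>)
  note IH = 4
  from IH(4) show ?case
  proof (cases rule: ctx_RenameE)
    case 1
    then show ?thesis by (rule rooted_case[OF _ derivable.intros(4)[OF IH(1,2)] IH(5)])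
  next
    case (2 Q')
    show ?thesis unfolding 2(1)
      by (rule ctx_relabel[OF relabel_Rename[OF 2(3)], where \<beta> = "Vis a"])
        (use 2 IH(2,3) ctx_process ctx.Rename[OF _ 2(3)] in \<open>auto simp: rename_act_def\<close>)
  qed
next
  case (5 P P' \<R>)
  note IH = 5
  from IH(3) show ?case
  proof (cases rule: ctx_RenameE)
    case 1
    then show ?thesis by (rule rooted_case[OF _ derivable.intros(5)[OF IH(1)] IH(4)])
  next
    case (2 Q')
    show ?thesis unfolding 2(1)
      by (rule ctx_relabel[OF relabel_Rename[OF 2(3)], where \<beta> = Tau])
        (use 2 IH(2) ctx_process ctx.Rename[OF _ 2(3)] in \<open>auto simp: rename_act_def\<close>)
  qed
next
  case (6 P P' \<R>)
  note IH = 6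
  from IH(3) show ?case
  proof (cases rule: ctx_RenameE)
    case 1
    then show ?thesis by (rule rooted_case[OF _ derivable.intros(6)[OF IH(1)] IH(4)])
  next
    case (2 Q')
    note rel = relabel_Rename[OF 2(3)]
    have "okt rea (relabel.pre (rename_act \<R>) X) P"
      using relabel.okt_pre[OF rel] IH(4) ctx_process[OF 2(2)] by blast
    then show ?thesis unfolding 2(1)
      by (intro ctx_relabel[OF rel, where \<beta> = Timeout])
        (use 2 IH(2,4) ctx_process ctx.Rename[OF _ 2(3)] in \<open>auto simp: rename_act_def\<close>)
  qed
next
  case (7 P \<alpha> P' S G)
  note IH = 7
  from IH(4) show ?case
  proof (cases rule: ctx_ParE)
    case 1
    then show ?thesis by (rule rooted_case[OF _ derivable.intros(7)[OF IH(1,2)] IH(5)])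
  next
    case (2 Q' H)
    have proc: "process P" "process G" "process Q'" "process H"
      using ctx_process 2 by blast+
    have okt: "okt rea (avail X S G) P \<and> okt rea (X - S) G" if "\<alpha> = Timeout"
      using okt_Par_left[OF proc(1,2)] IH(5) that by blast
    obtain R Q'' where R: "step Q' \<alpha> Q''" "ctx rea \<S> \<S>' P' R" "sim_after rea \<alpha> (avail X S G) R Q''"
      using IH(3)[OF 2(2)] IH(5) okt by blast
    have "step Q \<alpha> (Par S Q'' H)" unfolding 2(1) using R(1) IH(2) proc(3,4) by (rule step_Par_left)
    moreover have "ctx rea \<S> \<S>' (Par S P' G) (Par S R H)" using R(2) 2(3) by (rule ctx.Par)
    moreover have "sim_after rea \<alpha> X (Par S R H) (Par S Q'' H)"
    proof (cases "\<alpha> = Timeout")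
      case True
      \<comment> \<open>The answer lives beside \<open>H\<close>, whose offers determine the
        environment of the first component; equal initial actions make this the environment in which
        \<open>R\<close> and \<open>Q''\<close> are related.\<close>
      have eq: "initials step G = initials step H"
        using IH(5) True 2(3) unfolding initials_ok_def by blast
      have "avail X S G = avail X S H" "okt rea (X - S) H"
        using eq okt[OF True] okt_initials[OF eq] by (simp_all add: avail_def)
      then show ?thesis
        using R(3) True sim3_Par_left[of rea R X S H Q''] proc by (simp add: sim_after_def)
    next
      case False
      then show ?thesis using R(3) sim_Par_left proc by (simp add: sim_after_def)
    qed
    ultimately show ?thesis by blast
  qed
next
  case (8 P \<alpha> P' S G)
  note IH = 8
  from IH(4) show ?case
  proof (cases rule: ctx_ParE)
    case 1
    then show ?thesis by (rule rooted_case[OF _ derivable.intros(8)[OF IH(1,2)] IH(5)])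
  next
    case (2 H Q')
    have proc: "process P" "process G" "process Q'" "process H"
      using ctx_process 2 by blast+
    have okt: "okt rea (avail X S G) P \<and> okt rea (X - S) G" if "\<alpha> = Timeout"
      using okt_Par_right[OF proc(1,2)] IH(5) that by blast
    obtain R Q'' where R: "step Q' \<alpha> Q''" "ctx rea \<S> \<S>' P' R" "sim_after rea \<alpha> (avail X S G) R Q''"
      using IH(3)[OF 2(3)] IH(5) okt by blast
    have "step Q \<alpha> (Par S H Q'')" unfolding 2(1) using R(1) IH(2) proc(4,3) by (rule step_Par_right)
    moreover have "ctx rea \<S> \<S>' (Par S G P') (Par S H R)" using 2(2) R(2) by (rule ctx.Par)
    moreover have "sim_after rea \<alpha> X (Par S H R) (Par S H Q'')"
    proof (cases "\<alpha> = Timeout")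
      case True
      have eq: "initials step G = initials step H"
        using IH(5) True 2(2) unfolding initials_ok_def by blast
      have "avail X S G = avail X S H" "okt rea (X - S) H"
        using eq okt[OF True] okt_initials[OF eq] by (simp_all add: avail_def)
      then show ?thesis
        using R(3) True sim3_Par_right[of rea R X S H Q''] proc by (simp add: sim_after_def)
    next
      case False
      then show ?thesis using R(3) sim_Par[OF sim_refl[OF proc(4)]] by (simp add: sim_after_def)
    qed
    ultimately show ?thesis by blast
  qed
next
  case (9 P a P' G G' S)
  note IH = 9
  from IH(6) show ?case
  proof (cases rule: ctx_ParE)
    case 1
    then show ?thesis by (rule rooted_case[OF _ derivable.intros(9)[OF IH(1,2,3)] IH(7)])
  next
    case (2 Q' H)
    have proc: "process Q'" "process H"
      using ctx_process 2 by blast+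
    obtain R Q'' where R: "step Q' (Vis a) Q''" "ctx rea \<S> \<S>' P' R" "sim rea R Q''"
      using IH(4)[OF 2(2)] by (auto simp: sim_after_def)
    obtain T H' where T: "step H (Vis a) H'" "ctx rea \<S> \<S>' G' T" "sim rea T H'"
      using IH(5)[OF 2(3)] by (auto simp: sim_after_def)
    have "step Q (Vis a) (Par S Q'' H')"
      unfolding 2(1) using R(1) T(1) IH(3) proc by (rule step_Par_sync)
    moreover have "ctx rea \<S> \<S>' (Par S P' G') (Par S R T)" using R(2) T(2) by (rule ctx.Par)
    moreover have "sim_after rea (Vis a) X (Par S R T) (Par S Q'' H')"
      by (rule sim_sim_after[OF sim_Par[OF R(3) T(3)]])
    ultimately show ?thesis by blast
  qed
next
  case (10 P \<alpha> P' I)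
  note IH = 10
  from IH(4) show ?case
  proof (cases rule: ctx_HideE)
    case 1
    then show ?thesis by (rule rooted_case[OF _ derivable.intros(10)[OF IH(1,2)] IH(5)])
  next
    case (2 Q')
    have "okt rea (relabel.pre (hide_act I) X) P" if "\<alpha> = Timeout"
      using relabel.okt_pre[OF relabel_Hide] IH(5) ctx_process[OF 2(2)] that by blast
    then show ?thesis unfolding 2(1)
      by (intro ctx_relabel[OF relabel_Hide, where \<beta> = \<alpha>])
        (use 2 IH(2,3,5) ctx_process ctx.Hide in \<open>auto simp: hide_act_def\<close>)
  qed
next
  case (11 P a P' I)
  note IH = 11
  from IH(4) show ?case
  proof (cases rule: ctx_HideE)
    case 1
    then show ?thesis by (rule rooted_case[OF _ derivable.intros(11)[OF IH(1,2)] IH(5)])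
  next
    case (2 Q')
    show ?thesis unfolding 2(1)
      by (intro ctx_relabel[OF relabel_Hide, where \<beta> = "Vis a"])
        (use 2 IH(2,3) ctx_process ctx.Hide in \<open>auto simp: hide_act_def\<close>)
  qed
next
  case (12 \<T> x E \<alpha> P')
  note IH = 12
  from IH(4,1) show ?case
  proof (cases rule: ctx_RecE)
    case 1
    then show ?thesis by (rule rooted_case[OF _ derivable.intros(12)[OF IH(1,2)] IH(5)])
  next
    case (2 Z')
    have "process (Rec x \<T>)" using ctx_process[OF IH(4)] by blast
    from step_Rec[OF this IH(1)] have "initials step (Rec x \<T>) = initials step (unfold_rec E \<T>)"
      by (simp add: initials_def)
    then have H: "\<alpha> = Timeout \<longrightarrow> okt rea X (unfold_rec E \<T>) \<and> initials_ok"
      using IH(5) okt_initials by blast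
    then obtain R Z'' where R: "step Z' \<alpha> Z''" "ctx rea \<S> \<S>' P' R" "sim_after rea \<alpha> X R Z''"
      using IH(3)[OF 2(1), of X] by blast
    \<comment> \<open>\<open>Z'\<close> is only an intermediate answer; to pass its time-out on to
      \<open>Q\<close> it must satisfy \<open>okt\<close> itself.\<close>
    have "\<alpha> = Timeout \<Longrightarrow> okt rea X Z'"
      using H 2(1) okt_initials unfolding initials_ok_def by blast
    then obtain Q' where "step Q \<alpha> Q'" "sim_after rea \<alpha> X Z'' Q'"
      using rmatchD[OF 2(2) R(1)] by blast
    then show ?thesis using R sim_after_trans by blast
  qed
next
  case (13 P P' L U)
  show ?case by (rule rooted_case[OF ctx_ThetaE[OF 13(3)] derivable.intros(13)[OF 13(1)] 13(4)])
next
  case (14 P a P' U L)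
  show ?case by (rule rooted_case[OF ctx_ThetaE[OF 14(4)] derivable.intros(14)[OF 14(1,2)] 14(5)])
next
  case (15 P \<alpha> P' L U)
  show ?case by (rule rooted_case[OF ctx_ThetaE[OF 15(4)] derivable.intros(15)[OF 15(1,2)] 15(5)])
next
  case (16 P \<alpha> P' Y)
  show ?case by (rule rooted_case[OF ctx_PsiE[OF 16(4)] derivable.intros(16)[OF 16(1,2)] 16(5)])
next
  case (17 P P' Y)
  show ?case by (rule rooted_case[OF ctx_PsiE[OF 17(4)] derivable.intros(17)[OF 17(1,2)] 17(5)])
qed

text \<open>Initial actions exclude time-outs, so this instance of the matching does not presuppose
  \<open>initials_ok\<close>.\<close>

lemma ctx_initials_le:
  assumes "ctx rea \<S> \<S>' P Q"
  shows "initials step P \<subseteq> initials step Q"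
proof
  fix \<alpha> assume "\<alpha> \<in> initials step P"
  then obtain P' where "\<alpha> \<noteq> Timeout" "step P \<alpha> P'" by (auto simp: initials_def)
  with ctx_derivable_step[OF step_derivable assms, of \<alpha> P'] show "\<alpha> \<in> initials step Q"
    unfolding initials_def by blast
qed

end

lemma (in rec_pair) ctx_step:
  assumes PQ: "ctx rea \<S> \<S>' P Q" and P': "step P \<alpha> P'" "\<alpha> = Timeout \<Longrightarrow> okt rea X P"
  shows "\<exists>R Q'. step Q \<alpha> Q' \<and> ctx rea \<S> \<S>' P' R \<and> sim_after rea \<alpha> X R Q'"
proof -
  have initials_ok
    unfolding initials_ok_def
    using ctx_initials_le rec_pair.ctx_initials_le[OF rec_pair_sym] ctx_sym[OF _ dom] by blast
  with ctx_derivable_step[OF step_derivable[OF P'(1)] PQ] P'(2) show ?thesis by blast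
qed

text \<open>\<open>ctx\<close> is directed from \<open>\<S>\<close> to \<open>\<S>'\<close>; its
  union with the opposite direction is symmetric, and the matching holds both ways by
  \<open>rec_pair_sym\<close>.\<close>

lemma (in rec_pair) ctx_sim:
  assumes "ctx rea \<S> \<S>' P Q"
  shows "sim rea P Q"
proof (rule sim_upto)
  let ?C = "\<lambda>P Q. ctx rea \<S> \<S>' P Q \<or> ctx rea \<S>' \<S> P Q"
  show "?C P Q" using assms by blast
  show "sym_on_processes ?C"
    unfolding sym_on_processes_def
    using ctx_sym[OF _ dom] ctx_sym[OF _ dom[symmetric]] ctx_process
      rec_pair.ctx_process[OF rec_pair_sym] by blast
  show "\<exists>R Q'. step Q \<alpha> Q' \<and> ?C P' R \<and> sim_after rea \<alpha> X R Q'"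
    if "?C P Q" "step P \<alpha> P'" "\<alpha> = Timeout \<Longrightarrow> okt rea X P" for P Q \<alpha> P' X
    using that(1) ctx_step[OF _ that(2,3)] rec_pair.ctx_step[OF rec_pair_sym _ that(2,3)] by blast
qed

text \<open>The first step is matched strongly, and the \<open>ctx\<close> part of the derivatives
  is absorbed into bisimilarity by \<open>ctx_sim\<close>; this is what lifts bisimilarity to the
  rooted relation.\<close>

lemma (in rec_pair) ctx_rmatch:
  assumes "ctx rea \<S> \<S>' P Q"
  shows "rmatch rea P Q"
  unfolding rmatch_def
proof (intro allI impI)
  fix \<alpha> P' X assume "step P \<alpha> P'" "\<alpha> = Timeout \<longrightarrow> okt rea X P"
  then obtain R Q' where "step Q \<alpha> Q'" "ctx rea \<S> \<S>' P' R" "sim_after rea \<alpha> X R Q'"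
    using ctx_step[OF assms] by blast
  then show "\<exists>Q'. step Q \<alpha> Q' \<and> sim_after rea \<alpha> X P' Q'"
    using sim_sim_after[OF ctx_sim] sim_after_trans by blast
qed

lemma (in rec_pair) ctx_rooted: "ctx rea \<S> \<S>' P Q \<Longrightarrow> rooted rea P Q"
  unfolding rooted_def
  using ctx_process ctx_rmatch rec_pair.ctx_rmatch[OF rec_pair_sym] ctx_sym[OF _ dom] by blast

section \<open>Full congruence on open expressions\<close>

text \<open>With empty specifications \<open>ctx\<close> is a closure of rooted bisimilarity under
  contexts alone, so congruence for prefix, sum and the static operators other than
  \<open>\<theta>\<close> is a special case of the argument for recursion.\<close>

interpretation no_rec: rec_pair rea Map.empty Map.empty for rea
  by unfold_locales auto

lemma rooted_cong:
  assumes "rooted rea P Q"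
  shows "rooted rea (Prefix \<alpha> P) (Prefix \<alpha> Q)"
    "rooted rea G H \<Longrightarrow> rooted rea (Plus P G) (Plus Q H)"
    "rooted rea G H \<Longrightarrow> rooted rea (Par S P G) (Par S Q H)"
    "rooted rea (Hide I P) (Hide I Q)"
    "(\<And>a. finite {b. (a, b) \<in> \<R>}) \<Longrightarrow> rooted rea (Rename \<R> P) (Rename \<R> Q)"
  by (rule no_rec.ctx_rooted; use assms in \<open>blast intro: ctx.intros\<close>)+

lemma equiv_open_extension: "equiv valid_exprs (open_extension (rooted rea :: ('a, 'v) rel2))"
proof (rule equivI)
  show "open_extension (rooted rea :: ('a, 'v) rel2) \<subseteq> valid_exprs \<times> valid_exprs"
    by (auto simp: open_extension_def)
  show "refl_on valid_exprs (open_extension (rooted rea :: ('a, 'v) rel2))"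
  proof (rule refl_onI)
    fix E :: "('a, 'v) expr" assume E: "E \<in> valid_exprs"
    have "rooted rea (subst E (Some \<circ> \<rho>)) (subst E (Some \<circ> \<rho>))" if "\<forall>x. process (\<rho> x)" for \<rho>
      by (intro rooted_refl process_subst) (use that E in \<open>auto simp: closed_map_def\<close>)
    with E show "(E, E) \<in> open_extension (rooted rea)"
      unfolding open_extension_def by blast
  qed
  show "sym (open_extension (rooted rea :: ('a, 'v) rel2))"
    using rooted_sym by (auto simp: sym_def open_extension_def)
  show "trans (open_extension (rooted rea :: ('a, 'v) rel2))"
    using rooted_trans unfolding trans_def open_extension_def by blast
qed

lemma operator_congruence_rooted: "operator_congruence (open_extension (rooted rea))"
  unfolding operator_congruence_def open_extension_def valid_exprs_def
  by (auto intro: rooted_refl rooted_cong rooted_Theta rooted_Psi)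

lemma recursion_congruence_rooted: "recursion_congruence (open_extension (rooted rea :: ('a, 'v) rel2))"
  unfolding recursion_congruence_def
proof (intro allI impI, elim conjE)
  fix \<S> \<S>' :: "('a, 'v) rspec" and x
  assume dom: "dom \<S> = dom \<S>'" and x: "x \<in> dom \<S>"
    and proc: "process (Rec x \<S>)" "process (Rec x \<S>')"
    and body: "\<forall>y \<in> dom \<S>. (the (\<S> y), the (\<S>' y)) \<in> open_extension (rooted rea)"
  interpret rec_pair rea \<S> \<S>'
  proof
    show "rooted rea (subst E \<sigma>) (subst E' \<sigma>)"
      if E: "\<S> y = Some E" "\<S>' y = Some E'" and \<sigma>: "closed_map \<sigma>" "dom \<S> \<subseteq> dom \<sigma>" for y E E' \<sigma>
    proof -
      \<comment> \<open>\<open>open_extension\<close> quantifies over total substitutions.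
        \<open>Inaction\<close> is a closed dummy outside \<open>dom \<sigma>\<close>; the free
        variables of the bodies lie in \<open>dom \<S> \<subseteq> dom \<sigma>\<close>, so the
        dummy is never inserted.\<close>
      define \<rho> where "\<rho> x = (case \<sigma> x of None \<Rightarrow> Inaction | Some P \<Rightarrow> P)" for x
      have \<rho>: "process (\<rho> x)" for x
        using \<sigma>(1) by (auto simp: \<rho>_def closed_map_def split: option.splits)
      have eq: "subst F \<sigma> = subst F (Some \<circ> \<rho>)" if "\<And>x. occurs_free x F \<Longrightarrow> x \<in> dom \<S>" for F
      proof -
        have "\<not> occurs_free x (subst F \<sigma>)" for x
          using that \<sigma> occurs_free_subst[OF \<sigma>(1)] by blast
        then have "subst F \<sigma> = subst (subst F \<sigma>) (Some \<circ> \<rho>)"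
          by (intro subst_closed[symmetric]) blast
        also have "\<dots> = subst F ((Some \<circ> \<rho>) ++ \<sigma>)" by (rule subst_subst[OF \<sigma>(1)])
        also have "(Some \<circ> \<rho>) ++ \<sigma> = Some \<circ> \<rho>"
          by (auto simp: \<rho>_def map_add_def split: option.splits)
        finally show ?thesis .
      qed
      have "rooted rea (subst E (Some \<circ> \<rho>)) (subst E' (Some \<circ> \<rho>))"
        using body E \<rho> unfolding open_extension_def by force
      then show ?thesis
        using eq process_Rec_body[OF proc(1) E(1)] process_Rec_body[OF proc(2) E(2)] dom by metis
    qed
  qed (use dom process_Rec_cong[OF proc(1)] process_Rec_cong[OF proc(2)] in auto)
  have "rooted rea (Rec x \<S>) (Rec x \<S>')"
    by (rule ctx_rooted[OF ctx.Rec[OF x]])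
  moreover have "subst (Rec x \<S>) \<sigma> = Rec x \<S>" "subst (Rec x \<S>') \<sigma> = Rec x \<S>'" for \<sigma>
    using proc unfolding process_def by (blast intro: subst_closed)+
  ultimately show "(Rec x \<S>, Rec x \<S>') \<in> open_extension (rooted rea)"
    using proc by (simp add: open_extension_def process_def del: subst.simps)
qed

theorem theorem18:
  shows "full_congruence (open_extension (rbr_bisimilar :: ('a, 'v::countable) rel2)) \<and>
         full_congruence (open_extension (rb_bisimilar :: ('a, 'v) rel2))"
  unfolding full_congruence_def rbr_bisimilar_rooted rb_bisimilar_rooted
  by (intro conjI equiv_open_extension operator_congruence_rooted recursion_congruence_rooted)

end
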